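(* Let $\Gamma$ be an icc countable discrete group and let $\Gamma\curvearrowright^{\beta}X_0$ be a pmp action. Let $\Gamma\curvearrowright X$ be an ergodic compact extension of $\beta$, with factor map $\pi:X\to X_0$. Consider the inclusion of crossed product von Neumann algebras $L^\infty(X_0)\rtimes\Gamma\subseteq L^\infty(X)\rtimes\Gamma$. Then for any intermediate von Neumann subalgebra $L^\infty(X_0)\rtimes\Gamma\subseteq N\subseteq L^\infty(X)\rtimes\Gamma$ there exists an intermediate extension $\Gamma\curvearrowright Z$ between $\Gamma\curvearrowright X$ and $\Gamma\curvearrowright X_0$ satisfying $N=L^\infty(Z)\rtimes\Gamma$.
   Context: Pmp means probability measure preserving on a standard probability space; actions are not assumed free. A group is icc if all its nontrivial conjugacy classes are infinite. $\Gamma\curvearrowright X$ is an extension of $\Gamma\curvearrowright X_0$ if there is a $\Gamma$-equivariant factor map $\pi:X\to X_0$; this induces a $\Gamma$-equivariant inclusion $L^\infty(X_0)\subseteq L^\infty(X)$. An intermediate extension between $\Gamma\curvearrowright X_0$ and $\Gamma\curvearrowright X$ is an action $\Gamma\curvearrowright Z$ for which there are $\Gamma$-equivariant factor maps $\pi_1:X\to Z$ and $\pi_2:Z\to X_0$ with $\pi_2\circ\pi_1=\pi$; these correspond to the $\Gamma$-invariant intermediate von Neumann subalgebras $L^\infty(X_0)\subseteq L^\infty(Z)\subseteq L^\infty(X)$. Compact extension (in the sense of Furstenberg): the functions $f\in L^2(X)$ that are almost periodic relative to $X_0$ are dense in $L^2(X)$, where $f$ is almost periodic relative to $X_0$ if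 for every $\varepsilon>0$ there are $g_1,\dots,g_n\in L^2(X)$ such that for every $\gamma\in\Gamma$, $\min_{1\le i\le n}\|\sigma_\gamma(f)-g_i\|_{y}<\varepsilon$ for a.e. $y\in X_0$; here $\sigma_\gamma(f)=f\circ\gamma^{-1}$ and $\|g\|_y^2=E(|g|^2\mid X_0)(y)$. *)

theory Defs
  imports "HOL-Probability.Probability" "HOL-Algebra.Group_Action"
begin

section \<open>Groups and probability measure preserving actions\<close>

definition icc :: "('g, 'm) monoid_scheme \<Rightarrow> bool" where
  "icc G \<longleftrightarrow> (\<forall>g \<in> carrier G. g \<noteq> \<one>\<^bsub>G\<^esub> \<longrightarrow>
     infinite {h \<otimes>\<^bsub>G\<^esub> g \<otimes>\<^bsub>G\<^esub> inv\<^bsub>G\<^esub> h | h. h \<in> carrier G})"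

definition standard_probability_space :: "'x measure \<Rightarrow> bool" where
  "standard_probability_space M \<longleftrightarrow> prob_space M \<and>
     (\<exists>T. topspace T = space M \<and> completely_metrizable_space T \<and> second_countable T \<and>
          sets M = sigma_sets (space M) {U. openin T U})"

text \<open>The action is a genuine action by bijections of the underlying set; since the library's
  groups of bijections consist of extensional maps, \<open>a g x\<close> is only meaningful for
  \<open>x \<in> space M\<close>. It is not assumed to be free.\<close>

definition pmp_action ::
  "('g, 'm) monoid_scheme \<Rightarrow> 'x measure \<Rightarrow> ('g \<Rightarrow> 'x \<Rightarrow> 'x) \<Rightarrow> bool" where
  "pmp_action G M a \<longleftrightarrow> standard_probability_space M \<and> group_action G (space M) a \<and>
     (\<forall>g \<in> carrier G. a g \<in> measurable M M \<and> distr M M (a g) = M)"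

definition ergodic_action ::
  "('g, 'm) monoid_scheme \<Rightarrow> 'x measure \<Rightarrow> ('g \<Rightarrow> 'x \<Rightarrow> 'x) \<Rightarrow> bool" where
  "ergodic_action G M a \<longleftrightarrow> pmp_action G M a \<and>
     (\<forall>A \<in> sets M. (\<forall>g \<in> carrier G. a g -` A \<inter> space M = A) \<longrightarrow>
        measure M A = 0 \<or> measure M A = 1)"

text \<open>As usual for pmp actions, factor maps are equivariant up to null sets.\<close>

definition factor_map ::
  "('g, 'm) monoid_scheme \<Rightarrow> 'x measure \<Rightarrow> ('g \<Rightarrow> 'x \<Rightarrow> 'x) \<Rightarrow>
   'y measure \<Rightarrow> ('g \<Rightarrow> 'y \<Rightarrow> 'y) \<Rightarrow> ('x \<Rightarrow> 'y) \<Rightarrow> bool" where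
  "factor_map G M a M0 b p \<longleftrightarrow> p \<in> measurable M M0 \<and> distr M M0 p = M0 \<and>
     (\<forall>g \<in> carrier G. AE x in M. p (a g x) = b g (p x))"

definition intermediate_extension ::
  "('g, 'm) monoid_scheme \<Rightarrow> 'x measure \<Rightarrow> ('g \<Rightarrow> 'x \<Rightarrow> 'x) \<Rightarrow>
   'y measure \<Rightarrow> ('g \<Rightarrow> 'y \<Rightarrow> 'y) \<Rightarrow> ('x \<Rightarrow> 'y) \<Rightarrow>
   'z measure \<Rightarrow> ('g \<Rightarrow> 'z \<Rightarrow> 'z) \<Rightarrow> ('x \<Rightarrow> 'z) \<Rightarrow> ('z \<Rightarrow> 'y) \<Rightarrow> bool" where
  "intermediate_extension G M a M0 b p Z c p1 p2 \<longleftrightarrow>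
     pmp_action G Z c \<and> factor_map G M a Z c p1 \<and> factor_map G Z c M0 b p2 \<and>
     (AE x in M. p2 (p1 x) = p x)"


section \<open>Hilbert spaces of square integrable functions\<close>

text \<open>Elements of \<open>L\<^sup>2\<close> are represented by functions; equality in \<open>L\<^sup>2\<close> is equality almost
  everywhere.\<close>

definition L2 :: "'x measure \<Rightarrow> ('x \<Rightarrow> complex) set" where
  "L2 M = {f \<in> borel_measurable M. integrable M (\<lambda>x. (cmod (f x))\<^sup>2)}"

definition L2_inner :: "'x measure \<Rightarrow> ('x \<Rightarrow> complex) \<Rightarrow> ('x \<Rightarrow> complex) \<Rightarrow> complex" where
  "L2_inner M f g = (LINT x|M. f x * cnj (g x))"

definition L2_norm :: "'x measure \<Rightarrow> ('x \<Rightarrow> complex) \<Rightarrow> real" where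
  "L2_norm M f = sqrt (LINT x|M. (cmod (f x))\<^sup>2)"

definition Linfty :: "'x measure \<Rightarrow> ('x \<Rightarrow> complex) set" where
  "Linfty M = {f \<in> borel_measurable M. \<exists>C. AE x in M. cmod (f x) \<le> C}"


section \<open>Compact extensions\<close>

definition koopman ::
  "('g, 'm) monoid_scheme \<Rightarrow> ('g \<Rightarrow> 'x \<Rightarrow> 'x) \<Rightarrow> 'g \<Rightarrow> ('x \<Rightarrow> complex) \<Rightarrow> 'x \<Rightarrow> complex" where
  "koopman G a g f = (\<lambda>x. f (a (inv\<^bsub>G\<^esub> g) x))"

text \<open>The conditional expectation \<open>E(\<bar>g\<bar>\<^sup>2 | X\<^sub>0)\<close>, viewed as a function on \<open>X\<close> via
  \<open>L\<^sup>1(X\<^sub>0) \<subseteq> L\<^sup>1(X)\<close>: the value at \<open>x\<close> is the square of the fibre norm at \<open>y = p x\<close>. As \<open>p\<close> is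
  measure preserving, "for a.e. \<open>y\<close> in \<open>X\<^sub>0\<close>" and "for a.e. \<open>x\<close> in \<open>X\<close>" mean the same.\<close>

definition fibre_norm ::
  "'x measure \<Rightarrow> 'y measure \<Rightarrow> ('x \<Rightarrow> 'y) \<Rightarrow> ('x \<Rightarrow> complex) \<Rightarrow> 'x \<Rightarrow> real" where
  "fibre_norm M M0 p g x =
     sqrt (real_cond_exp M (vimage_algebra (space M) p M0) (\<lambda>x. (cmod (g x))\<^sup>2) x)"

definition almost_periodic ::
  "('g, 'm) monoid_scheme \<Rightarrow> 'x measure \<Rightarrow> ('g \<Rightarrow> 'x \<Rightarrow> 'x) \<Rightarrow> 'y measure \<Rightarrow> ('x \<Rightarrow> 'y) \<Rightarrow>
   ('x \<Rightarrow> complex) \<Rightarrow> bool" where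
  "almost_periodic G M a M0 p f \<longleftrightarrow> f \<in> L2 M \<and>
     (\<forall>\<epsilon>>0. \<exists>(n::nat) h. n \<ge> 1 \<and> (\<forall>i<n. h i \<in> L2 M) \<and>
        (\<forall>g \<in> carrier G. AE x in M.
           (MIN i \<in> {..<n}. fibre_norm M M0 p (\<lambda>x'. koopman G a g f x' - h i x') x) < \<epsilon>))"

definition compact_extension ::
  "('g, 'm) monoid_scheme \<Rightarrow> 'x measure \<Rightarrow> ('g \<Rightarrow> 'x \<Rightarrow> 'x) \<Rightarrow>
   'y measure \<Rightarrow> ('g \<Rightarrow> 'y \<Rightarrow> 'y) \<Rightarrow> ('x \<Rightarrow> 'y) \<Rightarrow> bool" where
  "compact_extension G M a M0 b p \<longleftrightarrow>
     pmp_action G M a \<and> pmp_action G M0 b \<and> factor_map G M a M0 b p \<and>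
     (\<forall>f \<in> L2 M. \<forall>\<epsilon>>0. \<exists>h. almost_periodic G M a M0 p h \<and> L2_norm M (\<lambda>x. f x - h x) < \<epsilon>)"


section \<open>Von Neumann algebras on \<open>L\<^sup>2\<close>\<close>

text \<open>Bounded operators are represented by maps on functions whose values outside \<open>L2 M\<close> are
  irrelevant. Linearity and boundedness make them respect equality almost everywhere.\<close>

definition bounded_ops :: "'x measure \<Rightarrow> (('x \<Rightarrow> complex) \<Rightarrow> ('x \<Rightarrow> complex)) set" where
  "bounded_ops M = {T.
     (\<forall>f \<in> L2 M. T f \<in> L2 M) \<and>
     (\<forall>f \<in> L2 M. \<forall>g \<in> L2 M. \<forall>c. AE x in M. T (\<lambda>x. f x + c * g x) x = T f x + c * T g x) \<and>
     (\<exists>K. \<forall>f \<in> L2 M. L2_norm M (T f) \<le> K * L2_norm M f)}"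

definition adjoint_ops ::
  "'x measure \<Rightarrow> (('x \<Rightarrow> complex) \<Rightarrow> ('x \<Rightarrow> complex)) \<Rightarrow> (('x \<Rightarrow> complex) \<Rightarrow> ('x \<Rightarrow> complex)) \<Rightarrow> bool" where
  "adjoint_ops M T S \<longleftrightarrow> (\<forall>f \<in> L2 M. \<forall>g \<in> L2 M. L2_inner M (T f) g = L2_inner M f (S g))"

definition commutant ::
  "'x measure \<Rightarrow> (('x \<Rightarrow> complex) \<Rightarrow> ('x \<Rightarrow> complex)) set \<Rightarrow> (('x \<Rightarrow> complex) \<Rightarrow> ('x \<Rightarrow> complex)) set" where
  "commutant M A = {T \<in> bounded_ops M. \<forall>S \<in> A. \<forall>f \<in> L2 M. AE x in M. T (S f) x = S (T f) x}"

text \<open>A commutant contains with an operator all its representatives, so equality of von Neumann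
  algebras as sets of representatives is equality as sets of operators. Being a unital subalgebra
  follows from the bicommutant condition.\<close>

definition von_neumann_algebra ::
  "'x measure \<Rightarrow> (('x \<Rightarrow> complex) \<Rightarrow> ('x \<Rightarrow> complex)) set \<Rightarrow> bool" where
  "von_neumann_algebra M A \<longleftrightarrow> A \<subseteq> bounded_ops M \<and>
     (\<forall>T \<in> A. \<exists>S \<in> A. adjoint_ops M T S) \<and> commutant M (commutant M A) = A"

definition vn_generated ::
  "'x measure \<Rightarrow> (('x \<Rightarrow> complex) \<Rightarrow> ('x \<Rightarrow> complex)) set \<Rightarrow> (('x \<Rightarrow> complex) \<Rightarrow> ('x \<Rightarrow> complex)) set" where
  "vn_generated M S = \<Inter>{A. von_neumann_algebra M A \<and> S \<subseteq> A}"


section \<open>Crossed products\<close>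

text \<open>The Hilbert space is \<open>L\<^sup>2(X) \<otimes> l\<^sup>2(G) = L\<^sup>2(X \<times> G)\<close>. A function \<open>f\<close> acts as
  multiplication by \<open>f \<otimes> 1\<close>, and \<open>g\<close> acts as the tensor product of the Koopman unitary with the
  left translation.\<close>

definition crossed_space :: "('g, 'm) monoid_scheme \<Rightarrow> 'x measure \<Rightarrow> ('x \<times> 'g) measure" where
  "crossed_space G M = M \<Otimes>\<^sub>M count_space (carrier G)"

definition mult_op :: "('x \<Rightarrow> complex) \<Rightarrow> ('x \<times> 'g \<Rightarrow> complex) \<Rightarrow> ('x \<times> 'g \<Rightarrow> complex)" where
  "mult_op f \<xi> = (\<lambda>(x, h). f x * \<xi> (x, h))"

definition group_op ::
  "('g, 'm) monoid_scheme \<Rightarrow> ('g \<Rightarrow> 'x \<Rightarrow> 'x) \<Rightarrow> 'g \<Rightarrow> ('x \<times> 'g \<Rightarrow> complex) \<Rightarrow> ('x \<times> 'g \<Rightarrow> complex)" where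
  "group_op G a g \<xi> = (\<lambda>(x, h). \<xi> (a (inv\<^bsub>G\<^esub> g) x, inv\<^bsub>G\<^esub> g \<otimes>\<^bsub>G\<^esub> h))"

text \<open>For a factor map \<open>q\<close> from \<open>X\<close> to \<open>Y\<close>, the crossed product of \<open>L\<^sup>\<infinity>(Y)\<close> by \<open>G\<close> as a von
  Neumann subalgebra of the crossed product of \<open>L\<^sup>\<infinity>(X)\<close> by \<open>G\<close>, where \<open>L\<^sup>\<infinity>(Y) \<subseteq> L\<^sup>\<infinity>(X)\<close> via
  \<open>f \<mapsto> f \<circ> q\<close>.\<close>

definition crossed_product_via ::
  "('g, 'm) monoid_scheme \<Rightarrow> 'x measure \<Rightarrow> ('g \<Rightarrow> 'x \<Rightarrow> 'x) \<Rightarrow> 'y measure \<Rightarrow> ('x \<Rightarrow> 'y) \<Rightarrow>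
   (('x \<times> 'g \<Rightarrow> complex) \<Rightarrow> ('x \<times> 'g \<Rightarrow> complex)) set" where
  "crossed_product_via G M a Y q =
     vn_generated (crossed_space G M)
       ({mult_op (\<lambda>x. f (q x)) | f. f \<in> Linfty Y} \<union> group_op G a ` carrier G)"

definition crossed_product ::
  "('g, 'm) monoid_scheme \<Rightarrow> 'x measure \<Rightarrow> ('g \<Rightarrow> 'x \<Rightarrow> 'x) \<Rightarrow>
   (('x \<times> 'g \<Rightarrow> complex) \<Rightarrow> ('x \<times> 'g \<Rightarrow> complex)) set" where
  "crossed_product G M a =
     vn_generated (crossed_space G M) (mult_op ` Linfty M \<union> group_op G a ` carrier G)"

end

theory Submission
  imports Defs
begin

text \<open>Let \<open>e\<close> be the orthogonal projection of \<open>L\<^sup>2(X \<times> G)\<close> onto the closure \<open>K\<close> of \<open>N\<close> applied to the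
  tracial vector \<open>1 \<otimes> \<delta>\<^sub>1\<close>. It commutes with \<open>L\<^sup>\<infinity>(X\<^sub>0)\<close> and with conjugation by group elements, which
  permutes the Fourier coefficients along conjugacy classes and on \<open>L\<^sup>2(X) \<otimes> \<delta>\<^sub>1\<close> is the Koopman
  representation. If \<open>f\<close> is almost periodic relative to \<open>X\<^sub>0\<close>, the conjugates of \<open>e (f \<otimes> \<delta>\<^sub>1)\<close> are
  uniformly close to combinations, with coefficients indicators of subsets of \<open>X\<^sub>0\<close>, of finitely many
  vectors; as nontrivial conjugacy classes are infinite, the coefficients of \<open>e (f \<otimes> \<delta>\<^sub>1)\<close> off the
  identity vanish. By compactness \<open>e\<close> preserves \<open>L\<^sup>2(X) \<otimes> \<delta>\<^sub>1\<close>, hence the Fourier coefficients of an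
  element of \<open>N\<close> lie in \<open>N\<close>, and \<open>N\<close> is generated by the group and the sets whose indicators
  multiply by elements of \<open>N\<close>. These sets form an invariant \<open>\<sigma>\<close>-algebra, which is realized by a
  factor on a space of sequences, copied to the reals by a bijection.\<close>

text \<open>The projection acts on vectors while the theorem is about operators; two facts carry
  results back. Elements of \<open>N\<close> commute with the right multiplications
  \<open>rops\<close>, for which \<open>vac\<close> is cyclic, so an operator is determined by its
  vector; and the vector of an operator commuting with \<open>rops\<close> has bounded slices, so
  each slice is the symbol of a multiplication operator. The trace property compensates for the fact
  that approximation of vectors gives no norm bound on the approximating operators. Relative almost
  periodicity gives an approximant that may change from fibre to fibre. Gluing the approximants by
  indicators of sets pulled back from the base is harmless exactly because multiplication by such an
  indicator lies in \<open>N\<close> and therefore commutes with the projection. The obstacle at the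
  end is that an invariant \<sigma>-algebra must become a standard space with point maps on both
  sides. The map to the base has to be defined on \<open>Z\<close> itself, so the code of a point
  \<open>x\<close> records, besides a dense sequence of sets, the image of \<open>p x\<close> under
  an embedding of the base into sequences.\<close>

section \<open>Square integrable functions as a Hilbert space\<close>

lemma L2_measurable: "f \<in> L2 M \<Longrightarrow> f \<in> borel_measurable M"
  by (simp add: L2_def)

lemma L2_integrable: "f \<in> L2 M \<Longrightarrow> integrable M (\<lambda>x. (cmod (f x))\<^sup>2)"
  by (simp add: L2_def)

lemma L2_bound:
  assumes "g \<in> L2 M" "f \<in> borel_measurable M" "AE x in M. cmod (f x) \<le> C * cmod (g x)"
  shows "f \<in> L2 M"
proof -
  have "integrable M (\<lambda>x. (cmod (f x))\<^sup>2)"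
  proof (rule Bochner_Integration.integrable_bound)
    show "integrable M (\<lambda>x. C\<^sup>2 * (cmod (g x))\<^sup>2)"
      using L2_integrable[OF assms(1)] by simp
    show "(\<lambda>x. (cmod (f x))\<^sup>2) \<in> borel_measurable M" using assms(2) by measurable
    show "AE x in M. norm ((cmod (f x))\<^sup>2) \<le> norm (C\<^sup>2 * (cmod (g x))\<^sup>2)"
      using assms(3)
    proof (eventually_elim)
      case (elim x)
      then have "(cmod (f x))\<^sup>2 \<le> (C * cmod (g x))\<^sup>2" by (intro power_mono) auto
      then show ?case by (simp add: power_mult_distrib)
    qed
  qed
  then show ?thesis using assms(2) by (simp add: L2_def)
qed

lemma L2_zero [simp]: "(\<lambda>x. 0) \<in> L2 M"
  by (simp add: L2_def)

lemma L2_scale [intro]: "f \<in> L2 M \<Longrightarrow> (\<lambda>x. c * f x) \<in> L2 M"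
  by (auto simp: L2_def norm_mult power_mult_distrib)

lemma L2_add [intro]:
  assumes "f \<in> L2 M" "g \<in> L2 M"
  shows "(\<lambda>x. f x + g x) \<in> L2 M"
proof -
  have [measurable]: "f \<in> borel_measurable M" "g \<in> borel_measurable M"
    using assms by (auto intro: L2_measurable)
  have "integrable M (\<lambda>x. (cmod (f x + g x))\<^sup>2)"
  proof (rule Bochner_Integration.integrable_bound)
    show "integrable M (\<lambda>x. 2 * (cmod (f x))\<^sup>2 + 2 * (cmod (g x))\<^sup>2)"
      using assms[THEN L2_integrable] by simp
    have "(cmod (f x + g x))\<^sup>2 \<le> 2 * (cmod (f x))\<^sup>2 + 2 * (cmod (g x))\<^sup>2" for x
    proof -
      have "(cmod (f x + g x))\<^sup>2 \<le> (cmod (f x) + cmod (g x))\<^sup>2"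
        by (intro power_mono norm_triangle_ineq) auto
      also have "\<dots> \<le> 2 * (cmod (f x))\<^sup>2 + 2 * (cmod (g x))\<^sup>2"
        using sum_squares_bound[of "cmod (f x)" "cmod (g x)"] by (simp add: power2_sum)
      finally show ?thesis .
    qed
    then show "AE x in M. norm ((cmod (f x + g x))\<^sup>2) \<le> norm (2 * (cmod (f x))\<^sup>2 + 2 * (cmod (g x))\<^sup>2)"
      by simp
  qed measurable
  then show ?thesis by (simp add: L2_def)
qed

lemma L2_lin [intro]: "f \<in> L2 M \<Longrightarrow> g \<in> L2 M \<Longrightarrow> (\<lambda>x. f x + c * g x) \<in> L2 M"
  by (intro L2_add L2_scale)

lemma L2_diff [intro]:
  assumes "f \<in> L2 M" "g \<in> L2 M"
  shows "(\<lambda>x. f x - g x) \<in> L2 M"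
  using L2_lin[OF assms, of "-1"] by simp

lemma L2_sum [intro]:
  assumes "\<And>i. i \<in> I \<Longrightarrow> f i \<in> L2 M"
  shows "(\<lambda>x. \<Sum>i\<in>I. f i x) \<in> L2 M"
  using assms
proof (induction I rule: infinite_finite_induct)
  case (insert i I)
  then show ?case using L2_add[of "f i" M "\<lambda>x. \<Sum>i\<in>I. f i x"] by simp
qed auto

lemma borel_measurable_cnj [measurable]:
  "f \<in> borel_measurable M \<Longrightarrow> (\<lambda>x. cnj (f x)) \<in> borel_measurable M"
  by (rule borel_measurable_continuous_on[OF continuous_on_cnj[OF continuous_on_id]])

lemma L2_inner_integrable:
  assumes "f \<in> L2 M" "g \<in> L2 M"
  shows "integrable M (\<lambda>x. f x * cnj (g x))"
proof (rule Bochner_Integration.integrable_bound)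
  have [measurable]: "f \<in> borel_measurable M" "g \<in> borel_measurable M"
    using assms by (auto intro: L2_measurable)
  show "integrable M (\<lambda>x. (cmod (f x))\<^sup>2 + (cmod (g x))\<^sup>2)"
    using assms by (auto dest: L2_integrable)
  have "cmod (f x) * cmod (g x) \<le> (cmod (f x))\<^sup>2 + (cmod (g x))\<^sup>2" for x
    using sum_squares_bound[of "cmod (f x)" "cmod (g x)"]
      mult_nonneg_nonneg[of "cmod (f x)" "cmod (g x)"] norm_ge_zero[of "f x"] norm_ge_zero[of "g x"]
    by linarith
  then show "AE x in M. norm (f x * cnj (g x)) \<le> norm ((cmod (f x))\<^sup>2 + (cmod (g x))\<^sup>2)"
    by (simp add: norm_mult)
  show "(\<lambda>x. f x * cnj (g x)) \<in> borel_measurable M" by measurable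
qed

lemma L2_inner_lin_left:
  assumes "f \<in> L2 M" "g \<in> L2 M" "h \<in> L2 M"
  shows "L2_inner M (\<lambda>x. f x + c * g x) h = L2_inner M f h + c * L2_inner M g h"
proof -
  have "L2_inner M (\<lambda>x. f x + c * g x) h = (LINT x|M. f x * cnj (h x) + c * (g x * cnj (h x)))"
    by (simp add: L2_inner_def algebra_simps)
  also have "\<dots> = L2_inner M f h + c * L2_inner M g h"
    unfolding L2_inner_def using assms
    by (subst Bochner_Integration.integral_add) (auto intro: L2_inner_integrable)
  finally show ?thesis .
qed

lemma L2_inner_commute: "L2_inner M g f = cnj (L2_inner M f g)"
proof -
  have "cnj (L2_inner M f g) = (LINT x|M. cnj (f x * cnj (g x)))"
    unfolding L2_inner_def by (rule integral_bounded_linear'[OF bounded_linear_cnj bounded_linear_cnj, symmetric]) simp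
  then show ?thesis by (simp add: L2_inner_def mult.commute)
qed

lemma L2_inner_lin_right:
  assumes "f \<in> L2 M" "g \<in> L2 M" "h \<in> L2 M"
  shows "L2_inner M h (\<lambda>x. f x + c * g x) = L2_inner M h f + cnj c * L2_inner M h g"
  using L2_inner_lin_left[OF assms, of c]
  by (subst (1 2 3) L2_inner_commute) simp

lemma L2_inner_diff_left:
  assumes "f \<in> L2 M" "g \<in> L2 M" "h \<in> L2 M"
  shows "L2_inner M (\<lambda>x. f x - g x) h = L2_inner M f h - L2_inner M g h"
  using L2_inner_lin_left[OF assms, of "-1"] by simp

lemma L2_inner_diff_right:
  assumes "f \<in> L2 M" "g \<in> L2 M" "h \<in> L2 M"
  shows "L2_inner M h (\<lambda>x. f x - g x) = L2_inner M h f - L2_inner M h g"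
  using L2_inner_lin_right[OF assms, of "-1"] by simp

lemma L2_inner_cong_AE:
  assumes "AE x in M. f x = f' x" "AE x in M. g x = g' x"
    and [measurable]: "f \<in> borel_measurable M" "f' \<in> borel_measurable M"
      "g \<in> borel_measurable M" "g' \<in> borel_measurable M"
  shows "L2_inner M f g = L2_inner M f' g'"
  unfolding L2_inner_def
  by (rule integral_cong_AE) (use assms(1,2) in auto)

lemma L2_norm_cong_AE:
  assumes "AE x in M. f x = f' x"
    and [measurable]: "f \<in> borel_measurable M" "f' \<in> borel_measurable M"
  shows "L2_norm M f = L2_norm M f'"
  unfolding L2_norm_def
  by (rule arg_cong[where f=sqrt], rule integral_cong_AE) (use assms(1) in auto)

lemma L2_norm_nonneg [simp]: "0 \<le> L2_norm M f"
  by (simp add: L2_norm_def)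

lemma L2_norm_zero [simp]: "L2_norm M (\<lambda>x. 0) = 0"
  by (simp add: L2_norm_def)

lemma L2_norm_sq: "(L2_norm M f)\<^sup>2 = (LINT x|M. (cmod (f x))\<^sup>2)"
  by (simp add: L2_norm_def)

lemma L2_inner_self: "L2_inner M f f = complex_of_real ((L2_norm M f)\<^sup>2)"
proof -
  have "L2_inner M f f = (LINT x|M. complex_of_real ((cmod (f x))\<^sup>2))"
    unfolding L2_inner_def
    by (rule arg_cong[where f="integral\<^sup>L M"]) (simp add: fun_eq_iff complex_norm_square flip: of_real_power)
  also have "\<dots> = complex_of_real ((L2_norm M f)\<^sup>2)"
    unfolding L2_norm_sq by (rule integral_complex_of_real)
  finally show ?thesis .
qed

lemma L2_norm_eq_0_iff:
  assumes "f \<in> L2 M"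
  shows "L2_norm M f = 0 \<longleftrightarrow> (AE x in M. f x = 0)"
proof -
  have "L2_norm M f = 0 \<longleftrightarrow> (LINT x|M. (cmod (f x))\<^sup>2) = 0"
    by (simp add: L2_norm_def)
  also have "\<dots> \<longleftrightarrow> (AE x in M. (cmod (f x))\<^sup>2 = 0)"
    by (rule integral_nonneg_eq_0_iff_AE) (use assms in \<open>auto dest: L2_integrable\<close>)
  finally show ?thesis by simp
qed

lemma L2_norm_scale: "L2_norm M (\<lambda>x. c * f x) = cmod c * L2_norm M f"
  by (simp add: L2_norm_def norm_mult power_mult_distrib real_sqrt_mult)

lemma L2_norm_minus_commute: "L2_norm M (\<lambda>x. f x - g x) = L2_norm M (\<lambda>x. g x - f x)"
  by (simp add: L2_norm_def norm_minus_commute)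

lemma L2_norm_sq_lin:
  assumes "f \<in> L2 M" "g \<in> L2 M"
  shows "(L2_norm M (\<lambda>x. f x + c * g x))\<^sup>2 =
    (L2_norm M f)\<^sup>2 + 2 * Re (cnj c * L2_inner M f g) + (cmod c)\<^sup>2 * (L2_norm M g)\<^sup>2"
proof -
  let ?h = "\<lambda>x. f x + c * g x"
  have h: "?h \<in> L2 M" using assms by auto
  have "L2_inner M ?h ?h = L2_inner M f f + cnj c * L2_inner M f g + c * (L2_inner M g f + cnj c * L2_inner M g g)"
    using assms h by (simp add: L2_inner_lin_left L2_inner_lin_right)
  also have "\<dots> = L2_inner M f f + (cnj c * L2_inner M f g + cnj (cnj c * L2_inner M f g)) + (c * cnj c) * L2_inner M g g"
    by (subst L2_inner_commute[of M g f]) (simp add: algebra_simps)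
  also have "\<dots> = complex_of_real ((L2_norm M f)\<^sup>2 + 2 * Re (cnj c * L2_inner M f g) + (cmod c)\<^sup>2 * (L2_norm M g)\<^sup>2)"
    unfolding L2_inner_self complex_add_cnj complex_norm_square[symmetric] by simp
  finally show ?thesis unfolding L2_inner_self of_real_eq_iff .
qed

lemma L2_Cauchy_Schwarz:
  assumes "f \<in> L2 M" "g \<in> L2 M"
  shows "cmod (L2_inner M f g) \<le> L2_norm M f * L2_norm M g"
proof (cases "L2_norm M g = 0")
  case True
  then have "AE x in M. g x = 0" using L2_norm_eq_0_iff[OF assms(2)] by simp
  then have "L2_inner M f g = L2_inner M f (\<lambda>x. 0)"
    using assms by (intro L2_inner_cong_AE) (auto intro: L2_measurable)
  then show ?thesis by (simp add: L2_inner_def)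
next
  case False
  define n where "n = (L2_norm M g)\<^sup>2"
  have n: "n > 0" using False by (simp add: n_def)
  define z where "z = L2_inner M f g"
  \<comment> \<open>With this coefficient \<open>f + c g\<close> is orthogonal to \<open>g\<close>,
    and the squared norm drops by exactly \<open>|z|^2 / n\<close>.\<close>
  define c where "c = - z / complex_of_real n"
  have "0 \<le> (L2_norm M (\<lambda>x. f x + c * g x))\<^sup>2" by simp
  also have "\<dots> = (L2_norm M f)\<^sup>2 + 2 * Re (cnj c * z) + (cmod c)\<^sup>2 * n"
    unfolding L2_norm_sq_lin[OF assms] z_def n_def ..
  also have "cnj c * z = - complex_of_real ((cmod z)\<^sup>2 / n)"
    unfolding c_def by (simp add: complex_norm_square mult.commute del: of_real_power)
  also have "(cmod c)\<^sup>2 * n = (cmod z)\<^sup>2 / n"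
    using n by (simp add: c_def norm_divide power_divide power2_eq_square)
  finally have "(cmod z)\<^sup>2 / n \<le> (L2_norm M f)\<^sup>2" by simp
  then have "(cmod z)\<^sup>2 \<le> (L2_norm M f * L2_norm M g)\<^sup>2"
    using n by (simp add: divide_le_eq n_def power_mult_distrib)
  then show ?thesis unfolding z_def
    by (rule power2_le_imp_le) simp
qed

lemma L2_norm_triangle:
  assumes "f \<in> L2 M" "g \<in> L2 M"
  shows "L2_norm M (\<lambda>x. f x + g x) \<le> L2_norm M f + L2_norm M g"
proof (rule power2_le_imp_le)
  have "(L2_norm M (\<lambda>x. f x + g x))\<^sup>2 = (L2_norm M f)\<^sup>2 + 2 * Re (L2_inner M f g) + (L2_norm M g)\<^sup>2"
    using L2_norm_sq_lin[OF assms, of 1] by simp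
  also have "Re (L2_inner M f g) \<le> L2_norm M f * L2_norm M g"
    using L2_Cauchy_Schwarz[OF assms] complex_Re_le_cmod order_trans by blast
  finally show "(L2_norm M (\<lambda>x. f x + g x))\<^sup>2 \<le> (L2_norm M f + L2_norm M g)\<^sup>2"
    by (simp add: power2_sum)
qed simp

lemma L2_norm_triangle_diff:
  assumes "f \<in> L2 M" "g \<in> L2 M" "h \<in> L2 M"
  shows "L2_norm M (\<lambda>x. f x - h x) \<le> L2_norm M (\<lambda>x. f x - g x) + L2_norm M (\<lambda>x. g x - h x)"
  using L2_norm_triangle[OF L2_diff[OF assms(1,2)] L2_diff[OF assms(2,3)]] by simp

lemma L2_norm_sum:
  assumes "\<And>i. i \<in> I \<Longrightarrow> f i \<in> L2 M"
  shows "L2_norm M (\<lambda>x. \<Sum>i\<in>I. f i x) \<le> (\<Sum>i\<in>I. L2_norm M (f i))"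
  using assms
proof (induction I rule: infinite_finite_induct)
  case (insert i I)
  have "L2_norm M (\<lambda>x. f i x + (\<Sum>i\<in>I. f i x)) \<le> L2_norm M (f i) + L2_norm M (\<lambda>x. \<Sum>i\<in>I. f i x)"
    using insert by (intro L2_norm_triangle) auto
  then show ?case using insert by auto
qed auto

lemma L2_norm_le_diff:
  assumes "f \<in> L2 M" "g \<in> L2 M"
  shows "L2_norm M f \<le> L2_norm M g + L2_norm M (\<lambda>x. f x - g x)"
  using L2_norm_triangle_diff[OF assms L2_zero] L2_norm_minus_commute[of M f g] by simp

lemma L2_norm_mono:
  assumes "f \<in> L2 M" "g \<in> L2 M" "AE x in M. cmod (f x) \<le> C * cmod (g x)" "0 \<le> C"
  shows "L2_norm M f \<le> C * L2_norm M g"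
proof -
  have "(L2_norm M f)\<^sup>2 \<le> (LINT x|M. C\<^sup>2 * (cmod (g x))\<^sup>2)"
    unfolding L2_norm_sq
  proof (rule integral_mono_AE)
    show "AE x in M. (cmod (f x))\<^sup>2 \<le> C\<^sup>2 * (cmod (g x))\<^sup>2"
      using assms(3) by eventually_elim (metis norm_ge_zero power_mono power_mult_distrib)
  qed (use assms in \<open>auto dest: L2_integrable\<close>)
  also have "\<dots> = (C * L2_norm M g)\<^sup>2" by (simp add: power_mult_distrib L2_norm_sq)
  finally show ?thesis using assms(4) by (auto intro: power2_le_imp_le)
qed

lemma L2_parallelogram:
  assumes "f \<in> L2 M" "g \<in> L2 M"
  shows "(L2_norm M (\<lambda>x. f x - g x))\<^sup>2 = 2 * (L2_norm M f)\<^sup>2 + 2 * (L2_norm M g)\<^sup>2 - (L2_norm M (\<lambda>x. f x + g x))\<^sup>2"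
  using L2_norm_sq_lin[OF assms, of 1] L2_norm_sq_lin[OF assms, of "-1"] by simp

lemma L2_norm_nn_integral:
  assumes "f \<in> L2 M"
  shows "(\<integral>\<^sup>+x. ennreal ((cmod (f x))\<^sup>2) \<partial>M) = ennreal ((L2_norm M f)\<^sup>2)"
  unfolding L2_norm_sq using assms by (intro nn_integral_eq_integral) (auto dest: L2_integrable)

lemma L2I_nn_integral:
  assumes [measurable]: "f \<in> borel_measurable M" and "(\<integral>\<^sup>+x. ennreal ((cmod (f x))\<^sup>2) \<partial>M) \<le> ennreal C"
  shows "f \<in> L2 M"
  unfolding L2_def
proof (safe intro!: integrableI_bounded)
  show "(\<integral>\<^sup>+x. ennreal (norm ((cmod (f x))\<^sup>2)) \<partial>M) < \<infinity>"
    using assms(2) by (simp add: order_le_less_trans)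
qed measurable

lemma L2_norm_le_nn_integral:
  assumes "f \<in> L2 M" "(\<integral>\<^sup>+x. ennreal ((cmod (f x))\<^sup>2) \<partial>M) \<le> ennreal (C\<^sup>2)" "0 \<le> C"
  shows "L2_norm M f \<le> C"
  using assms by (simp add: L2_norm_nn_integral)

text \<open>The absolute increments form a series whose partial sums have norm at most 2, so
  monotone convergence makes the telescoping series absolutely convergent almost everywhere. Square
  integrability of the limit comes from Fatou's lemma in \<open>L2_complete\<close>.\<close>

lemma L2_complete_fast:
  assumes f: "\<And>n. f n \<in> L2 M"
    and d: "\<And>n. L2_norm M (\<lambda>x. f (Suc n) x - f n x) \<le> (1/2)^n"
  shows "\<exists>g \<in> borel_measurable M. AE x in M. (\<lambda>n. f n x) \<longlonglongrightarrow> g x"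
proof -
  have [measurable]: "f n \<in> borel_measurable M" for n using f by (auto intro: L2_measurable)
  define S where "S k x = (\<Sum>n<k. cmod (f (Suc n) x - f n x))" for k x
  have [measurable]: "S k \<in> borel_measurable M" for k unfolding S_def by measurable
  have Snn: "0 \<le> S k x" for k x unfolding S_def by (simp add: sum_nonneg)
  have "(\<integral>\<^sup>+x. ennreal ((S k x)\<^sup>2) \<partial>M) \<le> ennreal 4" for k
  proof -
    have dl: "(\<lambda>x. complex_of_real (cmod (f (Suc n) x - f n x))) \<in> L2 M" for n
      by (rule L2_bound[OF L2_diff[OF f f], where C=1]) auto
    have e: "(\<lambda>x. complex_of_real (S k x)) = (\<lambda>x. \<Sum>n<k. complex_of_real (cmod (f (Suc n) x - f n x)))"
      by (simp add: S_def)
    have m: "(\<lambda>x. complex_of_real (S k x)) \<in> L2 M" unfolding e by (intro L2_sum dl)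
    have "L2_norm M (\<lambda>x. complex_of_real (S k x)) \<le> (\<Sum>n<k. L2_norm M (\<lambda>x. complex_of_real (cmod (f (Suc n) x - f n x))))"
      unfolding e by (rule L2_norm_sum[OF dl])
    also have "\<dots> = (\<Sum>n<k. L2_norm M (\<lambda>x. f (Suc n) x - f n x))"
      by (simp add: L2_norm_def)
    also have "\<dots> \<le> (\<Sum>n<k. (1/2)^n)" by (intro sum_mono d)
    also have "\<dots> \<le> 2" by (simp add: geometric_sum)
    finally have "(L2_norm M (\<lambda>x. complex_of_real (S k x)))\<^sup>2 \<le> 2\<^sup>2" by (intro power_mono) auto
    then have "ennreal ((L2_norm M (\<lambda>x. complex_of_real (S k x)))\<^sup>2) \<le> ennreal 4" by (intro ennreal_leI) simp
    then show ?thesis unfolding L2_norm_nn_integral[OF m, symmetric] by simp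
  qed
  then have "(SUP k. \<integral>\<^sup>+x. ennreal ((S k x)\<^sup>2) \<partial>M) \<le> ennreal 4" by (intro SUP_least) auto
  also have "(SUP k. \<integral>\<^sup>+x. ennreal ((S k x)\<^sup>2) \<partial>M) = (\<integral>\<^sup>+x. (SUP k. ennreal ((S k x)\<^sup>2)) \<partial>M)"
  proof (rule nn_integral_monotone_convergence_SUP[symmetric])
    have "S k x \<le> S (Suc k) x" for k x unfolding S_def by simp
    then show "incseq (\<lambda>k x. ennreal ((S k x)\<^sup>2))"
      by (intro incseq_SucI le_funI ennreal_leI power_mono Snn)
  qed measurable
  finally have "(\<integral>\<^sup>+x. (SUP k. ennreal ((S k x)\<^sup>2)) \<partial>M) \<noteq> \<infinity>"
    by (auto simp: top_unique)
  then have "AE x in M. (SUP k. ennreal ((S k x)\<^sup>2)) \<noteq> \<infinity>"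
    by (intro nn_integral_PInf_AE) auto
  then have conv: "AE x in M. (\<lambda>n. f n x) \<longlonglongrightarrow> lim (\<lambda>n. f n x)"
  proof eventually_elim
    case (elim x)
    then obtain C where C: "(SUP k. ennreal ((S k x)\<^sup>2)) = ennreal C" "0 \<le> C"
      by (cases "(SUP k. ennreal ((S k x)\<^sup>2))") auto
    have "(S k x)\<^sup>2 \<le> C" for k
    proof -
      have "ennreal ((S k x)\<^sup>2) \<le> ennreal C" unfolding C(1)[symmetric] by (intro SUP_upper) auto
      then show ?thesis using C(2) by simp
    qed
    then have "(\<Sum>n<k. cmod (f (Suc n) x - f n x)) \<le> sqrt C" for k
      by (metis S_def real_le_rsqrt)
    then have "summable (\<lambda>n. cmod (f (Suc n) x - f n x))"
      by (intro summableI_nonneg_bounded) auto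
    then have "summable (\<lambda>n. f (Suc n) x - f n x)" by (rule summable_norm_cancel)
    then have "convergent (\<lambda>n. \<Sum>i<n. f (Suc i) x - f i x)" by (simp only: summable_iff_convergent)
    then have "convergent (\<lambda>n. f n x - f 0 x)"
      by (simp only: sum_lessThan_telescope[of "\<lambda>n. f n x"])
    then have "convergent (\<lambda>n. f n x)" unfolding convergent_diff_const_right_iff .
    then show ?case by (simp add: convergent_LIMSEQ_iff)
  qed
  show ?thesis
    by (rule bexI[where x="\<lambda>x. lim (\<lambda>n. f n x)"], rule conv) measurable
qed

lemma L2_complete:
  assumes f: "\<And>n. f n \<in> L2 M"
    and cauchy: "\<And>e. e > 0 \<Longrightarrow> \<exists>N. \<forall>m\<ge>N. \<forall>n\<ge>N. L2_norm M (\<lambda>x. f m x - f n x) < e"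
  obtains g where "g \<in> L2 M" "(\<lambda>n. L2_norm M (\<lambda>x. f n x - g x)) \<longlonglongrightarrow> 0"
proof -
  have [measurable]: "f n \<in> borel_measurable M" for n using f by (auto intro: L2_measurable)
  have "\<exists>N. \<forall>m\<ge>N. \<forall>n\<ge>N. L2_norm M (\<lambda>x. f m x - f n x) < (1/2)^k" for k :: nat
    by (rule cauchy) simp
  then obtain N where N: "\<And>k m n. m \<ge> N k \<Longrightarrow> n \<ge> N k \<Longrightarrow> L2_norm M (\<lambda>x. f m x - f n x) < (1/2)^k"
    by metis
  \<comment> \<open>Adding up the thresholds gives \<open>r k \<ge> N k\<close>,
    \<open>r (Suc k) \<ge> N k\<close> and \<open>r k \<ge> k\<close> at once; the first two make
    the subsequence fast, the third lets \<open>r n\<close> pass any threshold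
    \<open>Ne\<close>.\<close>
  define r where "r k = k + (\<Sum>j\<le>k. N j)" for k
  have rN: "N k \<le> r k" for k
    unfolding r_def by (metis atMost_iff finite_atMost le_refl member_le_sum trans_le_add2 zero_le)
  have rS: "N k \<le> r (Suc k)" for k
    using rN[of k] by (simp add: r_def)
  have rk: "k \<le> r k" for k unfolding r_def by simp
  obtain g where g[measurable]: "g \<in> borel_measurable M" and lim: "AE x in M. (\<lambda>n. f (r n) x) \<longlonglongrightarrow> g x"
    using L2_complete_fast[of "\<lambda>n. f (r n)" M] f N[OF rS rN] by (auto simp: less_imp_le)
  \<comment> \<open>Fatou's lemma turns the Cauchy estimate into an estimate of the distance to the
    pointwise limit. It is stated with the nonnegative integral because \<open>g\<close> is not yet
    known to be square integrable.\<close>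
  have est: "(\<integral>\<^sup>+x. ennreal ((cmod (f m x - g x))\<^sup>2) \<partial>M) \<le> ennreal (e\<^sup>2)"
    if "e > 0" and Ne: "\<And>m n. m \<ge> Ne \<Longrightarrow> n \<ge> Ne \<Longrightarrow> L2_norm M (\<lambda>x. f m x - f n x) < e" "m \<ge> Ne" for m e Ne
  proof -
    have "(\<integral>\<^sup>+x. ennreal ((cmod (f m x - g x))\<^sup>2) \<partial>M)
      = (\<integral>\<^sup>+x. liminf (\<lambda>n. ennreal ((cmod (f m x - f (r n) x))\<^sup>2)) \<partial>M)"
    proof (rule nn_integral_cong_AE)
      show "AE x in M. ennreal ((cmod (f m x - g x))\<^sup>2) = liminf (\<lambda>n. ennreal ((cmod (f m x - f (r n) x))\<^sup>2))"
        using lim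
      proof eventually_elim
        case (elim x)
        then have *: "(\<lambda>n. ennreal ((cmod (f m x - f (r n) x))\<^sup>2)) \<longlonglongrightarrow> ennreal ((cmod (f m x - g x))\<^sup>2)"
          by (intro tendsto_intros)
        then show ?case by (rule lim_imp_Liminf[OF trivial_limit_sequentially, symmetric])
      qed
    qed
    also have "\<dots> \<le> liminf (\<lambda>n. \<integral>\<^sup>+x. ennreal ((cmod (f m x - f (r n) x))\<^sup>2) \<partial>M)"
      by (rule nn_integral_liminf) measurable
    also have "\<dots> \<le> ennreal (e\<^sup>2)"
    proof (rule Liminf_le, simp)
      have "(\<integral>\<^sup>+x. ennreal ((cmod (f m x - f (r n) x))\<^sup>2) \<partial>M) \<le> ennreal (e\<^sup>2)" if "n \<ge> Ne" for n
      proof -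
        have "L2_norm M (\<lambda>x. f m x - f (r n) x) < e" using Ne(1)[of m "r n"] Ne(2) that rk[of n] by simp
        then have "(L2_norm M (\<lambda>x. f m x - f (r n) x))\<^sup>2 \<le> e\<^sup>2" by (intro power_mono) auto
        then show ?thesis using L2_norm_nn_integral[OF L2_diff[OF f f]] by (simp add: ennreal_leI)
      qed
      then show "\<forall>\<^sub>F n in sequentially. (\<integral>\<^sup>+x. ennreal ((cmod (f m x - f (r n) x))\<^sup>2) \<partial>M) \<le> ennreal (e\<^sup>2)"
        by (auto simp: eventually_sequentially)
    qed
    finally show ?thesis .
  qed
  have fg: "(\<lambda>x. f (N 0) x - g x) \<in> L2 M"
    by (rule L2I_nn_integral[where C="1\<^sup>2"], measurable) (rule est[of 1 "N 0"], use N[of 0] in auto)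
  have "g \<in> L2 M" using L2_diff[OF f[of "N 0"] fg] by simp
  moreover have "(\<lambda>n. L2_norm M (\<lambda>x. f n x - g x)) \<longlonglongrightarrow> 0"
  proof (rule LIMSEQ_I)
    fix e :: real assume "e > 0"
    then obtain Ne where Ne: "\<And>m n. m \<ge> Ne \<Longrightarrow> n \<ge> Ne \<Longrightarrow> L2_norm M (\<lambda>x. f m x - f n x) < e/2"
      using cauchy[of "e/2"] by auto
    have "L2_norm M (\<lambda>x. f n x - g x) \<le> e/2" if "n \<ge> Ne" for n
      by (rule L2_norm_le_nn_integral[OF L2_diff[OF f \<open>g \<in> L2 M\<close>]])
         (rule est[OF _ Ne that], use \<open>e > 0\<close> in auto)
    then show "\<exists>no. \<forall>n\<ge>no. norm (L2_norm M (\<lambda>x. f n x - g x) - 0) < e"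
      using \<open>e > 0\<close> by (intro exI[of _ Ne]) fastforce
  qed
  ultimately show ?thesis using that by blast
qed

section \<open>Closed subspaces, orthogonal projection and the Riesz representation\<close>

definition closed_subspace :: "'x measure \<Rightarrow> ('x \<Rightarrow> complex) set \<Rightarrow> bool" where
  "closed_subspace M K \<longleftrightarrow> K \<subseteq> L2 M \<and> (\<lambda>x. 0) \<in> K \<and>
     (\<forall>f\<in>K. \<forall>g\<in>K. \<forall>c. (\<lambda>x. f x + c * g x) \<in> K) \<and>
     (\<forall>f\<in>L2 M. (\<forall>e>0. \<exists>k\<in>K. L2_norm M (\<lambda>x. f x - k x) < e) \<longrightarrow> f \<in> K)"

text \<open>Functions equal almost everywhere are at distance 0, so closedness under limits already
  makes \<open>K\<close> a union of almost everywhere classes.\<close>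

lemma closed_subspace_AE:
  assumes "closed_subspace M K" "k \<in> K" "f \<in> L2 M" "AE x in M. f x = k x"
  shows "f \<in> K"
proof -
  have "k \<in> L2 M" using assms by (auto simp: closed_subspace_def)
  then have "L2_norm M (\<lambda>x. f x - k x) = 0"
    using assms by (subst L2_norm_eq_0_iff) auto
  then have "\<forall>e>0. \<exists>k\<in>K. L2_norm M (\<lambda>x. f x - k x) < e" using assms(2) by metis
  then show ?thesis using assms by (auto simp: closed_subspace_def)
qed

text \<open>Otherwise removing the component along \<open>k\<close> would lower the squared norm of
  \<open>w\<close> by the positive amount \<open>|z|^2 / n\<close>, as in the Cauchy-Schwarz
  computation.\<close>

lemma orthogonal_of_minimal:
  assumes w: "w \<in> L2 M" and k: "k \<in> L2 M"
    and min: "\<And>c. L2_norm M w \<le> L2_norm M (\<lambda>x. w x + c * k x)"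
  shows "L2_inner M w k = 0"
proof (cases "L2_norm M k = 0")
  case True
  then show ?thesis using L2_Cauchy_Schwarz[OF w k] by simp
next
  case False
  define n where "n = (L2_norm M k)\<^sup>2"
  have n: "n > 0" using False by (simp add: n_def)
  define z where "z = L2_inner M w k"
  define c where "c = - z / complex_of_real n"
  have "(L2_norm M w)\<^sup>2 \<le> (L2_norm M (\<lambda>x. w x + c * k x))\<^sup>2" by (intro power_mono min) simp
  also have "\<dots> = (L2_norm M w)\<^sup>2 + 2 * Re (cnj c * z) + (cmod c)\<^sup>2 * n"
    unfolding L2_norm_sq_lin[OF w k] z_def n_def ..
  also have "cnj c * z = - complex_of_real ((cmod z)\<^sup>2 / n)"
    unfolding c_def by (simp add: complex_norm_square mult.commute del: of_real_power)
  also have "(cmod c)\<^sup>2 * n = (cmod z)\<^sup>2 / n"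
    using n by (simp add: c_def norm_divide power_divide power2_eq_square)
  finally have "(cmod z)\<^sup>2 / n \<le> 0" by simp
  then show ?thesis using n by (simp add: divide_le_0_iff z_def)
qed

text \<open>A minimising sequence for the distance is Cauchy by the parallelogram law, its limit
  attains the distance \<open>d\<close>, and a nearest point leaves an orthogonal remainder.\<close>

lemma L2_projection:
  assumes K: "closed_subspace M K" and f: "f \<in> L2 M"
  shows "\<exists>h\<in>K. \<forall>k\<in>K. L2_inner M (\<lambda>x. f x - h x) k = 0"
proof -
  have KL: "k \<in> L2 M" if "k \<in> K" for k using K that by (auto simp: closed_subspace_def)
  have Klin: "(\<lambda>x. k x + c * l x) \<in> K" if "k \<in> K" "l \<in> K" for k l c
    using K that by (auto simp: closed_subspace_def)
  have K0: "(\<lambda>x. 0) \<in> K" using K by (auto simp: closed_subspace_def)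
  define A where "A = (\<lambda>k. L2_norm M (\<lambda>x. f x - k x)) ` K"
  define d where "d = Inf A"
  have bdd: "bdd_below A" unfolding A_def by (auto intro!: bdd_belowI[of _ 0])
  have ne: "A \<noteq> {}" using K0 by (auto simp: A_def)
  have dle: "d \<le> L2_norm M (\<lambda>x. f x - k x)" if "k \<in> K" for k
    unfolding d_def using bdd that by (intro cInf_lower) (auto simp: A_def)
  have d0: "0 \<le> d" unfolding d_def by (rule cInf_greatest[OF ne]) (auto simp: A_def)
  have "\<exists>k\<in>K. (L2_norm M (\<lambda>x. f x - k x))\<^sup>2 < d\<^sup>2 + 1 / real (Suc n)" for n
  proof -
    have "d < sqrt (d\<^sup>2 + 1 / real (Suc n))" by (rule real_less_rsqrt) simp
    then obtain k where "k \<in> K" "L2_norm M (\<lambda>x. f x - k x) < sqrt (d\<^sup>2 + 1 / real (Suc n))"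
      using cInf_lessD[OF ne] unfolding d_def A_def by blast
    then have "(L2_norm M (\<lambda>x. f x - k x))\<^sup>2 < (sqrt (d\<^sup>2 + 1 / real (Suc n)))\<^sup>2"
      by (intro power_strict_mono) auto
    then show ?thesis using \<open>k \<in> K\<close> by (intro bexI[of _ k]) (simp_all add: add_nonneg_nonneg)
  qed
  then obtain k where kK: "\<And>n. k n \<in> K" and kd: "\<And>n. (L2_norm M (\<lambda>x. f x - k n x))\<^sup>2 < d\<^sup>2 + 1 / real (Suc n)"
    by metis
  have kL: "k n \<in> L2 M" for n using KL kK by auto
  have est: "(L2_norm M (\<lambda>x. k m x - k n x))\<^sup>2 \<le> 2 / real (Suc m) + 2 / real (Suc n)" for m n
  proof -
    \<comment> \<open>The midpoint of two almost nearest points stays in \<open>K\<close>, so its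
      distance from \<open>f\<close> is at least \<open>d\<close>; this is the lower bound that the
      parallelogram law needs.\<close>
    have mid: "(\<lambda>x. (1/2) * k m x + (1/2) * k n x) \<in> K"
      using Klin[OF Klin[OF K0 kK] kK, of "1/2" m "1/2" n] by simp
    have e: "(\<lambda>x. k m x - k n x) = (\<lambda>x. (f x - k n x) - (f x - k m x))" by simp
    have "(L2_norm M (\<lambda>x. (f x - k n x) - (f x - k m x)))\<^sup>2 =
      2 * (L2_norm M (\<lambda>x. f x - k n x))\<^sup>2 + 2 * (L2_norm M (\<lambda>x. f x - k m x))\<^sup>2
       - (L2_norm M (\<lambda>x. (f x - k n x) + (f x - k m x)))\<^sup>2"
      by (rule L2_parallelogram) (auto intro: f kL)
    also have "(\<lambda>x. (f x - k n x) + (f x - k m x)) = (\<lambda>x. 2 * (f x - ((1/2) * k m x + (1/2) * k n x)))"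
      by (simp add: fun_eq_iff algebra_simps)
    also have "(L2_norm M \<dots>)\<^sup>2 = 4 * (L2_norm M (\<lambda>x. f x - ((1/2) * k m x + (1/2) * k n x)))\<^sup>2"
      unfolding L2_norm_scale by (simp add: power_mult_distrib)
    finally have "(L2_norm M (\<lambda>x. k m x - k n x))\<^sup>2 = 2 * (L2_norm M (\<lambda>x. f x - k n x))\<^sup>2 + 2 * (L2_norm M (\<lambda>x. f x - k m x))\<^sup>2
       - 4 * (L2_norm M (\<lambda>x. f x - ((1/2) * k m x + (1/2) * k n x)))\<^sup>2"
      unfolding e .
    moreover have "(L2_norm M (\<lambda>x. f x - ((1/2) * k m x + (1/2) * k n x)))\<^sup>2 \<ge> d\<^sup>2"
      using dle[OF mid] d0 by (intro power_mono)
    moreover have "2 / real (Suc m) = 2 * (1 / real (Suc m))" "2 / real (Suc n) = 2 * (1 / real (Suc n))"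
      by simp_all
    ultimately show ?thesis using kd[of m] kd[of n] by linarith
  qed
  have cauchy: "\<exists>N. \<forall>m\<ge>N. \<forall>n\<ge>N. L2_norm M (\<lambda>x. k m x - k n x) < e" if "e > 0" for e
  proof -
    obtain N where N: "4 / e\<^sup>2 < real N" using reals_Archimedean2 by blast
    have "L2_norm M (\<lambda>x. k m x - k n x) < e" if "m \<ge> N" "n \<ge> N" for m n
    proof -
      have "2 / real (Suc m) < e\<^sup>2 / 2" if "m \<ge> N" for m
      proof -
        have "4 / e\<^sup>2 < real (Suc m)" using N that by linarith
        then show ?thesis using \<open>e > 0\<close> by (simp add: field_simps)
      qed
      from this[OF that(1)] this[OF that(2)] est[of m n]
      have "(L2_norm M (\<lambda>x. k m x - k n x))\<^sup>2 < e\<^sup>2" by linarith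
      then show ?thesis using \<open>e > 0\<close> by (simp add: power2_less_imp_less)
    qed
    then show ?thesis by blast
  qed
  obtain h where h: "h \<in> L2 M" and lim: "(\<lambda>n. L2_norm M (\<lambda>x. k n x - h x)) \<longlonglongrightarrow> 0"
    by (rule L2_complete[OF kL cauchy])
  have hK: "h \<in> K"
  proof -
    have "\<exists>k\<in>K. L2_norm M (\<lambda>x. h x - k x) < e" if "e > 0" for e
    proof -
      have "\<forall>\<^sub>F n in sequentially. L2_norm M (\<lambda>x. k n x - h x) < e"
        using order_tendstoD(2)[OF lim that] .
      then obtain n where "L2_norm M (\<lambda>x. k n x - h x) < e"
        by (auto simp: eventually_sequentially)
      then show ?thesis using kK by (auto simp: L2_norm_minus_commute[of M h])
    qed
    then show ?thesis using K h by (auto simp: closed_subspace_def)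
  qed
  have hd: "L2_norm M (\<lambda>x. f x - h x) \<le> d"
  proof (rule LIMSEQ_le_const)
    show "(\<lambda>n. sqrt (d\<^sup>2 + 1 / real (Suc n)) + L2_norm M (\<lambda>x. k n x - h x)) \<longlonglongrightarrow> d"
    proof -
      have "(\<lambda>n. sqrt (d\<^sup>2 + 1 / real (Suc n)) + L2_norm M (\<lambda>x. k n x - h x)) \<longlonglongrightarrow> sqrt (d\<^sup>2 + 0) + 0"
        by (intro tendsto_intros lim LIMSEQ_Suc[OF lim_1_over_n])
      then show ?thesis using d0 by simp
    qed
    have "L2_norm M (\<lambda>x. f x - h x) \<le> sqrt (d\<^sup>2 + 1 / real (Suc n)) + L2_norm M (\<lambda>x. k n x - h x)" for n
    proof -
      have "L2_norm M (\<lambda>x. f x - k n x) \<le> sqrt (d\<^sup>2 + 1 / real (Suc n))"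
        using kd[of n] by (intro real_le_rsqrt) simp
      then show ?thesis using L2_norm_triangle_diff[OF f kL h, of n] by linarith
    qed
    then show "\<exists>N. \<forall>n\<ge>N. L2_norm M (\<lambda>x. f x - h x) \<le> sqrt (d\<^sup>2 + 1 / real (Suc n)) + L2_norm M (\<lambda>x. k n x - h x)"
      by blast
  qed
  have "L2_inner M (\<lambda>x. f x - h x) l = 0" if "l \<in> K" for l
  proof (rule orthogonal_of_minimal)
    fix c
    have "L2_norm M (\<lambda>x. f x - h x) \<le> L2_norm M (\<lambda>x. f x - (h x + (-c) * l x))"
      using hd dle[OF Klin[OF hK that]] order_trans by blast
    then show "L2_norm M (\<lambda>x. f x - h x) \<le> L2_norm M (\<lambda>x. f x - h x + c * l x)"
      by (simp add: algebra_simps)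
  qed (use f h KL that in auto)
  then show ?thesis using hK by blast
qed

text \<open>Unless \<phi> vanishes, a vector outside its closed kernel has a component
  \<open>w\<close> orthogonal to the kernel. Modulo the kernel every \<open>f\<close> is the
  multiple \<open>\<phi> f / \<phi> w\<close> of \<open>w\<close>, so a scalar multiple of
  \<open>w\<close> represents \<phi>.\<close>

lemma L2_Riesz:
  assumes lin: "\<And>f g c. f \<in> L2 M \<Longrightarrow> g \<in> L2 M \<Longrightarrow> \<phi> (\<lambda>x. f x + c * g x) = \<phi> f + c * \<phi> g"
    and bdd: "\<And>f. f \<in> L2 M \<Longrightarrow> cmod (\<phi> f) \<le> C * L2_norm M f"
  shows "\<exists>g\<in>L2 M. \<forall>f\<in>L2 M. \<phi> f = L2_inner M f g"
proof -
  have \<phi>0: "\<phi> (\<lambda>x. 0) = 0" using bdd[OF L2_zero] by simp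
  have diff: "\<phi> (\<lambda>x. f x - g x) = \<phi> f - \<phi> g" if "f \<in> L2 M" "g \<in> L2 M" for f g
    using lin[OF that, of "-1"] by simp
  define K where "K = {f \<in> L2 M. \<phi> f = 0}"
  have K: "closed_subspace M K"
    unfolding closed_subspace_def
  proof (intro conjI ballI allI impI)
    fix f assume f: "f \<in> L2 M" and *: "\<forall>e>0. \<exists>k\<in>K. L2_norm M (\<lambda>x. f x - k x) < e"
    have "cmod (\<phi> f) \<le> e" if "e > 0" for e
    proof -
      obtain k where k: "k \<in> K" "L2_norm M (\<lambda>x. f x - k x) < e / (\<bar>C\<bar> + 1)"
        using * \<open>e > 0\<close> by (metis abs_ge_zero add_nonneg_pos divide_pos_pos zero_less_one)
      have "cmod (\<phi> f) = cmod (\<phi> (\<lambda>x. f x - k x))" using k f by (simp add: diff K_def)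
      also have "\<dots> \<le> C * L2_norm M (\<lambda>x. f x - k x)" using k f by (intro bdd) (auto simp: K_def)
      also have "\<dots> \<le> (\<bar>C\<bar> + 1) * L2_norm M (\<lambda>x. f x - k x)" by (intro mult_right_mono) auto
      also have "\<dots> \<le> e" using k(2) by (simp add: field_simps)
      finally show ?thesis .
    qed
    then have "cmod (\<phi> f) \<le> 0" by (metis field_le_epsilon add_0)
    then show "f \<in> K" using f by (simp add: K_def)
  qed (auto simp: K_def \<phi>0 lin)
  show ?thesis
  proof (cases "L2 M \<subseteq> K")
    case True
    then have "\<phi> f = L2_inner M f (\<lambda>x. 0)" if "f \<in> L2 M" for f
      using that by (auto simp: K_def L2_inner_def)
    then show ?thesis using L2_zero by blast
  next
    case False
    then obtain u where u: "u \<in> L2 M" "u \<notin> K" by blast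
    obtain h where h: "h \<in> K" "\<And>k. k \<in> K \<Longrightarrow> L2_inner M (\<lambda>x. u x - h x) k = 0"
      using L2_projection[OF K u(1)] by blast
    define w where "w = (\<lambda>x. u x - h x)"
    have hL: "h \<in> L2 M" using h by (simp add: K_def)
    have w: "w \<in> L2 M" using u hL by (auto simp: w_def)
    have wu: "\<phi> w = \<phi> u" using u h hL by (simp add: w_def diff K_def)
    then have w0: "\<phi> w \<noteq> 0" using u by (simp add: K_def)
    then have nw: "L2_norm M w \<noteq> 0" using bdd[OF w] by auto
    \<comment> \<open>The scalar is conjugated because the inner product is conjugate linear in the
      second argument; it is chosen so that \<open>L2_inner M w g = \<phi> w\<close>.\<close>
    define g where "g = (\<lambda>x. (cnj (\<phi> w) / complex_of_real ((L2_norm M w)\<^sup>2)) * w x)"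
    have g: "g \<in> L2 M" unfolding g_def using w by (intro L2_scale)
    have "\<phi> f = L2_inner M f g" if f: "f \<in> L2 M" for f
    proof -
      define t where "t = \<phi> f / \<phi> w"
      have "(\<lambda>x. f x + (-t) * w x) \<in> K"
        using f w w0 L2_lin[OF f w, of "-t"] lin[OF f w, of "-t"] by (auto simp: K_def t_def)
      then have "L2_inner M w (\<lambda>x. f x + (-t) * w x) = 0" using h(2) by (simp add: w_def)
      then have "L2_inner M (\<lambda>x. f x + (-t) * w x) w = 0" by (subst L2_inner_commute) simp
      then have "L2_inner M f w = t * L2_inner M w w"
        using L2_inner_lin_left[OF f w w, of "-t"] by simp
      then have *: "L2_inner M f w = t * complex_of_real ((L2_norm M w)\<^sup>2)" by (simp add: L2_inner_self)
      have "L2_inner M f g = cnj (cnj (\<phi> w) / complex_of_real ((L2_norm M w)\<^sup>2)) * L2_inner M f w"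
        unfolding g_def using L2_inner_lin_right[OF L2_zero w f, of "cnj (\<phi> w) / complex_of_real ((L2_norm M w)\<^sup>2)"]
        by (simp add: L2_inner_def[of M f "\<lambda>x. 0"])
      also have "\<dots> = \<phi> f" unfolding * using nw w0 by (simp add: t_def)
      finally show ?thesis by simp
    qed
    then show ?thesis using g by blast
  qed
qed


section \<open>Commutants and bicommutants\<close>

lemma L2_eq_by_inner:
  assumes "f \<in> L2 M" "g \<in> L2 M" "\<And>h. h \<in> L2 M \<Longrightarrow> L2_inner M f h = L2_inner M g h"
  shows "AE x in M. f x = g x"
proof -
  have d: "(\<lambda>x. f x - g x) \<in> L2 M" using assms by auto
  have "L2_inner M (\<lambda>x. f x - g x) (\<lambda>x. f x - g x) = 0"
    using L2_inner_diff_left[OF assms(1,2) d] assms(3)[OF d] by simp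
  then have "L2_norm M (\<lambda>x. f x - g x) = 0" by (simp add: L2_inner_self)
  then show ?thesis using L2_norm_eq_0_iff[OF d] by simp
qed

lemma L2_diff_norm_0:
  assumes "f \<in> L2 M" "g \<in> L2 M" "\<And>e. e > 0 \<Longrightarrow> L2_norm M (\<lambda>x. f x - g x) \<le> e"
  shows "AE x in M. f x = g x"
proof -
  have "L2_norm M (\<lambda>x. f x - g x) \<le> 0" using assms(3) by (metis field_le_epsilon add_0)
  then have "L2_norm M (\<lambda>x. f x - g x) = 0" by (simp add: antisym)
  then show ?thesis using L2_norm_eq_0_iff[OF L2_diff[OF assms(1,2)]] by simp
qed

section \<open>Bounded operators and their adjoints\<close>

lemma bounded_ops_L2: "T \<in> bounded_ops M \<Longrightarrow> f \<in> L2 M \<Longrightarrow> T f \<in> L2 M"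
  by (simp add: bounded_ops_def)

lemma bounded_ops_lin:
  "T \<in> bounded_ops M \<Longrightarrow> f \<in> L2 M \<Longrightarrow> g \<in> L2 M \<Longrightarrow> AE x in M. T (\<lambda>x. f x + c * g x) x = T f x + c * T g x"
  by (simp add: bounded_ops_def)

lemma bounded_ops_diff:
  "T \<in> bounded_ops M \<Longrightarrow> f \<in> L2 M \<Longrightarrow> g \<in> L2 M \<Longrightarrow> AE x in M. T (\<lambda>x. f x - g x) x = T f x - T g x"
  using bounded_ops_lin[of T M f g "-1"] by simp

lemma bounded_ops_bound:
  assumes "T \<in> bounded_ops M"
  shows "\<exists>K\<ge>0. \<forall>f. f \<in> L2 M \<longrightarrow> L2_norm M (T f) \<le> K * L2_norm M f"
proof -
  obtain K where K: "\<forall>f\<in>L2 M. L2_norm M (T f) \<le> K * L2_norm M f"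
    using assms unfolding bounded_ops_def by blast
  have "L2_norm M (T f) \<le> \<bar>K\<bar> * L2_norm M f" if "f \<in> L2 M" for f
    using bspec[OF K that] mult_right_mono[OF abs_ge_self, of "L2_norm M f" K] by simp
  then show ?thesis by (intro exI[of _ "\<bar>K\<bar>"]) auto
qed

lemma bounded_ops_zero:
  assumes "T \<in> bounded_ops M"
  shows "AE x in M. T (\<lambda>x. 0) x = 0"
proof -
  obtain K where "0 \<le> K" "\<And>f. f \<in> L2 M \<Longrightarrow> L2_norm M (T f) \<le> K * L2_norm M f"
    using bounded_ops_bound[OF assms] by metis
  from this(2)[OF L2_zero] have "L2_norm M (T (\<lambda>x. 0)) = 0" by (simp add: antisym)
  then show ?thesis using L2_norm_eq_0_iff[OF bounded_ops_L2[OF assms L2_zero]] by simp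
qed

lemma bounded_ops_cong:
  assumes T: "T \<in> bounded_ops M" and "f \<in> L2 M" "g \<in> L2 M" "AE x in M. f x = g x"
  shows "AE x in M. T f x = T g x"
proof (rule L2_diff_norm_0)
  fix e :: real assume "e > 0"
  obtain K where K: "0 \<le> K" "\<And>f. f \<in> L2 M \<Longrightarrow> L2_norm M (T f) \<le> K * L2_norm M f"
    using bounded_ops_bound[OF T] by metis
  have 0: "L2_norm M (\<lambda>x. f x - g x) = 0" using assms by (subst L2_norm_eq_0_iff) auto
  have "L2_norm M (\<lambda>x. T f x - T g x) = L2_norm M (T (\<lambda>x. f x - g x))"
    by (rule L2_norm_cong_AE, use bounded_ops_diff[OF T assms(2,3)] in auto)
       (use T assms in \<open>auto intro!: L2_measurable bounded_ops_L2[OF T]\<close>)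
  also have "\<dots> \<le> e" using K(2)[OF L2_diff[OF assms(2,3)]] 0 \<open>e > 0\<close> by simp
  finally show "L2_norm M (\<lambda>x. T f x - T g x) \<le> e" .
qed (use assms in \<open>auto intro: bounded_ops_L2[OF T]\<close>)

lemma bounded_ops_norm_diff:
  assumes T: "T \<in> bounded_ops M" and "f \<in> L2 M" "g \<in> L2 M"
  shows "L2_norm M (\<lambda>x. T f x - T g x) = L2_norm M (T (\<lambda>x. f x - g x))"
  by (rule L2_norm_cong_AE, use bounded_ops_diff[OF T assms(2,3)] in auto)
     (use T assms in \<open>auto intro!: L2_measurable bounded_ops_L2[OF T]\<close>)

lemma bounded_ops_comp:
  assumes T: "T \<in> bounded_ops M" and S: "S \<in> bounded_ops M"
  shows "(\<lambda>\<xi>. T (S \<xi>)) \<in> bounded_ops M"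
proof -
  obtain K where K: "0 \<le> K" "\<And>f. f \<in> L2 M \<Longrightarrow> L2_norm M (T f) \<le> K * L2_norm M f"
    using bounded_ops_bound[OF T] by metis
  obtain L where L: "0 \<le> L" "\<And>f. f \<in> L2 M \<Longrightarrow> L2_norm M (S f) \<le> L * L2_norm M f"
    using bounded_ops_bound[OF S] by metis
  have "L2_norm M (T (S f)) \<le> (K * L) * L2_norm M f" if "f \<in> L2 M" for f
    using K(2)[OF bounded_ops_L2[OF S that]] mult_left_mono[OF L(2)[OF that] K(1)] by (simp add: mult.assoc)
  moreover have "AE x in M. T (S (\<lambda>x. f x + c * g x)) x = T (S f) x + c * T (S g) x"
    if "f \<in> L2 M" "g \<in> L2 M" for f g c
  proof -
    have "AE x in M. T (S (\<lambda>x. f x + c * g x)) x = T (\<lambda>x. S f x + c * S g x) x"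
      by (rule bounded_ops_cong[OF T])
         (use that S in \<open>auto intro!: bounded_ops_L2[OF S] L2_lin bounded_ops_lin[OF S]\<close>)
    with bounded_ops_lin[OF T bounded_ops_L2[OF S that(1)] bounded_ops_L2[OF S that(2)], of c]
    show ?thesis by eventually_elim simp
  qed
  ultimately show ?thesis using T S by (auto simp: bounded_ops_def)
qed

lemma bounded_ops_lincomb:
  assumes T: "T \<in> bounded_ops M" and S: "S \<in> bounded_ops M"
  shows "(\<lambda>\<xi> x. T \<xi> x + c * S \<xi> x) \<in> bounded_ops M"
proof -
  obtain K where K: "0 \<le> K" "\<And>f. f \<in> L2 M \<Longrightarrow> L2_norm M (T f) \<le> K * L2_norm M f"
    using bounded_ops_bound[OF T] by metis
  obtain L where L: "0 \<le> L" "\<And>f. f \<in> L2 M \<Longrightarrow> L2_norm M (S f) \<le> L * L2_norm M f"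
    using bounded_ops_bound[OF S] by metis
  have "L2_norm M (\<lambda>x. T f x + c * S f x) \<le> (K + cmod c * L) * L2_norm M f" if "f \<in> L2 M" for f
  proof -
    have "L2_norm M (\<lambda>x. T f x + c * S f x) \<le> L2_norm M (T f) + L2_norm M (\<lambda>x. c * S f x)"
      using that T S by (intro L2_norm_triangle) (auto intro: bounded_ops_L2[OF T] bounded_ops_L2[OF S])
    also have "\<dots> \<le> K * L2_norm M f + cmod c * (L * L2_norm M f)"
      unfolding L2_norm_scale using K(2) L(2) that by (intro add_mono mult_left_mono) auto
    finally show ?thesis by (simp add: algebra_simps)
  qed
  moreover have "AE x in M. T (\<lambda>x. f x + d * g x) x + c * S (\<lambda>x. f x + d * g x) x
      = (T f x + c * S f x) + d * (T g x + c * S g x)" if "f \<in> L2 M" "g \<in> L2 M" for f g d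
    using bounded_ops_lin[OF T that, of d] bounded_ops_lin[OF S that, of d]
    by eventually_elim (simp add: algebra_simps)
  ultimately show ?thesis
    using T S unfolding bounded_ops_def by (auto simp del: mult_minus_left)
qed

lemma adjoint_ops_sym: "adjoint_ops M T S \<Longrightarrow> adjoint_ops M S T"
  unfolding adjoint_ops_def by (metis L2_inner_commute)

lemma adjoint_opsD:
  "adjoint_ops M T S \<Longrightarrow> f \<in> L2 M \<Longrightarrow> g \<in> L2 M \<Longrightarrow> L2_inner M (T f) g = L2_inner M f (S g)"
  by (simp add: adjoint_ops_def)

text \<open>For each \<open>g\<close> the functional sending \<open>f\<close> to the inner product
  of \<open>T f\<close> and \<open>g\<close> is bounded, and Riesz supplies \<open>S g\<close>. The
  representing vectors are determined only almost everywhere, which is why linearity of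
  \<open>S\<close> is checked by testing against all \<open>h\<close>.\<close>

lemma bounded_ops_adjoint:
  assumes T: "T \<in> bounded_ops M"
  obtains S where "S \<in> bounded_ops M" "adjoint_ops M T S"
proof -
  obtain K where K: "0 \<le> K" "\<And>f. f \<in> L2 M \<Longrightarrow> L2_norm M (T f) \<le> K * L2_norm M f"
    using bounded_ops_bound[OF T] by metis
  have TL: "T f \<in> L2 M" if "f \<in> L2 M" for f using bounded_ops_L2[OF T that] .
  have "\<exists>s\<in>L2 M. \<forall>f\<in>L2 M. L2_inner M (T f) g = L2_inner M f s" if g: "g \<in> L2 M" for g
  proof -
    have lin: "L2_inner M (T (\<lambda>x. f x + c * f' x)) g = L2_inner M (T f) g + c * L2_inner M (T f') g"
      if "f \<in> L2 M" "f' \<in> L2 M" for f f' c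
    proof -
      have "L2_inner M (T (\<lambda>x. f x + c * f' x)) g = L2_inner M (\<lambda>x. T f x + c * T f' x) g"
        by (rule L2_inner_cong_AE[OF bounded_ops_lin[OF T that]])
           (use that g in \<open>auto intro!: L2_measurable TL L2_lin\<close>)
      then show ?thesis using L2_inner_lin_left[OF TL TL g] that by simp
    qed
    have "cmod (L2_inner M (T f) g) \<le> (K * L2_norm M g) * L2_norm M f" if "f \<in> L2 M" for f
      using L2_Cauchy_Schwarz[OF TL[OF that] g] mult_right_mono[OF K(2)[OF that] L2_norm_nonneg[of M g]]
      by (simp add: mult_ac)
    from L2_Riesz[where \<phi>="\<lambda>f. L2_inner M (T f) g", OF lin this]
    show ?thesis .
  qed
  then obtain S where S: "\<And>g. g \<in> L2 M \<Longrightarrow> S g \<in> L2 M"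
      "\<And>f g. g \<in> L2 M \<Longrightarrow> f \<in> L2 M \<Longrightarrow> L2_inner M (T f) g = L2_inner M f (S g)"
    by metis
  have adj: "adjoint_ops M T S" using S by (simp add: adjoint_ops_def)
  have "AE x in M. S (\<lambda>x. f x + c * g x) x = S f x + c * S g x" if "f \<in> L2 M" "g \<in> L2 M" for f g c
  proof (rule L2_eq_by_inner)
    fix h assume h: "h \<in> L2 M"
    have "L2_inner M h (S (\<lambda>x. f x + c * g x)) = L2_inner M (T h) (\<lambda>x. f x + c * g x)"
      using S(2)[OF L2_lin[OF that] h] by simp
    also have "\<dots> = L2_inner M (T h) f + cnj c * L2_inner M (T h) g"
      by (rule L2_inner_lin_right) (use that TL h in auto)
    also have "\<dots> = L2_inner M h (S f) + cnj c * L2_inner M h (S g)"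
      using S(2) that h by simp
    also have "\<dots> = L2_inner M h (\<lambda>x. S f x + c * S g x)"
      by (rule L2_inner_lin_right[symmetric]) (use that S h in auto)
    finally show "L2_inner M (S (\<lambda>x. f x + c * g x)) h = L2_inner M (\<lambda>x. S f x + c * S g x) h"
      by (subst (1 2) L2_inner_commute) simp
  qed (use that S in auto)
  moreover have "L2_norm M (S g) \<le> K * L2_norm M g" if g: "g \<in> L2 M" for g
  proof (cases "L2_norm M (S g) = 0")
    case False
    \<comment> \<open>Testing the defining identity of \<open>S\<close> at \<open>f = S g\<close>
      and cancelling one factor gives the bound.\<close>
    have "(L2_norm M (S g))\<^sup>2 = cmod (L2_inner M (S g) (S g))" unfolding L2_inner_self norm_of_real by simp
    also have "L2_inner M (S g) (S g) = L2_inner M (T (S g)) g" using S g by simp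
    also have "cmod (L2_inner M (T (S g)) g) \<le> L2_norm M (T (S g)) * L2_norm M g"
      by (rule L2_Cauchy_Schwarz) (use S g TL in auto)
    also have "\<dots> \<le> (K * L2_norm M (S g)) * L2_norm M g"
      by (intro mult_right_mono K S g) auto
    finally have "L2_norm M (S g) * L2_norm M (S g) \<le> L2_norm M (S g) * (K * L2_norm M g)"
      by (simp add: power2_eq_square mult_ac)
    moreover have "L2_norm M (S g) > 0" using False L2_norm_nonneg[of M "S g"] by linarith
    ultimately show ?thesis by (metis mult_le_cancel_left_pos)
  qed (use K in auto)
  ultimately have "S \<in> bounded_ops M" unfolding bounded_ops_def using S(1) by blast
  then show ?thesis using that adj by blast
qed

section \<open>Commutants of sets of operators\<close>

lemma commutant_bounded: "T \<in> commutant M A \<Longrightarrow> T \<in> bounded_ops M"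
  by (simp add: commutant_def)

lemma commutantD: "T \<in> commutant M A \<Longrightarrow> S \<in> A \<Longrightarrow> f \<in> L2 M \<Longrightarrow> AE x in M. T (S f) x = S (T f) x"
  by (simp add: commutant_def)

lemma commutantI:
  assumes "T \<in> bounded_ops M" "\<And>S f. S \<in> A \<Longrightarrow> f \<in> L2 M \<Longrightarrow> AE x in M. T (S f) x = S (T f) x"
  shows "T \<in> commutant M A"
  using assms by (simp add: commutant_def)

lemma commutant_subset_bounded: "commutant M A \<subseteq> bounded_ops M"
  by (auto simp: commutant_def)

lemma commutant_antimono: "A \<subseteq> B \<Longrightarrow> commutant M B \<subseteq> commutant M A"
  by (auto simp: commutant_def)

lemma commutant_commutant_superset: "A \<subseteq> bounded_ops M \<Longrightarrow> A \<subseteq> commutant M (commutant M A)"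
proof
  fix S assume "A \<subseteq> bounded_ops M" "S \<in> A"
  then show "S \<in> commutant M (commutant M A)"
    by (intro commutantI) (auto dest: commutantD[of _ M A S] simp: eq_commute)
qed

lemma commutant_triple:
  assumes "A \<subseteq> bounded_ops M"
  shows "commutant M (commutant M (commutant M A)) = commutant M A"
  using commutant_antimono[OF commutant_commutant_superset[OF assms]]
    commutant_commutant_superset[OF commutant_subset_bounded] by blast

lemma commutant_cong:
  assumes A: "A \<subseteq> bounded_ops M" and T: "T \<in> commutant M A"
    and T': "\<And>f. f \<in> L2 M \<Longrightarrow> T' f \<in> L2 M" "\<And>f. f \<in> L2 M \<Longrightarrow> AE x in M. T' f x = T f x"
  shows "T' \<in> commutant M A"
proof (rule commutantI)
  have Tb: "T \<in> bounded_ops M" using T by (rule commutant_bounded)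
  obtain K where K: "0 \<le> K" "\<And>f. f \<in> L2 M \<Longrightarrow> L2_norm M (T f) \<le> K * L2_norm M f"
    using bounded_ops_bound[OF Tb] by metis
  have "L2_norm M (T' f) = L2_norm M (T f)" if "f \<in> L2 M" for f
    by (rule L2_norm_cong_AE[OF T'(2)[OF that]])
       (use T'(1) that Tb in \<open>auto intro!: L2_measurable bounded_ops_L2[OF Tb]\<close>)
  then have "\<exists>K. \<forall>f\<in>L2 M. L2_norm M (T' f) \<le> K * L2_norm M f" using K(2) by auto
  moreover have "AE x in M. T' (\<lambda>x. f x + c * g x) x = T' f x + c * T' g x" if "f \<in> L2 M" "g \<in> L2 M" for f g c
    using T'(2)[OF L2_lin[OF that, of c]] T'(2)[OF that(1)] T'(2)[OF that(2)] bounded_ops_lin[OF Tb that, of c]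
    by eventually_elim simp
  ultimately show "T' \<in> bounded_ops M" using T'(1) by (auto simp: bounded_ops_def)
  fix S f assume S: "S \<in> A" and f: "f \<in> L2 M"
  have Sb: "S \<in> bounded_ops M" using S A by auto
  have "AE x in M. S (T' f) x = S (T f) x"
    by (rule bounded_ops_cong[OF Sb T'(1)[OF f] bounded_ops_L2[OF Tb f] T'(2)[OF f]])
  with T'(2)[OF bounded_ops_L2[OF Sb f]] commutantD[OF T S f]
  show "AE x in M. T' (S f) x = S (T' f) x" by eventually_elim simp
qed

lemma commutant_comp:
  assumes A: "A \<subseteq> bounded_ops M" and T: "T \<in> commutant M A" and R: "R \<in> commutant M A"
  shows "(\<lambda>\<xi>. T (R \<xi>)) \<in> commutant M A"
proof (rule commutantI)
  note b = commutant_bounded[OF T] commutant_bounded[OF R]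
  show "(\<lambda>\<xi>. T (R \<xi>)) \<in> bounded_ops M" by (rule bounded_ops_comp[OF b])
  fix S f assume S: "S \<in> A" and f: "f \<in> L2 M"
  then have Sb: "S \<in> bounded_ops M" using A by auto
  have "AE x in M. T (R (S f)) x = T (S (R f)) x"
    by (rule bounded_ops_cong[OF b(1) _ _ commutantD[OF R S f]]) (intro bounded_ops_L2[OF b(2)] bounded_ops_L2[OF Sb] f)+
  with commutantD[OF T S bounded_ops_L2[OF b(2) f]]
  show "AE x in M. T (R (S f)) x = S (T (R f)) x" by eventually_elim simp
qed

lemma commutant_lincomb:
  assumes A: "A \<subseteq> bounded_ops M" and T: "T \<in> commutant M A" and R: "R \<in> commutant M A"
  shows "(\<lambda>\<xi> x. T \<xi> x + c * R \<xi> x) \<in> commutant M A"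
proof (rule commutantI)
  note b = commutant_bounded[OF T] commutant_bounded[OF R]
  show "(\<lambda>\<xi> x. T \<xi> x + c * R \<xi> x) \<in> bounded_ops M" by (rule bounded_ops_lincomb[OF b])
  fix S f assume S: "S \<in> A" and f: "f \<in> L2 M"
  then have Sb: "S \<in> bounded_ops M" using A by auto
  show "AE x in M. T (S f) x + c * R (S f) x = S (\<lambda>x. T f x + c * R f x) x"
    using commutantD[OF T S f] commutantD[OF R S f]
      bounded_ops_lin[OF Sb bounded_ops_L2[OF b(1) f] bounded_ops_L2[OF b(2) f], of c]
    by eventually_elim simp
qed

lemma bounded_ops_const_zero [simp]: "(\<lambda>\<xi> x. 0) \<in> bounded_ops M"
  by (auto simp: bounded_ops_def intro!: exI[of _ 0])

lemma commutant_zero: "A \<subseteq> bounded_ops M \<Longrightarrow> (\<lambda>\<xi> x. 0) \<in> commutant M A"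
proof (rule commutantI)
  fix S f assume "A \<subseteq> bounded_ops M" "S \<in> A"
  then have "AE x in M. S (\<lambda>x. 0) x = 0" by (auto intro: bounded_ops_zero)
  then show "AE x in M. 0 = S (\<lambda>x. 0) x" by eventually_elim simp
qed simp

lemma commutant_sum:
  assumes A: "A \<subseteq> bounded_ops M" and T: "\<And>i. i \<in> I \<Longrightarrow> T i \<in> commutant M A"
  shows "(\<lambda>\<xi> x. \<Sum>i\<in>I. T i \<xi> x) \<in> commutant M A"
  using T
proof (induction I rule: infinite_finite_induct)
  case (insert i I)
  then have "(\<lambda>\<xi> x. T i \<xi> x + 1 * (\<Sum>i\<in>I. T i \<xi> x)) \<in> commutant M A"
    by (intro commutant_lincomb[OF A]) auto
  then show ?case using insert by simp
qed (auto intro: commutant_zero[OF A])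

lemma commutant_id: "(\<lambda>\<xi>. \<xi>) \<in> commutant M A"
  by (rule commutantI) (auto simp: bounded_ops_def intro!: exI[of _ 1])

text \<open>Convergence is used at \<open>S f\<close> and, through the bound of \<open>S\<close>, at
  \<open>f\<close>. Sequential strong limits are what the later approximations produce.\<close>

lemma commutant_limit:
  assumes A: "A \<subseteq> bounded_ops M" and T: "T \<in> bounded_ops M"
    and R: "\<And>n. R n \<in> commutant M A"
    and lim: "\<And>f. f \<in> L2 M \<Longrightarrow> (\<lambda>n::nat. L2_norm M (\<lambda>x. R n f x - T f x)) \<longlonglongrightarrow> 0"
  shows "T \<in> commutant M A"
proof (rule commutantI[OF T])
  fix S f assume S: "S \<in> A" and f: "f \<in> L2 M"
  then have Sb: "S \<in> bounded_ops M" using A by auto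
  have Rb: "R n \<in> bounded_ops M" for n using R by (rule commutant_bounded)
  obtain K where K: "0 \<le> K" "\<And>f. f \<in> L2 M \<Longrightarrow> L2_norm M (S f) \<le> K * L2_norm M f"
    using bounded_ops_bound[OF Sb] by metis
  note L = bounded_ops_L2[OF Rb f] bounded_ops_L2[OF T f] bounded_ops_L2[OF Sb f]
  have "L2_norm M (\<lambda>x. T (S f) x - S (T f) x)
     \<le> L2_norm M (\<lambda>x. R n (S f) x - T (S f) x) + K * L2_norm M (\<lambda>x. R n f x - T f x)" for n
  proof -
    have "L2_norm M (\<lambda>x. R n (S f) x - S (T f) x) = L2_norm M (\<lambda>x. S (R n f) x - S (T f) x)"
      by (rule L2_norm_cong_AE, use commutantD[OF R S f, of n] in auto)
         (use L Sb Rb T in \<open>auto intro!: L2_measurable bounded_ops_L2[OF Rb] bounded_ops_L2[OF T] bounded_ops_L2[OF Sb]\<close>)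
    also have "\<dots> = L2_norm M (S (\<lambda>x. R n f x - T f x))"
      by (rule bounded_ops_norm_diff[OF Sb L(1,2)])
    also have "\<dots> \<le> K * L2_norm M (\<lambda>x. R n f x - T f x)"
      by (rule K(2)) (use L in auto)
    finally have 1: "L2_norm M (\<lambda>x. R n (S f) x - S (T f) x) \<le> K * L2_norm M (\<lambda>x. R n f x - T f x)" .
    have "L2_norm M (\<lambda>x. T (S f) x - S (T f) x) \<le>
       L2_norm M (\<lambda>x. T (S f) x - R n (S f) x) + L2_norm M (\<lambda>x. R n (S f) x - S (T f) x)"
      by (rule L2_norm_triangle_diff) (use L Sb Rb T in \<open>auto intro!: bounded_ops_L2[OF Rb] bounded_ops_L2[OF T] bounded_ops_L2[OF Sb]\<close>)
    then show ?thesis using 1 L2_norm_minus_commute[of M "T (S f)" "R n (S f)"] by simp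
  qed
  moreover have "(\<lambda>n. L2_norm M (\<lambda>x. R n (S f) x - T (S f) x) + K * L2_norm M (\<lambda>x. R n f x - T f x)) \<longlonglongrightarrow> 0 + K * 0"
    by (intro tendsto_intros lim f L)
  ultimately have "L2_norm M (\<lambda>x. T (S f) x - S (T f) x) \<le> 0 + K * 0"
    by (intro LIMSEQ_le_const[where X="\<lambda>n. L2_norm M (\<lambda>x. R n (S f) x - T (S f) x) + K * L2_norm M (\<lambda>x. R n f x - T f x)"]) auto
  then show "AE x in M. T (S f) x = S (T f) x"
    by (intro L2_diff_norm_0) (use L Sb T in \<open>auto intro!: bounded_ops_L2[OF T] bounded_ops_L2[OF Sb]\<close>)
qed

text \<open>Moving \<open>S\<close> and \<open>R\<close> across the inner product turns the
  commutation of \<open>R\<close> with \<open>S\<close> into that of \<open>T\<close> with the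
  adjoint \<open>S'\<close>, which also lies in \<open>A\<close>.\<close>

lemma adjoint_in_commutant:
  assumes A: "A \<subseteq> bounded_ops M" and adj: "\<And>S. S \<in> A \<Longrightarrow> \<exists>S'\<in>A. adjoint_ops M S S'"
    and T: "T \<in> commutant M A" and R: "R \<in> bounded_ops M" and TR: "adjoint_ops M T R"
  shows "R \<in> commutant M A"
proof (rule commutantI[OF R])
  fix S f assume S: "S \<in> A" and f: "f \<in> L2 M"
  then have Sb: "S \<in> bounded_ops M" using A by auto
  obtain S' where S': "S' \<in> A" "adjoint_ops M S S'" using adj[OF S] by blast
  have Sb': "S' \<in> bounded_ops M" using S' A by auto
  have Tb: "T \<in> bounded_ops M" using T by (rule commutant_bounded)
  note RT = adjoint_ops_sym[OF TR]
  show "AE x in M. R (S f) x = S (R f) x"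
  proof (rule L2_eq_by_inner)
    fix g assume g: "g \<in> L2 M"
    have "L2_inner M (R (S f)) g = L2_inner M (S f) (T g)"
      by (intro adjoint_opsD[OF RT] bounded_ops_L2[OF Sb] f g)
    also have "\<dots> = L2_inner M f (S' (T g))"
      by (intro adjoint_opsD[OF S'(2)] bounded_ops_L2[OF Tb] f g)
    also have "\<dots> = L2_inner M f (T (S' g))"
      by (rule L2_inner_cong_AE, use commutantD[OF T S'(1) g] in \<open>auto simp: eq_commute\<close>)
         (use f g Sb' Tb in \<open>auto intro!: L2_measurable bounded_ops_L2[OF Sb'] bounded_ops_L2[OF Tb]\<close>)
    also have "\<dots> = L2_inner M (R f) (S' g)"
      by (intro adjoint_opsD[OF RT, symmetric] bounded_ops_L2[OF Sb'] f g)
    also have "\<dots> = L2_inner M (S (R f)) g"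
      by (intro adjoint_opsD[OF S'(2), symmetric] bounded_ops_L2[OF R] f g)
    finally show "L2_inner M (R (S f)) g = L2_inner M (S (R f)) g" .
  qed (use R Sb f in \<open>auto intro!: bounded_ops_L2[OF R] bounded_ops_L2[OF Sb]\<close>)
qed

lemma adjoint_commutant_ex:
  assumes A: "A \<subseteq> bounded_ops M" and adj: "\<And>S. S \<in> A \<Longrightarrow> \<exists>S'\<in>A. adjoint_ops M S S'"
    and T: "T \<in> commutant M A"
  shows "\<exists>R\<in>commutant M A. adjoint_ops M T R"
  using bounded_ops_adjoint[OF commutant_bounded[OF T]] adjoint_in_commutant[OF A adj T] by metis

lemma von_neumann_algebra_commutant:
  assumes A: "A \<subseteq> bounded_ops M" and adj: "\<And>S. S \<in> A \<Longrightarrow> \<exists>S'\<in>A. adjoint_ops M S S'"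
  shows "von_neumann_algebra M (commutant M A)"
  unfolding von_neumann_algebra_def
  using commutant_subset_bounded commutant_triple[OF A] adjoint_commutant_ex[OF A adj] by blast

lemma von_neumann_algebra_bicommutant:
  assumes A: "A \<subseteq> bounded_ops M" and adj: "\<And>S. S \<in> A \<Longrightarrow> \<exists>S'\<in>A. adjoint_ops M S S'"
  shows "von_neumann_algebra M (commutant M (commutant M A))"
  by (rule von_neumann_algebra_commutant[OF commutant_subset_bounded adjoint_commutant_ex[OF A adj]])

text \<open>An operator is determined by its value on a tracial vector, and approximation of this value
  suffices to approximate the operator weakly: by the trace property the adjoints are approximated
  as well, which is what lets one pass to the limit in matrix coefficients of a commutator.\<close>

lemma in_bicommutant_of_approx:
  assumes Q: "Q \<subseteq> bounded_ops M" and Qadj: "\<And>S. S \<in> Q \<Longrightarrow> \<exists>S'\<in>Q. adjoint_ops M S S'"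
    and v: "v \<in> L2 M"
    and total: "\<And>z. z \<in> L2 M \<Longrightarrow> (\<And>q. q \<in> Q \<Longrightarrow> L2_inner M z (q v) = 0) \<Longrightarrow> AE x in M. z x = 0"
    and trace: "\<And>T S. T \<in> commutant M Q \<Longrightarrow> S \<in> commutant M Q \<Longrightarrow> adjoint_ops M T S \<Longrightarrow>
          L2_norm M (T v) = L2_norm M (S v)"
    and A: "A \<subseteq> commutant M Q" and Aadj: "\<And>S. S \<in> A \<Longrightarrow> \<exists>S'\<in>A. adjoint_ops M S S'"
    and T: "T \<in> commutant M Q"
    and approx: "\<And>e. e > 0 \<Longrightarrow> \<exists>n\<in>A. L2_norm M (\<lambda>x. T v x - n v x) < e"
  shows "T \<in> commutant M (commutant M A)"
proof (rule commutantI)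
  show Tb: "T \<in> bounded_ops M" using T by (rule commutant_bounded)
  fix T' f assume T': "T' \<in> commutant M A" and f: "f \<in> L2 M"
  have Tb': "T' \<in> bounded_ops M" using T' by (rule commutant_bounded)
  obtain Ts where Ts: "Ts \<in> commutant M Q" "adjoint_ops M T Ts"
    using adjoint_commutant_ex[OF Q Qadj T] by blast
  have Tsb: "Ts \<in> bounded_ops M" using Ts(1) by (rule commutant_bounded)
  \<comment> \<open>The commutator of \<open>T\<close> and \<open>T'\<close>, to be shown zero by
    its matrix coefficients on the vectors \<open>q v\<close>.\<close>
  define C where "C = (\<lambda>\<xi> x. T (T' \<xi>) x + (-1) * T' (T \<xi>) x)"
  have Cb: "C \<in> bounded_ops M" unfolding C_def
    by (rule bounded_ops_lincomb[OF bounded_ops_comp[OF Tb Tb'] bounded_ops_comp[OF Tb' Tb]])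
  obtain Cs where Cs: "Cs \<in> bounded_ops M" "adjoint_ops M C Cs" using bounded_ops_adjoint[OF Cb] .
  have main: "L2_inner M (C (q v)) (r v) = 0" if q: "q \<in> Q" and r: "r \<in> Q" for q r
  proof -
    have qb: "q \<in> bounded_ops M" and rb: "r \<in> bounded_ops M" using q r Q by auto
    have qv: "q v \<in> L2 M" and rv: "r v \<in> L2 M" using qb rb v by (auto intro: bounded_ops_L2[OF qb] bounded_ops_L2[OF rb])
    obtain Kq where Kq: "0 \<le> Kq" "\<And>f. f \<in> L2 M \<Longrightarrow> L2_norm M (q f) \<le> Kq * L2_norm M f"
    using bounded_ops_bound[OF qb] by metis
    obtain Kr where Kr: "0 \<le> Kr" "\<And>f. f \<in> L2 M \<Longrightarrow> L2_norm M (r f) \<le> Kr * L2_norm M f"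
    using bounded_ops_bound[OF rb] by metis
    obtain K' where K': "0 \<le> K'" "\<And>f. f \<in> L2 M \<Longrightarrow> L2_norm M (T' f) \<le> K' * L2_norm M f"
    using bounded_ops_bound[OF Tb'] by metis
    \<comment> \<open>Operators commuting with \<open>Q\<close> satisfy
      \<open>R (q v) = q (R v)\<close>, so smallness at \<open>v\<close> spreads to all of
      \<open>Q v\<close> although no operator norm of \<open>R\<close> is controlled.\<close>
    have ctrl: "L2_norm M (R (q v)) \<le> K * L2_norm M (R v)"
      if "R \<in> commutant M Q" "q \<in> Q" "\<And>f. f \<in> L2 M \<Longrightarrow> L2_norm M (q f) \<le> K * L2_norm M f" for R q K
    proof -
      have Rb: "R \<in> bounded_ops M" using that(1) by (rule commutant_bounded)
      have "L2_norm M (R (q v)) = L2_norm M (q (R v))"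
        by (rule L2_norm_cong_AE[OF commutantD[OF that(1,2) v]])
           (use v in \<open>auto intro!: L2_measurable bounded_ops_L2[OF Rb] bounded_ops_L2[OF subsetD[OF Q that(2)]]\<close>)
      then show ?thesis using that(3)[OF bounded_ops_L2[OF Rb v]] by simp
    qed
    have est: "cmod (L2_inner M (C (q v)) (r v)) \<le> e * (K' * Kq * L2_norm M (r v) + Kr * L2_norm M (T' (q v)))"
      if e0: "e > 0" for e
    proof -
      obtain n where n: "n \<in> A" "L2_norm M (\<lambda>x. T v x - n v x) < e" using approx[OF e0] by blast
      obtain m where m: "m \<in> A" "adjoint_ops M n m" using Aadj[OF n(1)] by blast
      have nc: "n \<in> commutant M Q" and mc: "m \<in> commutant M Q" using n m A by auto
      have nb: "n \<in> bounded_ops M" and mb: "m \<in> bounded_ops M"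
        using nc mc by (auto intro: commutant_bounded)
      \<comment> \<open>\<open>D\<close> is the error of the approximation and \<open>Ds\<close> its
        adjoint; the trace hypothesis makes \<open>Ds v\<close> as small as
        \<open>D v\<close>.\<close>
      define D where "D = (\<lambda>\<xi> x. T \<xi> x + (-1) * n \<xi> x)"
      define Ds where "Ds = (\<lambda>\<xi> x. Ts \<xi> x + (-1) * m \<xi> x)"
      have Dc: "D \<in> commutant M Q" unfolding D_def by (rule commutant_lincomb[OF Q T nc])
      have Dsc: "Ds \<in> commutant M Q" unfolding Ds_def by (rule commutant_lincomb[OF Q Ts(1) mc])
      have Db: "D \<in> bounded_ops M" and Dsb: "Ds \<in> bounded_ops M"
        using Dc Dsc by (auto intro: commutant_bounded)
      have "adjoint_ops M D Ds"
        unfolding adjoint_ops_def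
      proof (intro ballI)
        fix f g assume f: "f \<in> L2 M" and g: "g \<in> L2 M"
        have "L2_inner M (D f) g = L2_inner M (T f) g + (-1) * L2_inner M (n f) g"
          unfolding D_def by (rule L2_inner_lin_left) (use f g Tb nb in \<open>auto intro: bounded_ops_L2[OF Tb] bounded_ops_L2[OF nb]\<close>)
        also have "\<dots> = L2_inner M f (Ts g) + cnj (-1) * L2_inner M f (m g)"
          using adjoint_opsD[OF Ts(2) f g] adjoint_opsD[OF m(2) f g] by simp
        also have "\<dots> = L2_inner M f (Ds g)"
          unfolding Ds_def
          by (rule L2_inner_lin_right[symmetric]) (use f g Tsb mb in \<open>auto intro: bounded_ops_L2[OF Tsb] bounded_ops_L2[OF mb]\<close>)
        finally show "L2_inner M (D f) g = L2_inner M f (Ds g)" .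
      qed
      then have "L2_norm M (D v) = L2_norm M (Ds v)" by (rule trace[OF Dc Dsc])
      then have small: "L2_norm M (D v) < e" "L2_norm M (Ds v) < e"
        using n(2) by (simp_all add: D_def)
      note L = bounded_ops_L2[OF Tb] bounded_ops_L2[OF Tb'] bounded_ops_L2[OF nb] bounded_ops_L2[OF mb]
        bounded_ops_L2[OF Tsb] bounded_ops_L2[OF Db] bounded_ops_L2[OF Dsb] qv rv
      have e1: "L2_inner M (T (T' (q v))) (r v) = L2_inner M (T' (q v)) (Ts (r v))"
        by (rule adjoint_opsD[OF Ts(2)]) (intro L)+
      have "L2_inner M (T' (n (q v))) (r v) = L2_inner M (n (T' (q v))) (r v)"
        by (rule L2_inner_cong_AE[OF commutantD[OF T' n(1) qv]])
           (auto intro!: L2_measurable L)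
      also have "\<dots> = L2_inner M (T' (q v)) (m (r v))"
        by (rule adjoint_opsD[OF m(2)]) (intro L)+
      finally have e2: "L2_inner M (T' (n (q v))) (r v) = L2_inner M (T' (q v)) (m (r v))" .
      have "L2_inner M (C (q v)) (r v) = L2_inner M (T (T' (q v))) (r v) + (-1) * L2_inner M (T' (T (q v))) (r v)"
        unfolding C_def by (rule L2_inner_lin_left) (intro L)+
      \<comment> \<open>Since \<open>n\<close> commutes with \<open>T'\<close>, its commutator may
        be subtracted at no cost. What remains has one term with \<open>Ds\<close> applied to
        \<open>r v\<close> and one with \<open>D\<close> applied to \<open>q v\<close>.\<close>
      also have "\<dots> = (L2_inner M (T' (q v)) (Ts (r v)) - L2_inner M (T' (q v)) (m (r v)))
            - (L2_inner M (T' (T (q v))) (r v) - L2_inner M (T' (n (q v))) (r v))"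
        using e1 e2 by simp
      also have "\<dots> = L2_inner M (T' (q v)) (Ds (r v)) - L2_inner M (\<lambda>x. T' (T (q v)) x - T' (n (q v)) x) (r v)"
        unfolding Ds_def by (subst L2_inner_diff_left, (intro L)+)
          (simp add: L2_inner_diff_right L)
      finally have "cmod (L2_inner M (C (q v)) (r v)) \<le> cmod (L2_inner M (T' (q v)) (Ds (r v)))
          + cmod (L2_inner M (\<lambda>x. T' (T (q v)) x - T' (n (q v)) x) (r v))"
        by (simp add: norm_triangle_ineq4)
      also have "cmod (L2_inner M (T' (q v)) (Ds (r v))) \<le> L2_norm M (T' (q v)) * L2_norm M (Ds (r v))"
        by (rule L2_Cauchy_Schwarz) (intro L)+
      also have "\<dots> \<le> L2_norm M (T' (q v)) * (Kr * e)"
        using ctrl[OF Dsc r Kr(2)] mult_left_mono[OF less_imp_le[OF small(2)] Kr(1)]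
        by (intro mult_left_mono) auto
      also have "cmod (L2_inner M (\<lambda>x. T' (T (q v)) x - T' (n (q v)) x) (r v))
          \<le> L2_norm M (\<lambda>x. T' (T (q v)) x - T' (n (q v)) x) * L2_norm M (r v)"
        by (rule L2_Cauchy_Schwarz) (intro L2_diff L)+
      also have "L2_norm M (\<lambda>x. T' (T (q v)) x - T' (n (q v)) x) = L2_norm M (T' (D (q v)))"
        using bounded_ops_norm_diff[OF Tb', of "T (q v)" "n (q v)"] L by (simp add: D_def)
      also have "\<dots> \<le> K' * L2_norm M (D (q v))" by (rule K') (intro L)
      also have "\<dots> \<le> K' * (Kq * e)"
        using ctrl[OF Dc q Kq(2)] mult_left_mono[OF less_imp_le[OF small(1)] Kq(1)]
        by (intro mult_left_mono K') auto
      finally show ?thesis by (simp add: algebra_simps mult_right_mono)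
    qed
    define B where "B = K' * Kq * L2_norm M (r v) + Kr * L2_norm M (T' (q v))"
    have B: "0 \<le> B" unfolding B_def using K' Kq Kr by simp
    have "cmod (L2_inner M (C (q v)) (r v)) \<le> 0 + e" if "e > 0" for e
    proof -
      have "cmod (L2_inner M (C (q v)) (r v)) \<le> (e / (B + 1)) * B"
        using est[of "e / (B + 1)"] that B by (simp add: B_def)
      also have "\<dots> \<le> e" using B that by (simp add: field_simps)
      finally show ?thesis by simp
    qed
    then have "cmod (L2_inner M (C (q v)) (r v)) \<le> 0" by (rule field_le_epsilon)
    then show ?thesis by simp
  qed
  have vL: "q v \<in> L2 M" if "q \<in> Q" for q by (rule bounded_ops_L2[OF subsetD[OF Q that] v])
  have Cq: "AE x in M. C (q v) x = 0" if "q \<in> Q" for q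
    by (rule total[OF bounded_ops_L2[OF Cb vL[OF that]]]) (rule main[OF that])
  \<comment> \<open>Totality speaks of vectors orthogonal to \<open>Q v\<close>. As \<open>C\<close>
    is already zero on \<open>Q v\<close>, the range of \<open>Cs\<close> is orthogonal to it, and
    \<open>Cs = 0\<close> gives \<open>C = 0\<close>.\<close>
  have Cs0: "AE x in M. Cs h x = 0" if h: "h \<in> L2 M" for h
  proof (rule total[OF bounded_ops_L2[OF Cs(1) h]])
    fix q assume q: "q \<in> Q"
    have "L2_inner M (Cs h) (q v) = L2_inner M h (C (q v))"
      by (rule adjoint_opsD[OF adjoint_ops_sym[OF Cs(2)] h vL[OF q]])
    also have "\<dots> = L2_inner M h (\<lambda>x. 0)"
      by (rule L2_inner_cong_AE[OF _ Cq[OF q]])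
         (use h q vL Cb in \<open>auto intro!: L2_measurable bounded_ops_L2[OF Cb]\<close>)
    finally show "L2_inner M (Cs h) (q v) = 0" by (simp add: L2_inner_def)
  qed
  have "AE x in M. C f x = 0"
  proof (rule L2_eq_by_inner)
    fix h assume h: "h \<in> L2 M"
    have "L2_inner M (C f) h = L2_inner M f (Cs h)" by (rule adjoint_opsD[OF Cs(2) f h])
    also have "\<dots> = L2_inner M f (\<lambda>x. 0)"
      by (rule L2_inner_cong_AE[OF _ Cs0[OF h]])
         (use h f Cs in \<open>auto intro!: L2_measurable bounded_ops_L2[OF Cs(1)]\<close>)
    finally show "L2_inner M (C f) h = L2_inner M (\<lambda>x. 0) h" by (simp add: L2_inner_def)
  qed (use f Cb in \<open>auto intro: bounded_ops_L2[OF Cb]\<close>)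
  then show "AE x in M. T (T' f) x = T' (T f) x" by (simp add: C_def)
qed

section \<open>Multiplication operators and measure-preserving substitutions\<close>

lemma Linfty_mult_bounded_ops:
  assumes "w \<in> Linfty M"
  shows "(\<lambda>\<xi> x. w x * \<xi> x) \<in> bounded_ops M"
proof -
  obtain C where C: "AE x in M. cmod (w x) \<le> C" and [measurable]: "w \<in> borel_measurable M"
    using assms by (auto simp: Linfty_def)
  have b: "AE x in M. cmod (w x * f x) \<le> \<bar>C\<bar> * cmod (f x)" for f
    using C by eventually_elim (auto simp: norm_mult intro!: mult_right_mono)
  have L: "(\<lambda>x. w x * f x) \<in> L2 M" if "f \<in> L2 M" for f
  proof (rule L2_bound[OF that _ b])
    show "(\<lambda>x. w x * f x) \<in> borel_measurable M" using L2_measurable[OF that] by measurable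
  qed
  have "L2_norm M (\<lambda>x. w x * f x) \<le> \<bar>C\<bar> * L2_norm M f" if "f \<in> L2 M" for f
    by (rule L2_norm_mono[OF L[OF that] that b]) simp
  then show ?thesis using L by (auto simp: bounded_ops_def algebra_simps)
qed

lemma Linfty_mult_L2: "w \<in> Linfty M \<Longrightarrow> \<xi> \<in> L2 M \<Longrightarrow> (\<lambda>x. w x * \<xi> x) \<in> L2 M"
  using bounded_ops_L2[OF Linfty_mult_bounded_ops] .

lemma adjoint_ops_mult: "adjoint_ops M (\<lambda>\<xi> x. w x * \<xi> x) (\<lambda>\<xi> x. cnj (w x) * \<xi> x)"
  by (simp add: adjoint_ops_def L2_inner_def mult_ac)

text \<open>Dominated convergence: the pointwise limit inherits the bound \<open>C\<close>, so the
  integrand is dominated by \<open>(2 C)^2 |\<xi>|^2\<close>. This is the source of the strong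
  limits of multiplication operators below.\<close>

lemma Linfty_mult_tendsto:
  assumes w: "\<And>n::nat. w n \<in> borel_measurable M" "\<And>n. AE x in M. cmod (w n x) \<le> C"
    and lim: "AE x in M. (\<lambda>n. w n x) \<longlonglongrightarrow> w' x" and w': "w' \<in> borel_measurable M"
    and \<xi>: "\<xi> \<in> L2 M"
  shows "(\<lambda>n. L2_norm M (\<lambda>x. w n x * \<xi> x - w' x * \<xi> x)) \<longlonglongrightarrow> 0"
proof -
  note [measurable] = w(1) w' L2_measurable[OF \<xi>]
  have "AE x in M. \<forall>n. cmod (w n x) \<le> C" using w(2) by (simp add: AE_all_countable)
  then have bw': "AE x in M. cmod (w' x) \<le> C"
    using lim by eventually_elim (rule LIMSEQ_le_const2[OF tendsto_norm], auto)
  have "(\<lambda>n. LINT x|M. (cmod (w n x * \<xi> x - w' x * \<xi> x))\<^sup>2) \<longlonglongrightarrow> (LINT x|M. 0)"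
  proof (rule integral_dominated_convergence[where w="\<lambda>x. (2 * C)\<^sup>2 * (cmod (\<xi> x))\<^sup>2"])
    show "integrable M (\<lambda>x. (2 * C)\<^sup>2 * (cmod (\<xi> x))\<^sup>2)" using L2_integrable[OF \<xi>] by simp
    show "AE x in M. (\<lambda>n. (cmod (w n x * \<xi> x - w' x * \<xi> x))\<^sup>2) \<longlonglongrightarrow> 0"
      using lim
    proof eventually_elim
      case (elim x)
      have "(\<lambda>n. (cmod (w n x * \<xi> x - w' x * \<xi> x))\<^sup>2) \<longlonglongrightarrow> (cmod (w' x * \<xi> x - w' x * \<xi> x))\<^sup>2"
        by (intro tendsto_intros elim)
      then show ?case by simp
    qed
    fix n
    show "AE x in M. norm ((cmod (w n x * \<xi> x - w' x * \<xi> x))\<^sup>2) \<le> (2 * C)\<^sup>2 * (cmod (\<xi> x))\<^sup>2"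
      using bw' w(2)[of n]
    proof eventually_elim
      case (elim x)
      have "cmod (w n x - w' x) \<le> 2 * C" using norm_triangle_ineq4[of "w n x" "w' x"] elim by linarith
      then have "cmod (w n x * \<xi> x - w' x * \<xi> x) \<le> (2 * C) * cmod (\<xi> x)"
        by (metis left_diff_distrib mult_right_mono norm_ge_zero norm_mult)
      then have "(cmod (w n x * \<xi> x - w' x * \<xi> x))\<^sup>2 \<le> ((2 * C) * cmod (\<xi> x))\<^sup>2" by (intro power_mono) auto
      then show ?case by (simp add: power_mult_distrib)
    qed
  qed measurable
  then have "(\<lambda>n. sqrt (LINT x|M. (cmod (w n x * \<xi> x - w' x * \<xi> x))\<^sup>2)) \<longlonglongrightarrow> sqrt 0"
    by (intro tendsto_real_sqrt) simp
  then show ?thesis by (simp add: L2_norm_def)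
qed

lemma L2_inner_distr:
  assumes [measurable]: "\<Phi> \<in> measurable M M" and "distr M M \<Phi> = M" and "f \<in> L2 M" "g \<in> L2 M"
  shows "L2_inner M (\<lambda>x. f (\<Phi> x)) (\<lambda>x. g (\<Phi> x)) = L2_inner M f g"
proof -
  have [measurable]: "f \<in> borel_measurable M" "g \<in> borel_measurable M"
    using assms by (auto intro: L2_measurable)
  have "L2_inner M f g = (LINT x|distr M M \<Phi>. f x * cnj (g x))"
    using assms(2) by (simp add: L2_inner_def)
  also have "\<dots> = (LINT x|M. f (\<Phi> x) * cnj (g (\<Phi> x)))"
    by (rule integral_distr) measurable
  finally show ?thesis by (simp add: L2_inner_def)
qed

lemma L2_distr:
  assumes \<Phi>: "\<Phi> \<in> measurable M M" "distr M M \<Phi> = M" and f: "f \<in> L2 M"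
  shows "(\<lambda>x. f (\<Phi> x)) \<in> L2 M"
proof -
  have [measurable]: "f \<in> borel_measurable M" using f by (rule L2_measurable)
  have "integrable (distr M M \<Phi>) (\<lambda>x. (cmod (f x))\<^sup>2)" using \<Phi> L2_integrable[OF f] by simp
  then have "integrable M (\<lambda>x. (cmod (f (\<Phi> x)))\<^sup>2)"
    by (subst (asm) integrable_distr_eq) (use \<Phi> in auto)
  moreover have "(\<lambda>x. f (\<Phi> x)) \<in> borel_measurable M" using \<Phi>(1) by measurable
  ultimately show ?thesis by (simp add: L2_def)
qed

lemma L2_norm_distr:
  assumes "\<Phi> \<in> measurable M M" "distr M M \<Phi> = M" "f \<in> L2 M"
  shows "L2_norm M (\<lambda>x. f (\<Phi> x)) = L2_norm M f"
proof -
  have "(L2_norm M (\<lambda>x. f (\<Phi> x)))\<^sup>2 = (L2_norm M f)\<^sup>2"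
    using L2_inner_distr[OF assms assms(3)] unfolding L2_inner_self of_real_eq_iff .
  then show ?thesis by simp
qed

lemma bounded_ops_distr:
  assumes "\<Phi> \<in> measurable M M" "distr M M \<Phi> = M"
  shows "(\<lambda>\<xi> x. \<xi> (\<Phi> x)) \<in> bounded_ops M"
  using L2_distr[OF assms] L2_norm_distr[OF assms]
  by (auto simp: bounded_ops_def intro!: exI[of _ 1])


section \<open>The crossed product Hilbert space\<close>

text \<open>Countability of the group makes its counting measure \<sigma>-finite, and lets
  measurability and null sets on the product be checked slice by slice.\<close>

locale crossed_action = group G for G :: "('g, 'm) monoid_scheme" (structure) +
  fixes X :: "'x measure" and a :: "'g \<Rightarrow> 'x \<Rightarrow> 'x"
  assumes countable_G: "countable (carrier G)" and pmp: "pmp_action G X a"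
begin

abbreviation H :: "('x \<times> 'g) measure" where "H \<equiv> crossed_space G X"

sublocale X: prob_space X
  using pmp by (simp add: pmp_action_def standard_probability_space_def)

sublocale X: group_action G "space X" a
  using pmp by (simp add: pmp_action_def)

sublocale XG: pair_sigma_finite X "count_space (carrier G)"
  by (intro pair_sigma_finite.intro X.sigma_finite_measure_axioms
      sigma_finite_measure_count_space_countable countable_G)

lemma act_space: "g \<in> carrier G \<Longrightarrow> x \<in> space X \<Longrightarrow> a g x \<in> space X"
  using X.element_image by blast

lemma act_one: "x \<in> space X \<Longrightarrow> a \<one> x = x"
  using X.id_eq_one by (metis restrict_apply')

lemma act_mult: "x \<in> space X \<Longrightarrow> g \<in> carrier G \<Longrightarrow> h \<in> carrier G \<Longrightarrow> a g (a h x) = a (g \<otimes> h) x"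
  using X.composition_rule by simp

lemma act_inv: "x \<in> space X \<Longrightarrow> g \<in> carrier G \<Longrightarrow> a (inv g) (a g x) = x"
  by (simp add: act_mult act_one)

lemma act_inv': "x \<in> space X \<Longrightarrow> g \<in> carrier G \<Longrightarrow> a g (a (inv g) x) = x"
  by (simp add: act_mult act_one)

lemma act_meas: "g \<in> carrier G \<Longrightarrow> a g \<in> measurable X X"
  using pmp by (simp add: pmp_action_def)

lemma act_distr: "g \<in> carrier G \<Longrightarrow> distr X X (a g) = X"
  using pmp by (simp add: pmp_action_def)

lemma act_AE:
  assumes "g \<in> carrier G" "AE x in X. P x"
  shows "AE x in X. P (a g x)"
  by (rule AE_distrD[OF act_meas[OF assms(1)]]) (unfold act_distr[OF assms(1)], rule assms(2))

lemma space_H: "space H = space X \<times> carrier G"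
  by (simp add: crossed_space_def space_pair_measure)

lemma measurable_H:
  assumes "\<And>h. h \<in> carrier G \<Longrightarrow> (\<lambda>x. F (x, h)) \<in> measurable X M"
  shows "F \<in> measurable H M"
proof -
  have "(\<lambda>(h, x). F (x, h)) \<in> measurable (count_space (carrier G) \<Otimes>\<^sub>M X) M"
    by (rule measurable_pair_measure_countable1[OF countable_G]) (use assms in simp)
  from measurable_pair_swap[OF this] show ?thesis
    by (simp add: crossed_space_def case_prod_unfold)
qed

lemma measurable_slice: "F \<in> measurable H M \<Longrightarrow> h \<in> carrier G \<Longrightarrow> (\<lambda>x. F (x, h)) \<in> measurable X M"
  unfolding crossed_space_def by (rule measurable_Pair1) auto

lemma nn_integral_H:
  assumes "F \<in> borel_measurable H"
  shows "(\<integral>\<^sup>+z. F z \<partial>H) = (\<integral>\<^sup>+h. (\<integral>\<^sup>+x. F (x, h) \<partial>X) \<partial>count_space (carrier G))"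
  using XG.nn_integral_snd[of F] assms by (simp add: crossed_space_def)

text \<open>A null set of the product has null slices because counting measure charges every point;
  conversely countably many null slices make a null set. Almost everywhere statements thus reduce to
  single group elements.\<close>

lemma AE_H: "(AE z in H. P z) \<longleftrightarrow> (\<forall>h\<in>carrier G. AE x in X. P (x, h))"
proof
  assume "AE z in H. P z"
  then obtain N where N: "N \<in> null_sets H" "{z \<in> space H. \<not> P z} \<subseteq> N"
    by (auto elim!: AE_E simp: null_sets_def)
  show "\<forall>h\<in>carrier G. AE x in X. P (x, h)"
  proof
    fix h assume h: "h \<in> carrier G"
    have Nm: "N \<in> sets H" using N by auto
    have "0 = (\<integral>\<^sup>+z. indicator N z \<partial>H)" using N Nm by (simp add: null_sets_def)
    also have "\<dots> = (\<integral>\<^sup>+h. (\<integral>\<^sup>+x. indicator N (x, h) \<partial>X) \<partial>count_space (carrier G))"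
      by (rule nn_integral_H) (use Nm in simp)
    finally have "AE h in count_space (carrier G). (\<integral>\<^sup>+x. indicator N (x, h) \<partial>X) = 0"
      by (subst (asm) eq_commute, subst (asm) nn_integral_0_iff_AE) auto
    then have "(\<integral>\<^sup>+x. indicator N (x, h) \<partial>X) = 0" using h by (simp add: AE_count_space)
    then have "AE x in X. indicator N (x, h) = (0::ennreal)"
      by (subst (asm) nn_integral_0_iff_AE) (use Nm h in \<open>auto intro!: measurable_slice\<close>)
    then show "AE x in X. P (x, h)"
      by (rule AE_mp) (use N h in \<open>auto intro!: AE_I2 simp: space_H indicator_def split: if_splits\<close>)
  qed
next
  assume "\<forall>h\<in>carrier G. AE x in X. P (x, h)"
  then have "\<forall>h\<in>carrier G. \<exists>N. N \<in> null_sets X \<and> {x \<in> space X. \<not> P (x, h)} \<subseteq> N"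
    by (simp add: eventually_ae_filter) blast
  then obtain N where N: "\<And>h. h \<in> carrier G \<Longrightarrow> N h \<in> null_sets X"
      "\<And>h. h \<in> carrier G \<Longrightarrow> {x \<in> space X. \<not> P (x, h)} \<subseteq> N h" by metis
  have "(\<Union>h\<in>carrier G. N h \<times> {h}) \<in> null_sets H"
  proof (rule null_sets_UN'[OF countable_G])
    fix h assume h: "h \<in> carrier G"
    have "emeasure H (N h \<times> {h}) = emeasure X (N h) * emeasure (count_space (carrier G)) {h}"
      unfolding crossed_space_def
      by (rule XG.M2.emeasure_pair_measure_Times) (use N(1)[OF h] h in auto)
    moreover have "N h \<times> {h} \<in> sets H"
      unfolding crossed_space_def using N(1)[OF h] h by (intro pair_measureI) auto
    ultimately show "N h \<times> {h} \<in> null_sets H" using N(1)[OF h] by (auto simp: null_sets_def)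
  qed
  then show "AE z in H. P z"
    by (rule AE_I') (use N(2) in \<open>force simp: space_H\<close>)
qed

text \<open>Integrating over \<open>x\<close> for fixed \<open>h\<close> removes the
  measure-preserving \<open>\<tau> h\<close>, and the permutation \<theta> then only reorders the
  sum over the group. The same form covers the left action, right translation and the inversion
  \<open>(x, h) \<mapsto> (a (inv h) x, inv h)\<close>.\<close>

lemma
  assumes \<tau>: "\<And>h. h \<in> carrier G \<Longrightarrow> \<tau> h \<in> measurable X X" "\<And>h. h \<in> carrier G \<Longrightarrow> distr X X (\<tau> h) = X"
    and \<theta>: "bij_betw \<theta> (carrier G) (carrier G)"
  shows skew_measurable: "(\<lambda>(x, h). (\<tau> h x, \<theta> h)) \<in> measurable H H" (is "?\<Phi> \<in> _")
    and skew_distr: "distr H H (\<lambda>(x, h). (\<tau> h x, \<theta> h)) = H"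
proof -
  have \<theta>c: "\<theta> h \<in> carrier G" if "h \<in> carrier G" for h using \<theta> that by (auto simp: bij_betw_def)
  show m: "?\<Phi> \<in> measurable H H"
  proof (rule measurable_H)
    fix h assume h: "h \<in> carrier G"
    have "(\<lambda>x. (\<tau> h x, \<theta> h)) \<in> measurable X (X \<Otimes>\<^sub>M count_space (carrier G))"
      using \<tau>(1)[OF h] \<theta>c[OF h] by (intro measurable_Pair) auto
    then show "(\<lambda>x. ?\<Phi> (x, h)) \<in> measurable X H" by (simp add: crossed_space_def)
  qed
  show "distr H H ?\<Phi> = H"
  proof (rule measure_eqI)
    fix A assume A: "A \<in> sets (distr H H ?\<Phi>)"
    then have A': "A \<in> sets H" by simp
    have mA: "(\<lambda>x. indicator A (x, h) :: ennreal) \<in> borel_measurable X" if "h \<in> carrier G" for h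
      by (rule measurable_slice[OF _ that]) (use A' in simp)
    have "emeasure (distr H H ?\<Phi>) A = (\<integral>\<^sup>+z. indicator A z \<partial>distr H H ?\<Phi>)" using A by simp
    also have "\<dots> = (\<integral>\<^sup>+z. indicator A (?\<Phi> z) \<partial>H)"
      by (rule nn_integral_distr[OF m]) (use A' in simp)
    also have "\<dots> = (\<integral>\<^sup>+h. (\<integral>\<^sup>+x. indicator A (\<tau> h x, \<theta> h) \<partial>X) \<partial>count_space (carrier G))"
      by (subst nn_integral_H) (use m A' in auto)
    also have "\<dots> = (\<integral>\<^sup>+h. (\<integral>\<^sup>+x. indicator A (x, \<theta> h) \<partial>X) \<partial>count_space (carrier G))"
    proof (rule nn_integral_cong)
      fix h assume "h \<in> space (count_space (carrier G))"
      then have h: "h \<in> carrier G" by simp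
      have "(\<integral>\<^sup>+x. indicator A (x, \<theta> h) \<partial>X) = (\<integral>\<^sup>+x. indicator A (x, \<theta> h) \<partial>distr X X (\<tau> h))"
        using \<tau>(2)[OF h] by simp
      also have "\<dots> = (\<integral>\<^sup>+x. indicator A (\<tau> h x, \<theta> h) \<partial>X)"
        by (rule nn_integral_distr[OF \<tau>(1)[OF h]]) (use mA[OF \<theta>c[OF h]] in simp)
      finally show "(\<integral>\<^sup>+x. indicator A (\<tau> h x, \<theta> h) \<partial>X) = (\<integral>\<^sup>+x. indicator A (x, \<theta> h) \<partial>X)" ..
    qed
    also have "\<dots> = (\<integral>\<^sup>+h. (\<integral>\<^sup>+x. indicator A (x, h) \<partial>X) \<partial>count_space (carrier G))"
      by (rule nn_integral_bij_count_space[OF \<theta>])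
    also have "\<dots> = (\<integral>\<^sup>+z. indicator A z \<partial>H)"
      by (rule nn_integral_H[symmetric]) (use A' in simp)
    finally show "emeasure (distr H H ?\<Phi>) A = emeasure H A" using A' by simp
  qed simp
qed

text \<open>Expressing a slice as a density on \<open>H\<close> transfers Bochner integrals between
  \<open>X\<close> and \<open>H\<close> without a Fubini argument for each integrand.\<close>

lemma distr_slice:
  assumes g: "g \<in> carrier G"
  shows "distr X H (\<lambda>x. (x, g)) = density H (\<lambda>z. ennreal (indicator {g} (snd z)))"
proof (rule measure_eqI)
  have m: "(\<lambda>x. (x, g)) \<in> measurable X H" using g by (simp add: crossed_space_def)
  have i: "(\<lambda>z. indicator {g} (snd z) :: real) \<in> borel_measurable H"
    by (rule measurable_H) simp
  fix A assume "A \<in> sets (distr X H (\<lambda>x. (x, g)))"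
  then have A: "A \<in> sets H" by simp
  have "emeasure (density H (\<lambda>z. ennreal (indicator {g} (snd z)))) A
      = (\<integral>\<^sup>+z. ennreal (indicator {g} (snd z)) * indicator A z \<partial>H)"
    by (rule emeasure_density) (use i A in auto)
  also have "\<dots> = (\<integral>\<^sup>+h. (\<integral>\<^sup>+x. ennreal (indicator {g} h) * indicator A (x, h) \<partial>X) \<partial>count_space (carrier G))"
    by (subst nn_integral_H) (use i A in auto)
  also have "\<dots> = (\<Sum>h\<in>{g}. \<integral>\<^sup>+x. ennreal (indicator {g} h) * indicator A (x, h) \<partial>X)"
    by (rule nn_integral_count_space') (use g in auto)
  also have "\<dots> = (\<integral>\<^sup>+x. indicator ((\<lambda>x. (x, g)) -` A \<inter> space X) x \<partial>X)"
    by (simp, rule nn_integral_cong) (auto simp: indicator_def)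
  also have "\<dots> = emeasure X ((\<lambda>x. (x, g)) -` A \<inter> space X)"
    by (rule nn_integral_indicator) (use m A in \<open>auto intro: measurable_sets\<close>)
  also have "\<dots> = emeasure (distr X H (\<lambda>x. (x, g))) A"
    by (rule emeasure_distr[symmetric]) (use m A in auto)
  finally show "emeasure (distr X H (\<lambda>x. (x, g))) A = emeasure (density H (\<lambda>z. ennreal (indicator {g} (snd z)))) A" ..
qed simp

lemma
  fixes F :: "'x \<times> 'g \<Rightarrow> 'b::{banach, second_countable_topology}"
  assumes g: "g \<in> carrier G" and F: "F \<in> borel_measurable H"
  shows integral_slice: "(LINT z|H. indicator {g} (snd z) *\<^sub>R F z) = (LINT x|X. F (x, g))"
    and integrable_slice: "integrable H (\<lambda>z. indicator {g} (snd z) *\<^sub>R F z) \<longleftrightarrow> integrable X (\<lambda>x. F (x, g))"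
proof -
  have m: "(\<lambda>x. (x, g)) \<in> measurable X H" using g by (simp add: crossed_space_def)
  have i: "(\<lambda>z. indicator {g} (snd z) :: real) \<in> borel_measurable H"
    by (rule measurable_H) simp
  have "(LINT x|X. F (x, g)) = (LINT z|distr X H (\<lambda>x. (x, g)). F z)"
    by (rule integral_distr[OF m F, symmetric])
  also have "\<dots> = (LINT z|H. indicator {g} (snd z) *\<^sub>R F z)"
    unfolding distr_slice[OF g] by (rule integral_density[OF F i]) simp
  finally show "(LINT z|H. indicator {g} (snd z) *\<^sub>R F z) = (LINT x|X. F (x, g))" ..
  have "integrable X (\<lambda>x. F (x, g)) \<longleftrightarrow> integrable (distr X H (\<lambda>x. (x, g))) F"
    by (rule integrable_distr_eq[OF m F, symmetric])
  also have "\<dots> \<longleftrightarrow> integrable H (\<lambda>z. indicator {g} (snd z) *\<^sub>R F z)"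
    unfolding distr_slice[OF g] by (rule integrable_density[OF F i]) simp
  finally show "integrable H (\<lambda>z. indicator {g} (snd z) *\<^sub>R F z) \<longleftrightarrow> integrable X (\<lambda>x. F (x, g))" ..
qed

section \<open>Slices, and the vectors f \<otimes> \<delta> carried by a single group
  element\<close>

definition emb :: "('x \<Rightarrow> complex) \<Rightarrow> 'g \<Rightarrow> 'x \<times> 'g \<Rightarrow> complex" where
  "emb f g = (\<lambda>(x, h). if h = g then f x else 0)"

lemma emb_eq: "emb f g z = indicator {g} (snd z) *\<^sub>R f (fst z)"
  by (simp add: emb_def case_prod_unfold)

lemma fst_measurable: "f \<in> borel_measurable X \<Longrightarrow> (\<lambda>z. f (fst z)) \<in> borel_measurable H"
  by (rule measurable_H) simp

lemma emb_measurable: "f \<in> borel_measurable X \<Longrightarrow> emb f g \<in> borel_measurable H"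
  by (rule measurable_H) (simp add: emb_def)

lemma emb_L2:
  assumes f: "f \<in> L2 X" and g: "g \<in> carrier G"
  shows "emb f g \<in> L2 H"
proof -
  note f' = L2_measurable[OF f]
  have m: "(\<lambda>z. (cmod (f (fst z)))\<^sup>2) \<in> borel_measurable H" by (rule measurable_H, simp) (use f' in measurable)
  have "integrable H (\<lambda>z. indicator {g} (snd z) *\<^sub>R (cmod (f (fst z)))\<^sup>2)"
    using L2_integrable[OF f] by (subst integrable_slice[OF g m]) simp
  also have "(\<lambda>z. indicator {g} (snd z) *\<^sub>R (cmod (f (fst z)))\<^sup>2) = (\<lambda>z. (cmod (emb f g z))\<^sup>2)"
    by (auto simp: emb_eq indicator_def)
  finally show ?thesis using emb_measurable[OF f'] by (simp add: L2_def)
qed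

lemma emb_norm:
  assumes f: "f \<in> borel_measurable X" and g: "g \<in> carrier G"
  shows "L2_norm H (emb f g) = L2_norm X f"
proof -
  have m: "(\<lambda>z. (cmod (f (fst z)))\<^sup>2) \<in> borel_measurable H" by (rule measurable_H, simp) (use f in measurable)
  have "(\<lambda>z. indicator {g} (snd z) *\<^sub>R (cmod (f (fst z)))\<^sup>2) = (\<lambda>z. (cmod (emb f g z))\<^sup>2)"
    by (auto simp: emb_eq indicator_def)
  then show ?thesis using integral_slice[OF g m] by (simp add: L2_norm_def)
qed

lemma L2_slice:
  assumes \<xi>: "\<xi> \<in> L2 H" and g: "g \<in> carrier G"
  shows "(\<lambda>x. \<xi> (x, g)) \<in> L2 X"
proof -
  note m = L2_measurable[OF \<xi>]
  have m2: "(\<lambda>z. (cmod (\<xi> z))\<^sup>2) \<in> borel_measurable H" using m by measurable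
  have i: "(\<lambda>z. indicator {g} (snd z) :: real) \<in> borel_measurable H"
    by (rule measurable_H) simp
  have "integrable H (\<lambda>z. indicator {g} (snd z) *\<^sub>R (cmod (\<xi> z))\<^sup>2)"
    by (rule Bochner_Integration.integrable_bound[OF L2_integrable[OF \<xi>]])
       (use i m2 in \<open>auto simp: indicator_def\<close>)
  then show ?thesis
    using integrable_slice[OF g m2] measurable_slice[OF m g] by (simp add: L2_def)
qed

lemma emb_slice_L2: "\<xi> \<in> L2 H \<Longrightarrow> g \<in> carrier G \<Longrightarrow> emb (\<lambda>x. \<xi> (x, g)) g \<in> L2 H"
  by (intro emb_L2 L2_slice)

lemma emb_slice_eq: "emb (\<lambda>x. \<xi> (x, g)) g z = indicator {g} (snd z) *\<^sub>R \<xi> z"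
  by (cases z) (auto simp: emb_def)

lemma L2_norm_slice:
  assumes \<xi>: "\<xi> \<in> L2 H" and g: "g \<in> carrier G"
  shows "L2_norm X (\<lambda>x. \<xi> (x, g)) \<le> L2_norm H \<xi>"
proof -
  have "L2_norm H (emb (\<lambda>x. \<xi> (x, g)) g) \<le> 1 * L2_norm H \<xi>"
    by (rule L2_norm_mono[OF emb_slice_L2[OF assms] \<xi>]) (auto simp: emb_slice_eq indicator_def)
  then show ?thesis
    using emb_norm[OF L2_measurable[OF L2_slice[OF assms]] g] by simp
qed

lemma inner_emb:
  assumes \<xi>: "\<xi> \<in> borel_measurable H" and f: "f \<in> borel_measurable X" and g: "g \<in> carrier G"
  shows "L2_inner H \<xi> (emb f g) = L2_inner X (\<lambda>x. \<xi> (x, g)) f"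
proof -
  have m: "(\<lambda>z. \<xi> z * cnj (f (fst z))) \<in> borel_measurable H"
    using \<xi> fst_measurable[OF f] by measurable
  have "(\<lambda>z. indicator {g} (snd z) *\<^sub>R (\<xi> z * cnj (f (fst z)))) = (\<lambda>z. \<xi> z * cnj (emb f g z))"
    by (auto simp: emb_eq indicator_def)
  then show ?thesis using integral_slice[OF g m] by (simp add: L2_inner_def)
qed

lemma L2_finite_approx:
  assumes \<xi>: "\<xi> \<in> L2 H" and e: "e > 0"
  obtains F where "finite F" "F \<subseteq> carrier G"
    "L2_norm H (\<lambda>z. \<xi> z - (\<Sum>g\<in>F. emb (\<lambda>x. \<xi> (x, g)) g z)) < e"
proof -
  \<comment> \<open>The first \<open>n\<close> group elements in an enumeration, with repetitions if
    the group is finite; cutting a vector down to them is multiplication by a bounded function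
    converging to 1.\<close>
  define E where "E n = from_nat_into (carrier G) ` {..<n}" for n
  have ne: "carrier G \<noteq> {}" using one_closed by auto
  have Efin: "finite (E n)" "E n \<subseteq> carrier G" for n
    unfolding E_def using from_nat_into[OF ne] by auto
  define w :: "nat \<Rightarrow> 'x \<times> 'g \<Rightarrow> complex" where "w n z = indicator (E n) (snd z)" for n z
  have "(\<lambda>n. L2_norm H (\<lambda>z. w n z * \<xi> z - (\<lambda>_. 1) z * \<xi> z)) \<longlonglongrightarrow> 0"
  proof (rule Linfty_mult_tendsto[OF _ _ _ _ \<xi>, where C=1])
    show "w n \<in> borel_measurable H" for n by (rule measurable_H) (simp add: w_def)
    show "AE z in H. cmod (w n z) \<le> 1" for n by (auto simp: w_def indicator_def)
    show "AE z in H. (\<lambda>n. w n z) \<longlonglongrightarrow> 1"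
    proof (rule AE_I2)
      fix z assume "z \<in> space H"
      then have "snd z \<in> carrier G" by (auto simp: space_H)
      then obtain k where k: "from_nat_into (carrier G) k = snd z"
        using from_nat_into_surj[OF countable_G] by blast
      have "w n z = 1" if "n \<ge> Suc k" for n
        using k that by (auto simp: w_def E_def indicator_def image_iff intro!: bexI[of _ k])
      then show "(\<lambda>n. w n z) \<longlonglongrightarrow> 1"
        by (intro tendsto_eventually) (auto simp: eventually_sequentially)
    qed
  qed simp
  then have "\<forall>\<^sub>F n in sequentially. L2_norm H (\<lambda>z. w n z * \<xi> z - \<xi> z) < e"
    using order_tendstoD(2)[OF _ e] by simp
  then obtain n where n: "L2_norm H (\<lambda>z. w n z * \<xi> z - \<xi> z) < e"
    by (auto simp: eventually_sequentially)
  have "(\<Sum>g\<in>E n. emb (\<lambda>x. \<xi> (x, g)) g z) = w n z * \<xi> z" for z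
    using Efin(1)[of n] by (cases z) (simp add: emb_def w_def indicator_def sum.delta')
  then have "L2_norm H (\<lambda>z. \<xi> z - (\<Sum>g\<in>E n. emb (\<lambda>x. \<xi> (x, g)) g z)) < e"
    using n by (simp add: L2_norm_minus_commute[of H \<xi>])
  then show ?thesis using that Efin by blast
qed

text \<open>Off the finite set of a good approximation a vector has the same slices as the error.
  This is the finiteness that infinite conjugacy classes are played against.\<close>

lemma finite_large_slices:
  assumes \<xi>: "\<xi> \<in> L2 H" and e: "e > 0"
  shows "finite {g \<in> carrier G. L2_norm X (\<lambda>x. \<xi> (x, g)) \<ge> e}"
proof -
  obtain F where F: "finite F" "F \<subseteq> carrier G"
      "L2_norm H (\<lambda>z. \<xi> z - (\<Sum>g\<in>F. emb (\<lambda>x. \<xi> (x, g)) g z)) < e"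
    using L2_finite_approx[OF assms] .
  have L: "(\<lambda>z. \<xi> z - (\<Sum>g\<in>F. emb (\<lambda>x. \<xi> (x, g)) g z)) \<in> L2 H"
    using F by (intro L2_diff \<xi> L2_sum emb_slice_L2) auto
  have "L2_norm X (\<lambda>x. \<xi> (x, g)) < e" if "g \<in> carrier G" "g \<notin> F" for g
  proof -
    have "(\<lambda>x. \<xi> (x, g)) = (\<lambda>x. \<xi> (x, g) - (\<Sum>k\<in>F. emb (\<lambda>x. \<xi> (x, k)) k (x, g)))"
      using that(2) by (auto simp: emb_def fun_eq_iff intro!: sum.neutral)
    then show ?thesis using L2_norm_slice[OF L that(1)] F(3) by simp
  qed
  then have "{g \<in> carrier G. L2_norm X (\<lambda>x. \<xi> (x, g)) \<ge> e} \<subseteq> F" by force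
  then show ?thesis using F(1) finite_subset by blast
qed

lemma Linfty_fst: "f \<in> Linfty X \<Longrightarrow> (\<lambda>z. f (fst z)) \<in> Linfty H"
  by (auto simp: Linfty_def AE_H intro!: fst_measurable)

lemma mult_op_eq: "mult_op f = (\<lambda>\<xi> z. f (fst z) * \<xi> z)"
  by (auto simp: mult_op_def fun_eq_iff)

lemma mult_op_bounded: "f \<in> Linfty X \<Longrightarrow> mult_op f \<in> bounded_ops H"
  unfolding mult_op_eq by (rule Linfty_mult_bounded_ops[OF Linfty_fst])

lemma mult_op_adjoint: "adjoint_ops H (mult_op f) (mult_op (\<lambda>x. cnj (f x)))"
  unfolding mult_op_eq by (rule adjoint_ops_mult)

lemma mult_op_L2: "f \<in> Linfty X \<Longrightarrow> \<xi> \<in> L2 H \<Longrightarrow> mult_op f \<xi> \<in> L2 H"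
  using bounded_ops_L2[OF mult_op_bounded] .

lemma inv_bij: "bij_betw (\<lambda>h. inv h) (carrier G) (carrier G)"
  by (rule bij_betw_byWitness[where f'="\<lambda>h. inv h"]) auto

lemma left_bij: "g \<in> carrier G \<Longrightarrow> bij_betw (\<lambda>h. g \<otimes> h) (carrier G) (carrier G)"
  by (rule bij_betw_byWitness[where f'="\<lambda>h. inv g \<otimes> h"]) (auto simp: m_assoc[symmetric])

lemma right_bij: "g \<in> carrier G \<Longrightarrow> bij_betw (\<lambda>h. h \<otimes> g) (carrier G) (carrier G)"
  by (rule bij_betw_byWitness[where f'="\<lambda>h. h \<otimes> inv g"]) (auto simp: m_assoc)

lemma group_op_eq: "group_op G a g = (\<lambda>\<xi> z. \<xi> ((\<lambda>(x, h). (a (inv g) x, inv g \<otimes> h)) z))"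
  by (auto simp: group_op_def fun_eq_iff)

lemma group_skew:
  assumes "g \<in> carrier G"
  shows "(\<lambda>(x, h). (a g x, g \<otimes> h)) \<in> measurable H H" "distr H H (\<lambda>(x, h). (a g x, g \<otimes> h)) = H"
  using skew_measurable[of "\<lambda>h. a g", OF _ _ left_bij] skew_distr[of "\<lambda>h. a g", OF _ _ left_bij]
    act_meas act_distr assms by auto

lemma group_op_bounded:
  assumes "g \<in> carrier G"
  shows "group_op G a g \<in> bounded_ops H"
  unfolding group_op_eq using assms by (intro bounded_ops_distr group_skew) auto

lemma group_op_adjoint:
  assumes g: "g \<in> carrier G"
  shows "adjoint_ops H (group_op G a g) (group_op G a (inv g))"
  unfolding adjoint_ops_def
proof (intro ballI)
  fix f k assume f: "f \<in> L2 H" and k: "k \<in> L2 H"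
  let ?\<Phi> = "\<lambda>(x, h). (a g x, g \<otimes> h)"
  have "L2_inner H (group_op G a g f) k = L2_inner H (\<lambda>z. group_op G a g f (?\<Phi> z)) (\<lambda>z. k (?\<Phi> z))"
    by (rule L2_inner_distr[symmetric, OF group_skew[OF g] bounded_ops_L2[OF group_op_bounded[OF g] f] k])
  also have "\<dots> = L2_inner H f (group_op G a (inv g) k)"
    unfolding L2_inner_def
    by (rule Bochner_Integration.integral_cong)
       (use g in \<open>auto simp: group_op_def space_H act_inv m_assoc[symmetric]\<close>)
  finally show "L2_inner H (group_op G a g f) k = L2_inner H f (group_op G a (inv g) k)" .
qed

text \<open>Right multiplications; these operators play the role of the commutant of the crossed product.\<close>

definition rop :: "('x \<Rightarrow> complex) \<Rightarrow> 'g \<Rightarrow> ('x \<times> 'g \<Rightarrow> complex) \<Rightarrow> 'x \<times> 'g \<Rightarrow> complex" where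
  "rop F g \<xi> = (\<lambda>(x, h). F (a (inv h) x) * \<xi> (x, h \<otimes> g))"

definition rops :: "(('x \<times> 'g \<Rightarrow> complex) \<Rightarrow> 'x \<times> 'g \<Rightarrow> complex) set" where
  "rops = {rop F g | F g. F \<in> Linfty X \<and> g \<in> carrier G}"

definition vac :: "'x \<times> 'g \<Rightarrow> complex" where
  "vac = emb (\<lambda>_. 1) \<one>"

lemma Linfty_act:
  assumes F: "F \<in> Linfty X" and g: "g \<in> carrier G"
  shows "(\<lambda>x. F (a g x)) \<in> Linfty X"
proof -
  obtain C where C: "AE x in X. cmod (F x) \<le> C" and m: "F \<in> borel_measurable X"
    using F by (auto simp: Linfty_def)
  from act_AE[OF g C] show ?thesis
    using measurable_compose[OF act_meas[OF g] m] by (auto simp: Linfty_def)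
qed

lemma Linfty_twist:
  assumes F: "F \<in> Linfty X"
  shows "(\<lambda>(x, h). F (a (inv h) x)) \<in> Linfty H"
proof -
  obtain C where C: "AE x in X. cmod (F x) \<le> C" and m: "F \<in> borel_measurable X"
    using F by (auto simp: Linfty_def)
  have "AE z in H. cmod ((\<lambda>(x, h). F (a (inv h) x)) z) \<le> C"
    unfolding AE_H using act_AE[OF _ C] by auto
  moreover have "(\<lambda>(x, h). F (a (inv h) x)) \<in> borel_measurable H"
    by (rule measurable_H) (use measurable_compose[OF act_meas m] in simp)
  ultimately show ?thesis by (auto simp: Linfty_def)
qed

lemma right_skew:
  assumes "g \<in> carrier G"
  shows "(\<lambda>(x, h). (x, h \<otimes> g)) \<in> measurable H H" "distr H H (\<lambda>(x, h). (x, h \<otimes> g)) = H"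
  using skew_measurable[of "\<lambda>h x. x", OF _ _ right_bij] skew_distr[of "\<lambda>h x. x", OF _ _ right_bij]
    assms by (auto simp: distr_id2)

lemma rop_bounded:
  assumes F: "F \<in> Linfty X" and g: "g \<in> carrier G"
  shows "rop F g \<in> bounded_ops H"
proof -
  have "rop F g = (\<lambda>\<xi>. (\<lambda>\<xi> z. (\<lambda>(x, h). F (a (inv h) x)) z * \<xi> z) ((\<lambda>\<xi> z. \<xi> ((\<lambda>(x, h). (x, h \<otimes> g)) z)) \<xi>))"
    by (auto simp: rop_def fun_eq_iff)
  then show ?thesis
    using bounded_ops_comp[OF Linfty_mult_bounded_ops[OF Linfty_twist[OF F]] bounded_ops_distr[OF right_skew[OF g]]]
    by simp
qed

lemma rops_bounded: "rops \<subseteq> bounded_ops H"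
  by (auto simp: rops_def rop_bounded)

lemma Linfty_cnj: "F \<in> Linfty M \<Longrightarrow> (\<lambda>x. cnj (F x)) \<in> Linfty M"
  by (auto simp: Linfty_def)

lemma rop_adjoint:
  assumes F: "F \<in> Linfty X" and g: "g \<in> carrier G"
  shows "adjoint_ops H (rop F g) (rop (\<lambda>x. cnj (F (a g x))) (inv g))"
  unfolding adjoint_ops_def
proof (intro ballI)
  fix f k assume f: "f \<in> L2 H" and k: "k \<in> L2 H"
  let ?\<Phi> = "\<lambda>(x, h). (x, h \<otimes> inv g)"
  have "L2_inner H (rop F g f) k = L2_inner H (\<lambda>z. rop F g f (?\<Phi> z)) (\<lambda>z. k (?\<Phi> z))"
    by (rule L2_inner_distr[symmetric, OF right_skew bounded_ops_L2[OF rop_bounded[OF F g] f] k]) (use g in auto)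
  also have "\<dots> = L2_inner H f (rop (\<lambda>x. cnj (F (a g x))) (inv g) k)"
    unfolding L2_inner_def
    by (rule Bochner_Integration.integral_cong)
       (use g in \<open>auto simp: rop_def space_H act_mult inv_mult_group m_assoc\<close>)
  finally show "L2_inner H (rop F g f) k = L2_inner H f (rop (\<lambda>x. cnj (F (a g x))) (inv g) k)" .
qed

lemma rops_adjoint: "S \<in> rops \<Longrightarrow> \<exists>S'\<in>rops. adjoint_ops H S S'"
proof -
  assume "S \<in> rops"
  then obtain F g where S: "S = rop F g" and F: "F \<in> Linfty X" and g: "g \<in> carrier G"
    by (auto simp: rops_def)
  have "rop (\<lambda>x. cnj (F (a g x))) (inv g) \<in> rops"
    using Linfty_cnj[OF Linfty_act[OF F g]] g by (auto simp: rops_def)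
  then show ?thesis using rop_adjoint[OF F g] S by blast
qed

lemma Linfty_const: "(\<lambda>_. c) \<in> Linfty M"
  by (auto simp: Linfty_def)

lemma Linfty_L2:
  assumes "f \<in> Linfty X"
  shows "f \<in> L2 X"
proof -
  obtain C where C: "AE x in X. cmod (f x) \<le> C" and m: "f \<in> borel_measurable X"
    using assms by (auto simp: Linfty_def)
  have "(\<lambda>x. 1) \<in> L2 X" by (simp add: L2_def)
  then show ?thesis by (rule L2_bound[where C=C]) (use C m in auto)
qed

lemma vac_L2: "vac \<in> L2 H"
  unfolding vac_def by (intro emb_L2 Linfty_L2 Linfty_const one_closed)

text \<open>The symbol is precomposed with \<open>a h\<close> so that the twist in
  \<open>rop\<close> cancels on the only slice that survives. Right operators therefore reach every
  bounded function on every slice, which is the cyclicity of \<open>vac\<close>.\<close>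

lemma rop_vac:
  assumes "F \<in> Linfty X" "h \<in> carrier G" "z \<in> space H"
  shows "rop (\<lambda>x. F (a h x)) (inv h) vac z = emb F h z"
proof -
  obtain x k where z: "z = (x, k)" "x \<in> space X" "k \<in> carrier G" using assms by (auto simp: space_H)
  have "k \<otimes> inv h = \<one> \<longleftrightarrow> k = h"
    using z assms by (metis inv_equality inv_inv inv_closed r_inv)
  then show ?thesis using z assms by (auto simp: rop_def vac_def emb_def act_inv')
qed

text \<open>The test function \<open>z / (1 + |z|)\<close> is bounded by 1, and its inner product
  with \<open>z\<close> is the integral of the nonnegative function
  \<open>|z|^2 / (1 + |z|)\<close>, which vanishes only where \<open>z\<close> does.\<close>

lemma eq_0_by_Linfty:
  assumes z: "z \<in> L2 M" and orth: "\<And>F. F \<in> Linfty M \<Longrightarrow> L2_inner M z F = 0"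
  shows "AE x in M. z x = 0"
proof -
  note [measurable] = L2_measurable[OF z]
  define F where "F x = z x / complex_of_real (1 + cmod (z x))" for x
  have pos: "1 + cmod (z x) > 0" for x using norm_ge_zero[of "z x"] by linarith
  have "cmod (F x) \<le> 1" for x
    using pos[of x] by (simp add: F_def norm_divide del: of_real_add)
  then have F: "F \<in> Linfty M" by (auto simp: Linfty_def F_def[abs_def])
  have e: "z x * cnj (F x) = complex_of_real ((cmod (z x))\<^sup>2 / (1 + cmod (z x)))" for x
    by (simp add: F_def complex_norm_square mult.commute del: of_real_add of_real_power)
  have "(LINT x|M. (cmod (z x))\<^sup>2 / (1 + cmod (z x))) = 0"
    using orth[OF F] unfolding L2_inner_def e by (simp only: integral_complex_of_real of_real_eq_0_iff)
  moreover have "integrable M (\<lambda>x. (cmod (z x))\<^sup>2 / (1 + cmod (z x)))"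
  proof (rule Bochner_Integration.integrable_bound[OF L2_integrable[OF z]])
    have "(cmod (z x))\<^sup>2 / (1 + cmod (z x)) \<le> (cmod (z x))\<^sup>2" for x
      using pos[of x] by (simp add: divide_le_eq mult_le_cancel_left1)
    then show "AE x in M. norm ((cmod (z x))\<^sup>2 / (1 + cmod (z x))) \<le> norm ((cmod (z x))\<^sup>2)"
      using pos by (simp add: less_imp_le)
  qed measurable
  ultimately have "AE x in M. (cmod (z x))\<^sup>2 / (1 + cmod (z x)) = 0"
    using pos by (subst (asm) integral_nonneg_eq_0_iff_AE) (auto simp: less_imp_le)
  then show ?thesis
  proof eventually_elim
    case (elim x)
    then show ?case using pos[of x] by auto
  qed
qed

lemma inner_rop_vac:
  assumes F: "F \<in> Linfty X" and h: "h \<in> carrier G" and z: "z \<in> L2 H"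
  shows "L2_inner H z (rop (\<lambda>x. F (a h x)) (inv h) vac) = L2_inner X (\<lambda>x. z (x, h)) F"
proof -
  have "L2_inner H z (rop (\<lambda>x. F (a h x)) (inv h) vac) = L2_inner H z (emb F h)"
    unfolding L2_inner_def
    by (rule Bochner_Integration.integral_cong) (use F h rop_vac in auto)
  then show ?thesis
    using inner_emb[OF L2_measurable[OF z] _ h] F by (simp add: Linfty_def)
qed

lemma rops_vac_total:
  assumes z: "z \<in> L2 H" and orth: "\<And>q. q \<in> rops \<Longrightarrow> L2_inner H z (q vac) = 0"
  shows "AE x in H. z x = 0"
  unfolding AE_H
proof
  fix h assume h: "h \<in> carrier G"
  show "AE x in X. z (x, h) = 0"
  proof (rule eq_0_by_Linfty[OF L2_slice[OF z h]])
    fix F assume F: "F \<in> Linfty X"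
    have "rop (\<lambda>x. F (a h x)) (inv h) \<in> rops"
      using Linfty_act[OF F h] h by (auto simp: rops_def)
    from orth[OF this] show "L2_inner X (\<lambda>x. z (x, h)) F = 0"
      using inner_rop_vac[OF F h z] by simp
  qed
qed

lemma inv_skew:
  "(\<lambda>(x, h). (a (inv h) x, inv h)) \<in> measurable H H" "distr H H (\<lambda>(x, h). (a (inv h) x, inv h)) = H"
  using skew_measurable[of "\<lambda>h. a (inv h)", OF _ _ inv_bij] skew_distr[of "\<lambda>h. a (inv h)", OF _ _ inv_bij]
    act_meas act_distr by auto

text \<open>The modular conjugation sends \<xi> to
  \<open>(x, h) \<mapsto> cnj (\<xi> (a (inv h) x, inv h))\<close>. It is isometric because the
  inversion preserves the measure of \<open>H\<close>, and it exchanges \<open>T vac\<close> with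
  the vector of the adjoint.\<close>

lemma vac_trace:
  assumes T: "T \<in> commutant H rops" and S: "S \<in> commutant H rops" and adj: "adjoint_ops H T S"
  shows "L2_norm H (T vac) = L2_norm H (S vac)"
proof -
  have Tb: "T \<in> bounded_ops H" and Sb: "S \<in> bounded_ops H" using T S by (auto intro: commutant_bounded)
  define t where "t = T vac"
  define s where "s = S vac"
  have t: "t \<in> L2 H" unfolding t_def by (rule bounded_ops_L2[OF Tb vac_L2])
  have s: "s \<in> L2 H" unfolding s_def by (rule bounded_ops_L2[OF Sb vac_L2])
  define j where "j z = cnj (s ((\<lambda>(x, h). (a (inv h) x, inv h)) z))" for z
  have j': "(\<lambda>z. s ((\<lambda>(x, h). (a (inv h) x, inv h)) z)) \<in> L2 H" by (rule L2_distr[OF inv_skew s])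
  have j: "j \<in> L2 H"
    by (rule L2_bound[OF j', where C=1]) (use L2_measurable[OF j'] in \<open>auto simp: j_def[abs_def]\<close>)
  have "AE z in H. t z - j z = 0"
    unfolding AE_H
  proof
    fix h assume h: "h \<in> carrier G"
    show "AE x in X. t (x, h) - j (x, h) = 0"
    proof (rule eq_0_by_Linfty)
      show "(\<lambda>x. t (x, h) - j (x, h)) \<in> L2 X" by (intro L2_diff L2_slice t j h)
      fix F assume F: "F \<in> Linfty X"
      \<comment> \<open>Pairing the slice at \<open>h\<close> with \<open>F\<close> becomes a
        pairing with \<open>\<rho> vac\<close>; moving \<open>T\<close> to its adjoint
        \<open>S\<close> and commuting \<open>S\<close> past \<rho> leaves an integral of
        \<open>s\<close> at the inverse element.\<close>
      define \<rho> where "\<rho> = rop (\<lambda>x. F (a h x)) (inv h)"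
      have \<rho>: "\<rho> \<in> rops" using Linfty_act[OF F h] h by (auto simp: \<rho>_def rops_def)
      have \<rho>b: "\<rho> \<in> bounded_ops H" using \<rho> rops_bounded by blast
      note Fm = Linfty_L2[OF F]
      have "L2_inner X (\<lambda>x. t (x, h)) F = L2_inner H t (\<rho> vac)"
        unfolding \<rho>_def by (rule inner_rop_vac[OF F h t, symmetric])
      also have "\<dots> = L2_inner H vac (S (\<rho> vac))"
        unfolding t_def by (rule adjoint_opsD[OF adj vac_L2 bounded_ops_L2[OF \<rho>b vac_L2]])
      also have "\<dots> = L2_inner H vac (\<rho> s)"
        by (rule L2_inner_cong_AE, simp, use commutantD[OF S \<rho> vac_L2] s_def in simp)
           (intro L2_measurable vac_L2 bounded_ops_L2[OF Sb] bounded_ops_L2[OF \<rho>b] s)+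
      also have "\<dots> = cnj (L2_inner H (\<rho> s) vac)" by (rule L2_inner_commute)
      also have "L2_inner H (\<rho> s) vac = L2_inner X (\<lambda>x. \<rho> s (x, \<one>)) (\<lambda>_. 1)"
        unfolding vac_def by (rule inner_emb[OF L2_measurable[OF bounded_ops_L2[OF \<rho>b s]]]) auto
      also have "\<dots> = (LINT x|X. (\<lambda>x. F x * s (a (inv h) x, inv h)) (a h x))"
        unfolding L2_inner_def
        by (rule Bochner_Integration.integral_cong) (use h in \<open>auto simp: \<rho>_def rop_def act_one act_inv\<close>)
      also have "\<dots> = (LINT x|distr X X (a h). F x * s (a (inv h) x, inv h))"
      proof (rule integral_distr[symmetric, OF act_meas[OF h]])
        have "(\<lambda>x. s (a (inv h) x, inv h)) \<in> borel_measurable X"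
          using measurable_slice[OF L2_measurable[OF j'] h] by simp
        then show "(\<lambda>x. F x * s (a (inv h) x, inv h)) \<in> borel_measurable X"
          using L2_measurable[OF Fm] by measurable
      qed
      also have "\<dots> = (LINT x|X. F x * cnj (j (x, h)))" using act_distr[OF h] by (simp add: j_def)
      also have "cnj \<dots> = L2_inner X (\<lambda>x. j (x, h)) F"
        by (subst L2_inner_commute) (simp add: L2_inner_def)
      finally show "L2_inner X (\<lambda>x. t (x, h) - j (x, h)) F = 0"
        using L2_inner_diff_left[OF L2_slice[OF t h] L2_slice[OF j h] Fm] by simp
    qed
  qed
  then have "L2_norm H t = L2_norm H j"
    by (intro L2_norm_cong_AE L2_measurable t j) auto
  also have "\<dots> = L2_norm H (\<lambda>z. s ((\<lambda>(x, h). (a (inv h) x, inv h)) z))"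
    by (simp add: L2_norm_def j_def)
  also have "\<dots> = L2_norm H s" by (rule L2_norm_distr[OF inv_skew s])
  finally show ?thesis by (simp add: t_def s_def)
qed

lemma mult_op_commutes:
  assumes f: "f \<in> Linfty X"
  shows "mult_op f \<in> commutant H rops"
  by (rule commutantI[OF mult_op_bounded[OF f]]) (auto simp: rops_def rop_def mult_op_def intro!: AE_I2)

text \<open>The factor \<open>F (a (inv h) x)\<close> is unchanged when \<open>(x, h)\<close> moves
  to \<open>(a (inv k) x, inv k \<otimes> h)\<close>; this invariance dictates the twist in
  \<open>rop\<close>.\<close>

lemma group_op_commutes:
  assumes k: "k \<in> carrier G"
  shows "group_op G a k \<in> commutant H rops"
proof (rule commutantI[OF group_op_bounded[OF k]])
  fix S \<xi> assume "S \<in> rops"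
  then obtain F g where S: "S = rop F g" and g: "g \<in> carrier G" by (auto simp: rops_def)
  show "AE z in H. group_op G a k (S \<xi>) z = S (group_op G a k \<xi>) z"
  proof (rule AE_I2)
    fix z assume "z \<in> space H"
    then obtain x h where z: "z = (x, h)" "x \<in> space X" "h \<in> carrier G" by (auto simp: space_H)
    have "inv (inv k \<otimes> h) \<otimes> inv k = inv h" using z k by (simp add: inv_mult_group m_assoc)
    then have "a (inv (inv k \<otimes> h)) (a (inv k) x) = a (inv h) x"
      using z k by (subst act_mult) auto
    then show "group_op G a k (S \<xi>) z = S (group_op G a k \<xi>) z"
      using z k g by (simp add: S group_op_def rop_def m_assoc)
  qed
qed

lemma commutant_rops_vN: "von_neumann_algebra H (commutant H rops)"
  by (rule von_neumann_algebra_commutant[OF rops_bounded rops_adjoint])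

lemma crossed_product_subset: "crossed_product G X a \<subseteq> commutant H rops"
  unfolding crossed_product_def vn_generated_def
  using commutant_rops_vN mult_op_commutes group_op_commutes by (intro Inter_lower) auto

lemma in_bicommutant_of_vac:
  assumes "A \<subseteq> commutant H rops" "\<And>S. S \<in> A \<Longrightarrow> \<exists>S'\<in>A. adjoint_ops H S S'"
    and "T \<in> commutant H rops" "\<And>e. e > 0 \<Longrightarrow> \<exists>n\<in>A. L2_norm H (\<lambda>x. T vac x - n vac x) < e"
  shows "T \<in> commutant H (commutant H A)"
  by (rule in_bicommutant_of_approx[where Q=rops and v=vac])
     (fact rops_bounded rops_adjoint vac_L2 rops_vac_total vac_trace assms)+

end


section \<open>The projection onto the closure of \<open>N\<close>\<close>

text \<open>A relation and not a function: the nearest point of \<open>K\<close> is determined only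
  up to null sets, and explicit representatives are needed when sums and images of projections are
  compared.\<close>

definition is_proj :: "'x measure \<Rightarrow> ('x \<Rightarrow> complex) set \<Rightarrow> ('x \<Rightarrow> complex) \<Rightarrow> ('x \<Rightarrow> complex) \<Rightarrow> bool" where
  "is_proj M K z h \<longleftrightarrow> h \<in> K \<and> (\<forall>k\<in>K. L2_inner M (\<lambda>x. z x - h x) k = 0)"

lemma closed_subspace_L2: "closed_subspace M K \<Longrightarrow> k \<in> K \<Longrightarrow> k \<in> L2 M"
  by (auto simp: closed_subspace_def)

lemma closed_subspace_lin: "closed_subspace M K \<Longrightarrow> k \<in> K \<Longrightarrow> l \<in> K \<Longrightarrow> (\<lambda>x. k x + c * l x) \<in> K"
  by (auto simp: closed_subspace_def)

lemma is_proj_ex: "closed_subspace M K \<Longrightarrow> z \<in> L2 M \<Longrightarrow> \<exists>h. is_proj M K z h"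
  using L2_projection unfolding is_proj_def by blast

lemma is_proj_L2: "closed_subspace M K \<Longrightarrow> is_proj M K z h \<Longrightarrow> h \<in> L2 M"
  by (auto simp: is_proj_def intro: closed_subspace_L2)

lemma is_proj_lin:
  assumes K: "closed_subspace M K" and z: "z \<in> L2 M" "z' \<in> L2 M"
    and h: "is_proj M K z h" and h': "is_proj M K z' h'"
  shows "is_proj M K (\<lambda>x. z x + c * z' x) (\<lambda>x. h x + c * h' x)"
proof -
  note L = is_proj_L2[OF K h] is_proj_L2[OF K h']
  have "L2_inner M (\<lambda>x. z x + c * z' x - (h x + c * h' x)) k = 0" if k: "k \<in> K" for k
  proof -
    have "L2_inner M (\<lambda>x. (z x - h x) + c * (z' x - h' x)) k
       = L2_inner M (\<lambda>x. z x - h x) k + c * L2_inner M (\<lambda>x. z' x - h' x) k"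
      by (rule L2_inner_lin_left) (use z L closed_subspace_L2[OF K k] in auto)
    also have "\<dots> = 0" using h h' k by (simp add: is_proj_def)
    finally show ?thesis by (simp add: algebra_simps)
  qed
  then show ?thesis using h h' closed_subspace_lin[OF K] by (simp add: is_proj_def)
qed

lemma is_proj_zero:
  assumes "closed_subspace M K"
  shows "is_proj M K (\<lambda>x. 0) (\<lambda>x. 0)"
  using assms by (simp add: is_proj_def closed_subspace_def L2_inner_def)

lemma is_proj_sum:
  assumes K: "closed_subspace M K" and z: "\<And>i. i \<in> I \<Longrightarrow> z i \<in> L2 M"
    and h: "\<And>i. i \<in> I \<Longrightarrow> is_proj M K (z i) (h i)"
  shows "is_proj M K (\<lambda>x. \<Sum>i\<in>I. z i x) (\<lambda>x. \<Sum>i\<in>I. h i x)"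
  using z h
proof (induction I rule: infinite_finite_induct)
  case (insert i I)
  have "is_proj M K (\<lambda>x. z i x + 1 * (\<Sum>i\<in>I. z i x)) (\<lambda>x. h i x + 1 * (\<Sum>i\<in>I. h i x))"
    by (rule is_proj_lin[OF K]) (use insert in auto)
  then show ?case using insert by simp
qed (auto intro: is_proj_zero[OF K])

lemma is_proj_norm:
  assumes K: "closed_subspace M K" and z: "z \<in> L2 M" and h: "is_proj M K z h"
  shows "L2_norm M h \<le> L2_norm M z"
proof (cases "L2_norm M h = 0")
  case False
  note L = is_proj_L2[OF K h]
  have "L2_inner M (\<lambda>x. z x - h x) h = 0" using h by (simp add: is_proj_def)
  then have "L2_inner M z h = L2_inner M h h" using L2_inner_diff_left[OF z L L] by simp
  then have "(L2_norm M h)\<^sup>2 = cmod (L2_inner M z h)" unfolding L2_inner_self by (simp only: norm_of_real) simp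
  also have "\<dots> \<le> L2_norm M z * L2_norm M h" by (rule L2_Cauchy_Schwarz[OF z L])
  finally show ?thesis using False L2_norm_nonneg[of M h] by (simp add: power2_eq_square)
qed simp

lemma is_proj_norm_diff:
  assumes K: "closed_subspace M K" and z: "z \<in> L2 M" "z' \<in> L2 M"
    and h: "is_proj M K z h" and h': "is_proj M K z' h'"
  shows "L2_norm M (\<lambda>x. h x - h' x) \<le> L2_norm M (\<lambda>x. z x - z' x)"
  using is_proj_norm[OF K L2_diff[OF z]] is_proj_lin[OF K z h h', of "-1"] by simp

text \<open>The projection commutes with an operator as soon as the operator and its adjoint both
  preserve \<open>K\<close>: the adjoint keeps the remainder orthogonal to \<open>K\<close>.\<close>

lemma is_proj_op:
  assumes K: "closed_subspace M K" and W: "W \<in> bounded_ops M" "adjoint_ops M W W'"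
    and inv: "\<And>k. k \<in> K \<Longrightarrow> W k \<in> K" "\<And>k. k \<in> K \<Longrightarrow> W' k \<in> K"
    and z: "z \<in> L2 M" and h: "is_proj M K z h"
  shows "is_proj M K (W z) (W h)"
  unfolding is_proj_def
proof (intro conjI ballI)
  note L = is_proj_L2[OF K h]
  show "W h \<in> K" using h inv by (simp add: is_proj_def)
  fix k assume k: "k \<in> K"
  note kL = closed_subspace_L2[OF K k]
  have "L2_inner M (\<lambda>x. W z x - W h x) k = L2_inner M (W (\<lambda>x. z x - h x)) k"
    by (rule L2_inner_cong_AE, use bounded_ops_diff[OF W(1) z L] in auto)
       (use z L kL in \<open>auto intro!: L2_measurable bounded_ops_L2[OF W(1)]\<close>)
  also have "\<dots> = L2_inner M (\<lambda>x. z x - h x) (W' k)"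
    by (rule adjoint_opsD[OF W(2)]) (use z L kL in auto)
  also have "\<dots> = 0" using h inv(2)[OF k] by (simp add: is_proj_def)
  finally show "L2_inner M (\<lambda>x. W z x - W h x) k = 0" .
qed

text \<open>On almost every fibre some \<open>h i\<close> lies within \<open>e\<close> of
  \<open>u\<close>. Choosing the least such index cuts the base into measurable pieces, and
  integrating the conditional bound over the pieces gives the bound in \<open>L2 X\<close>.\<close>

lemma fibre_approx:
  assumes X: "prob_space X" and p: "p \<in> measurable X X0" and u: "u \<in> L2 X"
    and h: "\<And>i. i < n \<Longrightarrow> h i \<in> L2 X" and n: "n \<ge> (1::nat)" and e: "e > 0"
    and small: "AE x in X. (MIN i\<in>{..<n}. fibre_norm X X0 p (\<lambda>x. u x - h i x) x) < e"
  shows "\<exists>D. (\<forall>i<n. D i \<in> sets X0) \<and> L2_norm X (\<lambda>x. u x - (\<Sum>i<n. indicator (D i) (p x) * h i x)) \<le> e"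
proof -
  interpret prob_space X by fact
  define F where "F = vimage_algebra (space X) p X0"
  have psp: "p \<in> space X \<rightarrow> space X0" using p by (auto simp: measurable_def)
  have setsF: "sets F = {p -` A \<inter> space X | A. A \<in> sets X0}"
    unfolding F_def by (rule sets_vimage_algebra2[OF psp])
  have sub: "subalgebra X F"
    unfolding subalgebra_def using p by (auto simp: setsF measurable_sets) (auto simp: F_def)
  interpret F: finite_measure_subalgebra X F by unfold_locales (rule sub)
  define r where "r i = real_cond_exp X F (\<lambda>x. (cmod (u x - h i x))\<^sup>2)" for i
  define B where "B i = {x \<in> space F. sqrt (r i x) < e}" for i
  have B: "B i \<in> sets F" for i unfolding B_def r_def by measurable
  \<comment> \<open>Points whose first good index is \<open>i\<close>. These sets belong to the
    pulled back \<sigma>-algebra, hence are preimages of sets \<open>D i\<close> of the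
    base.\<close>
  define A where "A i = B i - (\<Union>j<i. B j)" for i
  have A: "A i \<in> sets F" for i unfolding A_def by (intro sets.Diff sets.finite_UN B finite_lessThan)
  have AX: "A i \<in> sets X" for i using A sub by (auto simp: subalgebra_def)
  have spF: "space F = space X" using sub by (simp add: subalgebra_def)
  have disj: "i = j" if "x \<in> A i" "x \<in> A j" for x i j
    using that by (cases i j rule: linorder_cases) (auto simp: A_def)
  obtain D where D: "\<And>i. D i \<in> sets X0" "\<And>i. A i = p -` D i \<inter> space X"
    using A unfolding setsF by (simp, metis)
  have ind: "indicator (D i) (p x) = (indicator (A i) x :: complex)" if "x \<in> space X" for i x
    using that by (auto simp: D(2) indicator_def)
  have int: "integrable X (\<lambda>x. (cmod (u x - h i x))\<^sup>2)" if "i < n" for i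
    by (rule L2_integrable[OF L2_diff[OF u h[OF that]]])
  have cover: "AE x in X. \<exists>i<n. x \<in> A i"
    using small
  proof (rule AE_mp, intro AE_I2 impI)
    fix x assume x: "x \<in> space X" and m: "(MIN i\<in>{..<n}. fibre_norm X X0 p (\<lambda>x. u x - h i x) x) < e"
    have "\<exists>i<n. fibre_norm X X0 p (\<lambda>x. u x - h i x) x < e"
      using m n by (subst (asm) Min_less_iff) (auto simp: lessThan_empty_iff)
    then have ex: "\<exists>i. i < n \<and> x \<in> B i" using x by (auto simp: B_def r_def F_def[symmetric] fibre_norm_def spF)
    define i where "i = (LEAST i. i < n \<and> x \<in> B i)"
    have "i < n \<and> x \<in> B i" unfolding i_def by (rule LeastI_ex[OF ex])
    moreover have "x \<notin> B j" if "j < i" for j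
      using not_less_Least[of j "\<lambda>i. i < n \<and> x \<in> B i"] that \<open>i < n \<and> x \<in> B i\<close> by (auto simp: i_def)
    ultimately show "\<exists>i<n. x \<in> A i" by (auto simp: A_def)
  qed
  have eq: "AE x in X. (cmod (u x - (\<Sum>i<n. indicator (D i) (p x) * h i x)))\<^sup>2
      = (\<Sum>i<n. indicator (A i) x *\<^sub>R (cmod (u x - h i x))\<^sup>2)"
    using cover
  proof (rule AE_mp, intro AE_I2 impI)
    fix x assume x: "x \<in> space X" and "\<exists>i<n. x \<in> A i"
    then obtain i where i: "i < n" "x \<in> A i" by auto
    have iff: "x \<in> A j \<longleftrightarrow> j = i" for j using disj[OF i(2)] i(2) by blast
    have oner: "indicator (A j) x = (if j = i then 1 else 0 :: real)" for j
      unfolding indicator_def iff by simp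
    have onec: "indicator (A j) x = (if j = i then 1 else 0 :: complex)" for j
      unfolding indicator_def iff by simp
    have "(\<Sum>j<n. indicator (D j) (p x) * h j x) = (\<Sum>j<n. if j = i then h j x else 0)"
      unfolding ind[OF x] onec by (rule sum.cong) auto
    also have "\<dots> = h i x" using i by simp
    finally have 1: "(\<Sum>j<n. indicator (D j) (p x) * h j x) = h i x" .
    have "(\<Sum>j<n. indicator (A j) x *\<^sub>R (cmod (u x - h j x))\<^sup>2) = (\<Sum>j<n. if j = i then (cmod (u x - h j x))\<^sup>2 else 0)"
      unfolding oner by (rule sum.cong) auto
    also have "\<dots> = (cmod (u x - h i x))\<^sup>2" using i by simp
    finally show "(cmod (u x - (\<Sum>i<n. indicator (D i) (p x) * h i x)))\<^sup>2
      = (\<Sum>i<n. indicator (A i) x *\<^sub>R (cmod (u x - h i x))\<^sup>2)" using 1 by simp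
  qed
  note [measurable] = L2_measurable[OF u] p
  have hm: "h i \<in> borel_measurable X" if "i < n" for i by (rule L2_measurable[OF h[OF that]])
  have intA: "integrable X (\<lambda>x. indicator (A i) x *\<^sub>R (cmod (u x - h i x))\<^sup>2)" if "i < n" for i
    using integrable_mult_indicator[OF AX int[OF that]] .
  have m1: "(\<lambda>x. indicator (D i) (p x) * h i x) \<in> borel_measurable X" if "i < n" for i
    using hm[OF that] D(1)[of i] by measurable
  have "(LINT x|X. (cmod (u x - (\<Sum>i<n. indicator (D i) (p x) * h i x)))\<^sup>2)
      = (LINT x|X. (\<Sum>i<n. indicator (A i) x *\<^sub>R (cmod (u x - h i x))\<^sup>2))"
  proof (rule integral_cong_AE[OF _ _ eq])
    have [measurable]: "(\<lambda>x. \<Sum>i<n. indicator (D i) (p x) * h i x) \<in> borel_measurable X"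
      by (rule borel_measurable_sum, rule m1, simp)
    show "(\<lambda>x. (cmod (u x - (\<Sum>i<n. indicator (D i) (p x) * h i x)))\<^sup>2) \<in> borel_measurable X"
      by measurable
    show "(\<lambda>x. \<Sum>i<n. indicator (A i) x *\<^sub>R (cmod (u x - h i x))\<^sup>2) \<in> borel_measurable X"
      by (rule borel_measurable_sum, rule borel_measurable_integrable, rule intA, simp)
  qed
  also have "\<dots> = (\<Sum>i<n. LINT x|X. indicator (A i) x *\<^sub>R (cmod (u x - h i x))\<^sup>2)"
    by (rule Bochner_Integration.integral_sum) (use intA in auto)
  \<comment> \<open>As \<open>A i\<close> is measurable for the pulled back \<sigma>-algebra, the
    integrand may be replaced by its conditional expectation, which is below \<open>e^2\<close> on
    \<open>A i\<close>.\<close>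
  also have "\<dots> = (\<Sum>i<n. LINT x|X. indicator (A i) x *\<^sub>R r i x)"
    using F.real_cond_exp_intA[OF int A] by (intro sum.cong) (auto simp: r_def set_lebesgue_integral_def)
  also have "\<dots> \<le> (\<Sum>i<n. LINT x|X. indicator (A i) x *\<^sub>R e\<^sup>2)"
  proof (rule sum_mono, rule integral_mono)
    fix i assume "i \<in> {..<n}"
    then have i: "i < n" by simp
    show "integrable X (\<lambda>x. indicator (A i) x *\<^sub>R r i x)"
      unfolding r_def by (rule integrable_mult_indicator[OF AX F.real_cond_exp_int(1)[OF int[OF i]]])
    show "integrable X (\<lambda>x. indicator (A i) x *\<^sub>R e\<^sup>2)"
      by (rule integrable_mult_indicator[OF AX]) simp
    fix x assume "x \<in> space X"
    have "r i x \<le> e\<^sup>2" if "x \<in> A i"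
    proof -
      have "sqrt (r i x) < sqrt (e\<^sup>2)" using that e by (simp add: A_def B_def)
      then show ?thesis by (simp only: real_sqrt_less_iff less_imp_le)
    qed
    then show "indicator (A i) x *\<^sub>R r i x \<le> indicator (A i) x *\<^sub>R e\<^sup>2" by (auto simp: indicator_def)
  qed
  also have "\<dots> = (\<Sum>i<n. measure X (A i)) * e\<^sup>2"
    using AX by (simp add: sum_distrib_right sets.Int_space_eq2)
  also have "(\<Sum>i<n. measure X (A i)) = measure X (\<Union>i<n. A i)"
    by (rule finite_measure_finite_Union[symmetric])
       (use AX disj in \<open>auto simp: disjoint_family_on_def\<close>)
  also have "measure X (\<Union>i<n. A i) * e\<^sup>2 \<le> 1 * e\<^sup>2" by (intro mult_right_mono prob_le_1) auto
  finally have "(L2_norm X (\<lambda>x. u x - (\<Sum>i<n. indicator (D i) (p x) * h i x)))\<^sup>2 \<le> e\<^sup>2"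
    by (simp add: L2_norm_sq)
  then have "L2_norm X (\<lambda>x. u x - (\<Sum>i<n. indicator (D i) (p x) * h i x)) \<le> e"
    using e by (auto intro: power2_le_imp_le)
  then show ?thesis using D(1) by blast
qed

section \<open>An intermediate algebra and the closure of its vectors\<close>

locale intermediate_algebra = crossed_action G X a
  for G :: "('g, 'm) monoid_scheme" (structure) and X :: "'x measure" and a +
  fixes X0 :: "'y measure" and b :: "'g \<Rightarrow> 'y \<Rightarrow> 'y" and p :: "'x \<Rightarrow> 'y"
    and N :: "(('x \<times> 'g \<Rightarrow> complex) \<Rightarrow> ('x \<times> 'g \<Rightarrow> complex)) set"
  assumes icc: "icc G"
    and compact: "compact_extension G X a X0 b p"
    and N_vN: "von_neumann_algebra (crossed_space G X) N"
    and N_lower: "crossed_product_via G X a X0 p \<subseteq> N"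
    and N_upper: "N \<subseteq> crossed_product G X a"
begin

lemma factor: "factor_map G X a X0 b p"
  using compact by (simp add: compact_extension_def)

lemma p_meas: "p \<in> measurable X X0"
  using factor by (simp add: factor_map_def)

lemma p_distr: "distr X X0 p = X0"
  using factor by (simp add: factor_map_def)

lemma N_bicommutant: "commutant H (commutant H N) = N"
  using N_vN by (simp add: von_neumann_algebra_def)

lemma N_bounded: "n \<in> N \<Longrightarrow> n \<in> bounded_ops H"
  using N_vN by (auto simp: von_neumann_algebra_def)

lemma N_adjoint: "n \<in> N \<Longrightarrow> \<exists>m\<in>N. adjoint_ops H n m"
  using N_vN by (auto simp: von_neumann_algebra_def)

lemma N_rops: "N \<subseteq> commutant H rops"
  using N_upper crossed_product_subset by blast

lemma N_comp: "n \<in> N \<Longrightarrow> m \<in> N \<Longrightarrow> (\<lambda>\<xi>. n (m \<xi>)) \<in> N"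
  using commutant_comp[of "commutant H N" H n m] commutant_subset_bounded[of H N]
  by (simp add: N_bicommutant)

lemma N_lincomb: "n \<in> N \<Longrightarrow> m \<in> N \<Longrightarrow> (\<lambda>\<xi> x. n \<xi> x + c * m \<xi> x) \<in> N"
  using commutant_lincomb[of "commutant H N" H n m c] commutant_subset_bounded[of H N]
  by (simp add: N_bicommutant)

lemma N_zero: "(\<lambda>\<xi> x. 0) \<in> N"
  using commutant_zero[of "commutant H N" H] commutant_subset_bounded[of H N]
  by (simp add: N_bicommutant)

lemma N_cong:
  assumes "n \<in> N" "\<And>f. f \<in> L2 H \<Longrightarrow> n' f \<in> L2 H" "\<And>f. f \<in> L2 H \<Longrightarrow> AE z in H. n' f z = n f z"
  shows "n' \<in> N"
  using commutant_cong[of "commutant H N" H n n'] commutant_subset_bounded[of H N] assms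
  by (simp add: N_bicommutant)

lemma group_in_N: "g \<in> carrier G \<Longrightarrow> group_op G a g \<in> N"
  using N_lower unfolding crossed_product_via_def vn_generated_def by blast

lemma mult_in_N: "f \<in> Linfty X0 \<Longrightarrow> mult_op (\<lambda>x. f (p x)) \<in> N"
  using N_lower unfolding crossed_product_via_def vn_generated_def by blast

definition K :: "('x \<times> 'g \<Rightarrow> complex) set" where
  "K = {z \<in> L2 H. \<forall>e>0. \<exists>n\<in>N. L2_norm H (\<lambda>x. z x - n vac x) < e}"

lemma N_vac_L2: "n \<in> N \<Longrightarrow> n vac \<in> L2 H"
  by (rule bounded_ops_L2[OF N_bounded vac_L2])

lemma N_vac: "n \<in> N \<Longrightarrow> n vac \<in> K"
  using N_vac_L2 unfolding K_def by (auto intro!: bexI[of _ n])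

lemma K_closed: "closed_subspace H K"
  unfolding closed_subspace_def
proof (intro conjI ballI allI impI)
  show "(\<lambda>x. 0) \<in> K" using N_vac[OF N_zero] by simp
  fix f g c assume f: "f \<in> K" and g: "g \<in> K"
  have L: "f \<in> L2 H" "g \<in> L2 H" using f g by (auto simp: K_def)
  have "\<exists>n\<in>N. L2_norm H (\<lambda>x. f x + c * g x - n vac x) < e" if e: "e > 0" for e
  proof -
    obtain n where n: "n \<in> N" "L2_norm H (\<lambda>x. f x - n vac x) < e / 2"
      using f e unfolding K_def by (auto dest!: spec[of _ "e/2"])
    \<comment> \<open>The summand 1 keeps the divisor positive when \<open>c\<close> is 0 and
      absorbs the extra \<open>e' / 2\<close> that makes the estimate strict.\<close>
    define s where "s = cmod c + 1"
    have s: "s > 0" using norm_ge_zero[of c] unfolding s_def by linarith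
    define e' where "e' = e / (2 * s)"
    have e': "e' > 0" unfolding e'_def using e s by simp
    obtain m where m: "m \<in> N" "L2_norm H (\<lambda>x. g x - m vac x) < e'"
      using g e' unfolding K_def by blast
    have "L2_norm H (\<lambda>x. (f x - n vac x) + c * (g x - m vac x))
       \<le> L2_norm H (\<lambda>x. f x - n vac x) + L2_norm H (\<lambda>x. c * (g x - m vac x))"
      using L N_vac_L2 n m by (intro L2_norm_triangle L2_scale L2_diff) auto
    also have "\<dots> < e / 2 + cmod c * e' + e' / 2"
    proof -
      have "cmod c * L2_norm H (\<lambda>x. g x - m vac x) \<le> cmod c * e'"
        using m by (intro mult_left_mono) auto
      then show ?thesis unfolding L2_norm_scale using n(2) e' by linarith
    qed
    also have "\<dots> \<le> e / 2 + s * e'" using e' by (simp add: s_def algebra_simps)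
    also have "\<dots> = e" using s by (simp add: e'_def)
    finally have "L2_norm H (\<lambda>x. f x + c * g x - (n vac x + c * m vac x)) < e"
      by (simp add: algebra_simps)
    then show ?thesis using N_lincomb[OF n(1) m(1), of c] by (intro bexI[of _ "\<lambda>\<xi> x. n \<xi> x + c * m \<xi> x"]) auto
  qed
  then show "(\<lambda>x. f x + c * g x) \<in> K" using L by (auto simp: K_def)
next
  fix f assume f: "f \<in> L2 H" and *: "\<forall>e>0. \<exists>k\<in>K. L2_norm H (\<lambda>x. f x - k x) < e"
  have "\<exists>n\<in>N. L2_norm H (\<lambda>x. f x - n vac x) < e" if e: "e > 0" for e
  proof -
    obtain k where k: "k \<in> K" "L2_norm H (\<lambda>x. f x - k x) < e / 2" using * e by (meson half_gt_zero)
    obtain n where n: "n \<in> N" "L2_norm H (\<lambda>x. k x - n vac x) < e / 2"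
      using k e unfolding K_def by (auto dest!: spec[of _ "e/2"])
    have kL: "k \<in> L2 H" using k by (simp add: K_def)
    have "L2_norm H (\<lambda>x. f x - n vac x) < e"
      using L2_norm_triangle_diff[OF f kL N_vac_L2[OF n(1)]] k n by linarith
    then show ?thesis using n by blast
  qed
  then show "f \<in> K" using f by (auto simp: K_def)
qed (auto simp: K_def)

text \<open>Boundedness carries invariance from the vectors \<open>n vac\<close> to their closure;
  the hypothesis is stated up to null sets because commutation with \<open>rops\<close> holds only
  so.\<close>

lemma K_invariant:
  assumes W: "W \<in> bounded_ops H" and inv: "\<And>n. n \<in> N \<Longrightarrow> \<exists>m\<in>N. AE z in H. W (n vac) z = m vac z"
    and k: "k \<in> K"
  shows "W k \<in> K"
proof -
  obtain C where C: "0 \<le> C" "\<And>f. f \<in> L2 H \<Longrightarrow> L2_norm H (W f) \<le> C * L2_norm H f"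
    using bounded_ops_bound[OF W] by metis
  have kL: "k \<in> L2 H" using k by (simp add: K_def)
  have "\<exists>m\<in>N. L2_norm H (\<lambda>x. W k x - m vac x) < e" if e: "e > 0" for e
  proof -
    have "e / (C + 1) > 0" using e C by simp
    then obtain n where n: "n \<in> N" "L2_norm H (\<lambda>x. k x - n vac x) < e / (C + 1)"
      using k unfolding K_def by blast
    obtain m where m: "m \<in> N" "AE z in H. W (n vac) z = m vac z" using inv[OF n(1)] by blast
    note nL = N_vac_L2[OF n(1)] N_vac_L2[OF m(1)]
    have "L2_norm H (\<lambda>x. W k x - m vac x) = L2_norm H (\<lambda>x. W k x - W (n vac) x)"
      by (rule L2_norm_cong_AE, use m in auto)
         (use kL nL in \<open>auto intro!: L2_measurable bounded_ops_L2[OF W]\<close>)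
    also have "\<dots> = L2_norm H (W (\<lambda>x. k x - n vac x))" by (rule bounded_ops_norm_diff[OF W kL nL(1)])
    also have "\<dots> \<le> C * L2_norm H (\<lambda>x. k x - n vac x)" using kL nL by (intro C) auto
    also have "\<dots> \<le> C * (e / (C + 1))" using n C by (intro mult_left_mono) auto
    also have "\<dots> < e" using e C by (simp add: field_simps)
    finally show ?thesis using m by blast
  qed
  then show ?thesis using bounded_ops_L2[OF W kL] by (auto simp: K_def)
qed

lemma K_N_invariant:
  assumes n: "n \<in> N" and k: "k \<in> K"
  shows "n k \<in> K"
proof (rule K_invariant[OF N_bounded[OF n] _ k])
  fix m assume "m \<in> N"
  with n have "(\<lambda>\<xi>. n (m \<xi>)) \<in> N" by (rule N_comp)
  then show "\<exists>l\<in>N. AE z in H. n (m vac) z = l vac z" by (rule bexI[rotated]) simp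
qed

text \<open>Both operators carry the mass of \<open>vac\<close> to \<open>inv g\<close>, and the
  constant function 1 does not notice the action. A right translate of \<open>n vac\<close> is
  therefore the vector of a product of \<open>n\<close> with a group element, which keeps
  \<open>K\<close> invariant from the right.\<close>

lemma rop_1_vac:
  assumes "g \<in> carrier G" "z \<in> space H"
  shows "rop (\<lambda>_. 1) g vac z = group_op G a (inv g) vac z"
proof -
  obtain x k where z: "z = (x, k)" "x \<in> space X" "k \<in> carrier G" using assms by (auto simp: space_H)
  have "k \<otimes> g = \<one> \<longleftrightarrow> g \<otimes> k = \<one>" using z assms by (metis inv_comm)
  then show ?thesis using z assms by (auto simp: rop_def group_op_def vac_def emb_def)
qed

lemma rop_1_rops: "g \<in> carrier G \<Longrightarrow> rop (\<lambda>_. 1) g \<in> rops"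
  using Linfty_const[of 1 X] by (auto simp: rops_def)

lemma rop_1_N_vac:
  assumes g: "g \<in> carrier G" and n: "n \<in> N"
  shows "AE z in H. rop (\<lambda>_. 1) g (n vac) z = n (group_op G a (inv g) vac) z"
proof -
  have r: "rop (\<lambda>_. 1) g \<in> bounded_ops H" using rops_bounded rop_1_rops[OF g] by blast
  have gi: "group_op G a (inv g) \<in> bounded_ops H" using g by (intro group_op_bounded) auto
  have "AE z in H. n (rop (\<lambda>_. 1) g vac) z = rop (\<lambda>_. 1) g (n vac) z"
    using N_rops n by (intro commutantD[OF _ rop_1_rops[OF g] vac_L2]) auto
  moreover have "AE z in H. n (rop (\<lambda>_. 1) g vac) z = n (group_op G a (inv g) vac) z"
    by (rule bounded_ops_cong[OF N_bounded[OF n] bounded_ops_L2[OF r vac_L2] bounded_ops_L2[OF gi vac_L2]])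
       (use rop_1_vac[OF g] in \<open>auto intro!: AE_I2\<close>)
  ultimately show ?thesis by eventually_elim simp
qed

lemma K_rop_invariant:
  assumes g: "g \<in> carrier G" and k: "k \<in> K"
  shows "rop (\<lambda>_. 1) g k \<in> K"
proof (rule K_invariant[OF _ _ k])
  show "rop (\<lambda>_. 1) g \<in> bounded_ops H" using rops_bounded rop_1_rops[OF g] by blast
  fix n assume n: "n \<in> N"
  show "\<exists>m\<in>N. AE z in H. rop (\<lambda>_. 1) g (n vac) z = m vac z"
    using rop_1_N_vac[OF g n] N_comp[OF n group_in_N[OF inv_closed[OF g]]] by (rule bexI)
qed

text \<open>A left and a right translation together conjugate the vector by \<open>g\<close>; each
  preserves \<open>K\<close> along with its adjoint, so the projection commutes with
  conjugation.\<close>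

lemma is_proj_conj:
  assumes g: "g \<in> carrier G" and z: "z \<in> L2 H" and h: "is_proj H K z \<zeta>"
  shows "is_proj H K (group_op G a g (rop (\<lambda>_. 1) g z)) (group_op G a g (rop (\<lambda>_. 1) g \<zeta>))"
proof -
  have r: "rop (\<lambda>_. 1) g \<in> bounded_ops H" using rops_bounded rop_1_rops[OF g] by blast
  have ra: "adjoint_ops H (rop (\<lambda>_. 1) g) (rop (\<lambda>_. 1) (inv g))"
    using rop_adjoint[OF Linfty_const[of 1 X] g] by simp
  show ?thesis
  proof (rule is_proj_op[OF K_closed group_op_bounded[OF g] group_op_adjoint[OF g]])
    show "is_proj H K (rop (\<lambda>_. 1) g z) (rop (\<lambda>_. 1) g \<zeta>)"
      by (rule is_proj_op[OF K_closed r ra _ _ z h]) (use g K_rop_invariant in auto)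
    show "rop (\<lambda>_. 1) g z \<in> L2 H" by (rule bounded_ops_L2[OF r z])
    show "group_op G a g k \<in> K" "group_op G a (inv g) k \<in> K" if "k \<in> K" for k
      using K_N_invariant[OF group_in_N that] g by auto
  qed
qed

lemma conj_slice_norm:
  assumes g: "g \<in> carrier G" and t: "t \<in> carrier G" and z: "z \<in> L2 H"
  shows "L2_norm X (\<lambda>x. group_op G a g (rop (\<lambda>_. 1) g z) (x, g \<otimes> t \<otimes> inv g)) = L2_norm X (\<lambda>x. z (x, t))"
proof -
  have "inv g \<otimes> (g \<otimes> t \<otimes> inv g) \<otimes> g = t"
    using g t by (simp add: m_assoc) (simp add: m_assoc[symmetric])
  then have "(\<lambda>x. group_op G a g (rop (\<lambda>_. 1) g z) (x, g \<otimes> t \<otimes> inv g)) = (\<lambda>x. z (a (inv g) x, t))"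
    by (simp add: group_op_def rop_def)
  then show ?thesis
    using L2_norm_distr[OF act_meas act_distr L2_slice[OF z t]] g by simp
qed

lemma conj_emb:
  assumes g: "g \<in> carrier G" and z: "z \<in> space H"
  shows "group_op G a g (rop (\<lambda>_. 1) g (emb f \<one>)) z = emb (koopman G a g f) \<one> z"
proof -
  obtain x k where z: "z = (x, k)" "x \<in> space X" "k \<in> carrier G" using assms by (auto simp: space_H)
  have "inv g \<otimes> k \<otimes> g = \<one> \<longleftrightarrow> k = \<one>"
  proof
    assume "inv g \<otimes> k \<otimes> g = \<one>"
    then have "inv g \<otimes> k = inv g" using g z by (intro inv_equality[symmetric]) auto
    then show "k = \<one>" using g z r_cancel_one[of k "inv g"] by auto
  qed (use g in simp)
  then show ?thesis using z g by (simp add: group_op_def rop_def emb_def koopman_def)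
qed

lemma koopman_L2: "g \<in> carrier G \<Longrightarrow> f \<in> L2 X \<Longrightarrow> koopman G a g f \<in> L2 X"
  unfolding koopman_def by (rule L2_distr[OF act_meas act_distr]) auto

lemma indicator_p:
  assumes "D \<in> sets X0"
  shows "mult_op (\<lambda>x. indicator D (p x)) \<in> N" "(\<lambda>x. indicator D (p x) :: complex) \<in> Linfty X"
proof -
  have "(indicator D :: _ \<Rightarrow> complex) \<in> Linfty X0"
    using assms by (auto simp: Linfty_def indicator_def intro!: exI[of _ 1])
  then show "mult_op (\<lambda>x. indicator D (p x)) \<in> N" by (rule mult_in_N)
  have "(\<lambda>x. indicator D (p x) :: complex) \<in> borel_measurable X" using assms p_meas by measurable
  then show "(\<lambda>x. indicator D (p x) :: complex) \<in> Linfty X"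
    by (auto simp: Linfty_def indicator_def intro!: exI[of _ 1])
qed

lemma conj_class_escapes:
  assumes t: "t \<in> carrier G" "t \<noteq> \<one>" and "finite E"
  shows "\<exists>g\<in>carrier G. g \<otimes> t \<otimes> inv g \<notin> E"
proof (rule ccontr)
  assume "\<not> ?thesis"
  then have "{g \<otimes> t \<otimes> inv g | g. g \<in> carrier G} \<subseteq> E" by auto
  then show False using icc t finite_subset[OF _ \<open>finite E\<close>] by (auto simp: icc_def)
qed

text \<open>Conjugation moves the coefficient at \<open>t \<noteq> 1\<close> along an infinite conjugacy class, while almost
  periodicity keeps the whole orbit close to finitely many vectors, which have only finitely many
  coefficients that are not small.\<close>

lemma proj_almost_periodic:
  assumes f: "almost_periodic G X a X0 p f" and \<zeta>: "is_proj H K (emb f \<one>) \<zeta>"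
    and t: "t \<in> carrier G" "t \<noteq> \<one>" and e: "e > 0"
  shows "L2_norm X (\<lambda>x. \<zeta> (x, t)) \<le> 2 * e"
proof -
  have fL: "f \<in> L2 X" using f by (simp add: almost_periodic_def)
  obtain n :: nat and h where n: "n \<ge> 1" and h: "\<And>i. i < n \<Longrightarrow> h i \<in> L2 X"
    and ap: "\<And>g. g \<in> carrier G \<Longrightarrow> AE x in X. (MIN i\<in>{..<n}. fibre_norm X X0 p (\<lambda>x'. koopman G a g f x' - h i x') x) < e"
    using f e unfolding almost_periodic_def by blast
  have hE: "emb (h i) \<one> \<in> L2 H" if "i < n" for i using h[OF that] by (intro emb_L2) auto
  have "\<forall>i. \<exists>\<eta>. i < n \<longrightarrow> is_proj H K (emb (h i) \<one>) \<eta>"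
    using is_proj_ex[OF K_closed hE] by blast
  then obtain \<eta> where \<eta>: "\<And>i. i < n \<Longrightarrow> is_proj H K (emb (h i) \<one>) (\<eta> i)" by metis
  have \<eta>L: "\<eta> i \<in> L2 H" if "i < n" for i by (rule is_proj_L2[OF K_closed \<eta>[OF that]])
  have \<zeta>L: "\<zeta> \<in> L2 H" by (rule is_proj_L2[OF K_closed \<zeta>])
  \<comment> \<open>The threshold \<open>e / n\<close> is shared by the \<open>n\<close> projected
    vectors, so that on a slice outside \<open>E\<close> their sum has norm at most
    \<open>e\<close>.\<close>
  define E where "E = (\<Union>i<n. {k \<in> carrier G. L2_norm X (\<lambda>x. \<eta> i (x, k)) \<ge> e / n})"
  have "finite E" unfolding E_def using n e \<eta>L by (intro finite_UN_I finite_large_slices) auto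
  then obtain g where g: "g \<in> carrier G" and gE: "g \<otimes> t \<otimes> inv g \<notin> E"
    using conj_class_escapes[OF t] by blast
  define k where "k = g \<otimes> t \<otimes> inv g"
  have k: "k \<in> carrier G" using g t by (simp add: k_def)
  define u where "u = koopman G a g f"
  have u: "u \<in> L2 X" unfolding u_def by (rule koopman_L2[OF g fL])
  have apu: "AE x in X. (MIN i\<in>{..<n}. fibre_norm X X0 p (\<lambda>x'. u x' - h i x') x) < e"
    using ap[OF g] unfolding u_def .
  have "\<exists>D. (\<forall>i<n. D i \<in> sets X0) \<and>
      L2_norm X (\<lambda>x. u x - (\<Sum>i<n. indicator (D i) (p x) * h i x)) \<le> e"
    by (rule fibre_approx[OF X.prob_space_axioms p_meas u _ n e apu]) (rule h)
  then obtain D where DD: "(\<forall>i<n. D i \<in> sets X0) \<and>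
      L2_norm X (\<lambda>x. u x - (\<Sum>i<n. indicator (D i) (p x) * h i x)) \<le> e" ..
  have D: "D i \<in> sets X0" if "i < n" for i using DD that by simp
  have close: "L2_norm X (\<lambda>x. u x - (\<Sum>i<n. indicator (D i) (p x) * h i x)) \<le> e" using DD by simp
  \<comment> \<open>Multiplication by these indicators belongs to \<open>N\<close> and is
    self-adjoint, so it commutes with the projection. The glued approximant is thus projected term
    by term onto multiples of the vectors \<open>\<eta> i\<close>, which do not depend on
    \<open>g\<close>.\<close>
  define w where "w i = (\<lambda>x. indicator (D i) (p x) :: complex)" for i
  have wN: "mult_op (w i) \<in> N" and w: "w i \<in> Linfty X" if "i < n" for i
    unfolding w_def by (rule indicator_p[OF D[OF that]])+
  have cw: "(\<lambda>x. cnj (w i x)) = w i" for i by (auto simp: w_def indicator_def fun_eq_iff)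
  have wE: "mult_op (w i) (emb (h i) \<one>) \<in> L2 H" if "i < n" for i
    by (rule mult_op_L2[OF w[OF that] hE[OF that]])
  have w\<eta>: "mult_op (w i) (\<eta> i) \<in> L2 H" if "i < n" for i
    by (rule mult_op_L2[OF w[OF that] \<eta>L[OF that]])
  define z where "z = group_op G a g (rop (\<lambda>_. 1) g (emb f \<one>))"
  define \<zeta>' where "\<zeta>' = group_op G a g (rop (\<lambda>_. 1) g \<zeta>)"
  have r: "rop (\<lambda>_. 1) g \<in> bounded_ops H" using rops_bounded rop_1_rops[OF g] by blast
  have zL: "z \<in> L2 H" unfolding z_def
    by (intro bounded_ops_L2[OF group_op_bounded[OF g]] bounded_ops_L2[OF r] emb_L2 fL) simp
  have \<zeta>'L: "\<zeta>' \<in> L2 H" unfolding \<zeta>'_def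
    by (intro bounded_ops_L2[OF group_op_bounded[OF g]] bounded_ops_L2[OF r] \<zeta>L)
  have p1: "is_proj H K z \<zeta>'" unfolding z_def \<zeta>'_def
    by (rule is_proj_conj[OF g emb_L2[OF fL] \<zeta>]) simp
  have p2: "is_proj H K (\<lambda>x. \<Sum>i<n. mult_op (w i) (emb (h i) \<one>) x) (\<lambda>x. \<Sum>i<n. mult_op (w i) (\<eta> i) x)"
  proof (rule is_proj_sum[OF K_closed])
    fix i assume "i \<in> {..<n}"
    then have i: "i < n" by simp
    show "mult_op (w i) (emb (h i) \<one>) \<in> L2 H" by (rule wE[OF i])
    show "is_proj H K (mult_op (w i) (emb (h i) \<one>)) (mult_op (w i) (\<eta> i))"
      by (rule is_proj_op[OF K_closed mult_op_bounded[OF w[OF i]] mult_op_adjoint _ _ hE[OF i] \<eta>[OF i]])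
         (use K_N_invariant[OF wN[OF i]] cw in auto)
  qed
  have sL: "(\<lambda>x. \<Sum>i<n. mult_op (w i) (\<eta> i) x) \<in> L2 H" using w\<eta> by (intro L2_sum) auto
  have "L2_norm H (\<lambda>x. \<zeta>' x - (\<Sum>i<n. mult_op (w i) (\<eta> i) x))
      \<le> L2_norm H (\<lambda>x. z x - (\<Sum>i<n. mult_op (w i) (emb (h i) \<one>) x))"
    by (rule is_proj_norm_diff[OF K_closed zL _ p1 p2]) (use wE in \<open>auto intro!: L2_sum\<close>)
  also have "\<dots> = L2_norm H (emb (\<lambda>x. u x - (\<Sum>i<n. indicator (D i) (p x) * h i x)) \<one>)"
  proof -
    have "z x - (\<Sum>i<n. mult_op (w i) (emb (h i) \<one>) x) = emb (\<lambda>x. u x - (\<Sum>i<n. indicator (D i) (p x) * h i x)) \<one> x"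
      if "x \<in> space H" for x
      unfolding z_def conj_emb[OF g that]
      by (cases x) (simp add: emb_def mult_op_def w_def u_def)
    then show ?thesis unfolding L2_norm_def
      by (intro arg_cong[where f=sqrt] Bochner_Integration.integral_cong) auto
  qed
  also have "\<dots> = L2_norm X (\<lambda>x. u x - (\<Sum>i<n. indicator (D i) (p x) * h i x))"
  proof (rule emb_norm)
    have "(\<lambda>x. w i x * h i x) \<in> L2 X" if "i < n" for i by (rule Linfty_mult_L2[OF w[OF that] h[OF that]])
    then show "(\<lambda>x. u x - (\<Sum>i<n. indicator (D i) (p x) * h i x)) \<in> borel_measurable X"
      unfolding w_def by (intro L2_measurable L2_diff u L2_sum) auto
  qed simp
  also note close
  finally have d: "L2_norm H (\<lambda>x. \<zeta>' x - (\<Sum>i<n. mult_op (w i) (\<eta> i) x)) \<le> e" .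
  \<comment> \<open>The slice of \<open>\<zeta>'\<close> at \<open>k\<close> is the moved slice of
    \<zeta> at \<open>t\<close>. It is within \<open>e\<close> of a sum that is itself at most
    \<open>e\<close> there, hence the bound \<open>2 * e\<close>.\<close>
  have dk: "L2_norm X (\<lambda>x. \<zeta>' (x, k) - (\<Sum>i<n. mult_op (w i) (\<eta> i) (x, k))) \<le> e"
    using L2_norm_slice[OF L2_diff[OF \<zeta>'L sL] k] d by simp
  have wk: "(\<lambda>x. mult_op (w i) (\<eta> i) (x, k)) \<in> L2 X" if "i < n" for i
    by (rule L2_slice[OF w\<eta>[OF that] k])
  have "L2_norm X (\<lambda>x. \<Sum>i<n. mult_op (w i) (\<eta> i) (x, k)) \<le> (\<Sum>i<n. L2_norm X (\<lambda>x. mult_op (w i) (\<eta> i) (x, k)))"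
    using wk by (intro L2_norm_sum) auto
  also have "\<dots> \<le> (\<Sum>i<n. e / n)"
  proof (rule sum_mono)
    fix i assume "i \<in> {..<n}"
    then have i: "i < n" by simp
    have "L2_norm X (\<lambda>x. mult_op (w i) (\<eta> i) (x, k)) \<le> 1 * L2_norm X (\<lambda>x. \<eta> i (x, k))"
      by (rule L2_norm_mono[OF wk[OF i] L2_slice[OF \<eta>L[OF i] k]])
         (auto simp: mult_op_def w_def indicator_def)
    also have "\<dots> \<le> e / n" using gE i k unfolding E_def k_def by force
    finally show "L2_norm X (\<lambda>x. mult_op (w i) (\<eta> i) (x, k)) \<le> e / n" .
  qed
  also have "\<dots> = e" using n by simp
  finally have s: "L2_norm X (\<lambda>x. \<Sum>i<n. mult_op (w i) (\<eta> i) (x, k)) \<le> e" .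
  have "L2_norm X (\<lambda>x. \<zeta>' (x, k)) \<le> 2 * e"
    using L2_norm_le_diff[OF L2_slice[OF \<zeta>'L k] L2_slice[OF sL k]] dk s by simp
  then show ?thesis
    using conj_slice_norm[OF g t(1) \<zeta>L] by (simp add: \<zeta>'_def k_def)
qed

lemma proj_slice_zero:
  assumes f: "f \<in> L2 X" and \<zeta>: "is_proj H K (emb f \<one>) \<zeta>" and t: "t \<in> carrier G" "t \<noteq> \<one>"
  shows "AE x in X. \<zeta> (x, t) = 0"
proof -
  have \<zeta>L: "\<zeta> \<in> L2 H" by (rule is_proj_L2[OF K_closed \<zeta>])
  have "AE x in X. \<zeta> (x, t) = (\<lambda>x. 0) x"
  proof (rule L2_diff_norm_0[OF L2_slice[OF \<zeta>L t(1)] L2_zero])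
    fix e :: real assume "e > 0"
    \<comment> \<open>One third pays for replacing \<open>f\<close> by an almost periodic
      \<open>h\<close>, the other two are the bound \<open>2 * (e / 3)\<close> for
      \<open>h\<close>.\<close>
    then have e: "e / 3 > 0" by simp
    obtain h where h: "almost_periodic G X a X0 p h" and d: "L2_norm X (\<lambda>x. f x - h x) < e / 3"
      using compact f e unfolding compact_extension_def by blast
    have hL: "h \<in> L2 X" using h by (simp add: almost_periodic_def)
    obtain \<eta> where \<eta>: "is_proj H K (emb h \<one>) \<eta>" using is_proj_ex[OF K_closed emb_L2[OF hL]] by auto
    have \<eta>L: "\<eta> \<in> L2 H" by (rule is_proj_L2[OF K_closed \<eta>])
    have "L2_norm X (\<lambda>x. \<zeta> (x, t) - \<eta> (x, t)) \<le> L2_norm H (\<lambda>x. \<zeta> x - \<eta> x)"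
      using L2_norm_slice[OF L2_diff[OF \<zeta>L \<eta>L] t(1)] .
    also have "\<dots> \<le> L2_norm H (\<lambda>x. emb f \<one> x - emb h \<one> x)"
      by (rule is_proj_norm_diff[OF K_closed _ _ \<zeta> \<eta>]) (use f hL in \<open>auto intro!: emb_L2\<close>)
    also have "(\<lambda>x. emb f \<one> x - emb h \<one> x) = emb (\<lambda>x. f x - h x) \<one>" by (auto simp: emb_def)
    also have "L2_norm H \<dots> = L2_norm X (\<lambda>x. f x - h x)"
      by (rule emb_norm[OF L2_measurable[OF L2_diff[OF f hL]]]) simp
    finally have "L2_norm X (\<lambda>x. \<zeta> (x, t) - \<eta> (x, t)) \<le> e / 3" using d by simp
    then show "L2_norm X (\<lambda>x. \<zeta> (x, t) - 0) \<le> e"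
      using L2_norm_le_diff[OF L2_slice[OF \<zeta>L t(1)] L2_slice[OF \<eta>L t(1)]]
        proj_almost_periodic[OF h \<eta> t e] by simp
  qed
  then show ?thesis by simp
qed

text \<open>Let \<open>d = w - \<zeta>\<close>, where \<open>w\<close> is the identity slice of
  \<open>z\<close> and \<zeta> its projection. As \<open>d\<close> lives on the identity slice, it
  has the same inner product with \<open>w\<close> as with \<open>z\<close>, which is 0 since
  \<open>d\<close> is orthogonal to \<open>K\<close>. It is orthogonal to \<zeta> too, so
  \<open>d = 0\<close> and \<open>w\<close> agrees with a vector of \<open>K\<close>.\<close>

lemma K_slice:
  assumes z: "z \<in> K"
  shows "emb (\<lambda>x. z (x, \<one>)) \<one> \<in> K"
proof -
  have zL: "z \<in> L2 H" using z by (simp add: K_def)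
  define f where "f = (\<lambda>x. z (x, \<one>))"
  have f: "f \<in> L2 X" unfolding f_def by (rule L2_slice[OF zL]) simp
  define w where "w = emb f \<one>"
  have w: "w \<in> L2 H" unfolding w_def by (rule emb_L2[OF f]) simp
  obtain \<zeta> where \<zeta>: "is_proj H K w \<zeta>" using is_proj_ex[OF K_closed w] by auto
  have \<zeta>L: "\<zeta> \<in> L2 H" by (rule is_proj_L2[OF K_closed \<zeta>])
  define d where "d = (\<lambda>x. w x - \<zeta> x)"
  have d: "d \<in> L2 H" unfolding d_def using w \<zeta>L by auto
  have d1: "(\<lambda>x. d (x, \<one>)) \<in> L2 X" by (rule L2_slice[OF d]) simp
  have dE: "AE x in H. d x = emb (\<lambda>x. d (x, \<one>)) \<one> x"
    unfolding AE_H
  proof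
    fix t assume t: "t \<in> carrier G"
    show "AE x in X. d (x, t) = emb (\<lambda>x. d (x, \<one>)) \<one> (x, t)"
    proof (cases "t = \<one>")
      case False
      show ?thesis
        using proj_slice_zero[OF f \<zeta>[unfolded w_def] t False]
        by eventually_elim (simp add: d_def emb_def w_def False)
    qed (simp add: emb_def)
  qed
  have "L2_inner H d z = cnj (L2_inner H z d)" by (rule L2_inner_commute)
  also have "L2_inner H z d = L2_inner H z (emb (\<lambda>x. d (x, \<one>)) \<one>)"
    by (rule L2_inner_cong_AE) (use dE zL d emb_slice_L2[OF d] in \<open>auto intro!: L2_measurable\<close>)
  also have "\<dots> = L2_inner X f (\<lambda>x. d (x, \<one>))"
    unfolding f_def by (rule inner_emb[OF L2_measurable[OF zL] L2_measurable[OF d1]]) simp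
  also have "cnj \<dots> = L2_inner X (\<lambda>x. d (x, \<one>)) f" by (rule L2_inner_commute[symmetric])
  also have "\<dots> = L2_inner H d w"
    unfolding w_def by (rule inner_emb[OF L2_measurable[OF d] L2_measurable[OF f], symmetric]) simp
  finally have "L2_inner H d w = L2_inner H d z" ..
  then have "L2_inner H d w = 0" using \<zeta> z by (simp add: is_proj_def d_def)
  moreover have "L2_inner H d \<zeta> = 0" using \<zeta> by (simp add: is_proj_def d_def)
  ultimately have "L2_inner H d d = 0"
    using L2_inner_diff_right[OF w \<zeta>L d] by (simp add: d_def)
  then have "L2_norm H d = 0" by (simp add: L2_inner_self)
  then have "AE x in H. w x = \<zeta> x" using L2_norm_eq_0_iff[OF d] by (simp add: d_def)
  then have "w \<in> K" using \<zeta> w by (auto simp: is_proj_def intro: closed_subspace_AE[OF K_closed, of \<zeta> w])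
  then show ?thesis by (simp add: w_def f_def)
qed

text \<open>The operator bound \<open>C\<close> of \<open>T\<close> bounds the slice: a right
  operator, which commutes with \<open>T\<close>, cuts the slice of \<open>T vac\<close> down to the
  set \<open>S\<close> where it exceeds \<open>C\<close>, so the part over \<open>S\<close> has norm
  at most \<open>C\<close> times that of the indicator of \<open>S\<close>. This forces
  \<open>S\<close> to be null.\<close>

lemma commutant_vac_slice_bounded:
  assumes T: "T \<in> commutant H rops" and h: "h \<in> carrier G"
  shows "(\<lambda>x. T vac (x, h)) \<in> Linfty X"
proof -
  have Tb: "T \<in> bounded_ops H" using T by (rule commutant_bounded)
  obtain C where C: "0 \<le> C" "\<And>f. f \<in> L2 H \<Longrightarrow> L2_norm H (T f) \<le> C * L2_norm H f"
    using bounded_ops_bound[OF Tb] by metis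
  define t where "t = T vac"
  have t: "t \<in> L2 H" unfolding t_def by (rule bounded_ops_L2[OF Tb vac_L2])
  define th where "th = (\<lambda>x. t (x, h))"
  have th: "th \<in> L2 X" unfolding th_def by (rule L2_slice[OF t h])
  note [measurable] = L2_measurable[OF th]
  define S where "S = {x \<in> space X. C < cmod (th x)}"
  have S[measurable]: "S \<in> sets X" unfolding S_def by measurable
  \<comment> \<open>Composing with \<open>a h\<close> undoes the twist of \<open>rop\<close> on
    slice \<open>h\<close>, where the factor becomes the indicator of \<open>S\<close>
    itself.\<close>
  define F where "F = (\<lambda>x. indicator S (a h x) :: complex)"
  have iS: "(indicator S :: _ \<Rightarrow> complex) \<in> Linfty X"
    using S by (auto simp: Linfty_def indicator_def intro!: exI[of _ 1])
  have F: "F \<in> Linfty X" unfolding F_def by (rule Linfty_act[OF iS h])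
  define \<rho> where "\<rho> = rop (\<lambda>x. F (a \<one> x)) (inv \<one>)"
  have \<rho>: "\<rho> \<in> rops" using Linfty_act[OF F one_closed] by (auto simp: \<rho>_def rops_def)
  have \<rho>b: "\<rho> \<in> bounded_ops H" using \<rho> rops_bounded by blast
  have "L2_norm X (\<lambda>x. indicator S x * th x) = L2_norm X (\<lambda>x. \<rho> t (x, h))"
    unfolding L2_norm_def
    by (rule arg_cong[where f=sqrt], rule Bochner_Integration.integral_cong)
       (use h in \<open>auto simp: \<rho>_def rop_def F_def act_mult th_def act_one\<close>)
  also have "\<dots> \<le> L2_norm H (\<rho> t)" by (rule L2_norm_slice[OF bounded_ops_L2[OF \<rho>b t] h])
  also have "\<dots> = L2_norm H (T (\<rho> vac))"
    by (rule L2_norm_cong_AE, use commutantD[OF T \<rho> vac_L2] t_def in auto)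
       (intro L2_measurable bounded_ops_L2[OF \<rho>b] bounded_ops_L2[OF Tb] vac_L2)+
  also have "\<dots> \<le> C * L2_norm H (\<rho> vac)" by (rule C(2)[OF bounded_ops_L2[OF \<rho>b vac_L2]])
  also have "L2_norm H (\<rho> vac) = L2_norm H (emb F \<one>)"
    unfolding L2_norm_def \<rho>_def
    by (rule arg_cong[where f=sqrt], rule Bochner_Integration.integral_cong) (use F rop_vac[of F \<one>] in auto)
  also have "\<dots> = L2_norm X F" by (rule emb_norm) (use F in \<open>auto simp: Linfty_def\<close>)
  also have "\<dots> = L2_norm X (indicator S)"
    unfolding F_def by (rule L2_norm_distr[OF act_meas[OF h] act_distr[OF h] Linfty_L2[OF iS]])
  finally have "(L2_norm X (\<lambda>x. indicator S x * th x))\<^sup>2 \<le> (C * L2_norm X (indicator S))\<^sup>2"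
    by (intro power_mono) auto
  then have le: "(LINT x|X. (cmod (indicator S x * th x))\<^sup>2) \<le> (LINT x|X. C\<^sup>2 * (cmod (indicator S x :: complex))\<^sup>2)"
    by (simp add: L2_norm_sq power_mult_distrib)
  have i1: "integrable X (\<lambda>x. (cmod (indicator S x * th x))\<^sup>2)"
    by (rule L2_integrable[OF Linfty_mult_L2[OF iS th]])
  have i2: "integrable X (\<lambda>x. C\<^sup>2 * (cmod (indicator S x :: complex))\<^sup>2)"
    using L2_integrable[OF Linfty_L2[OF iS]] by simp
  \<comment> \<open>The excess over \<open>C\<close>: zero off \<open>S\<close> and positive on it,
    while its integral is at most 0.\<close>
  define D where "D x = (cmod (indicator S x * th x))\<^sup>2 - C\<^sup>2 * (cmod (indicator S x :: complex))\<^sup>2" for x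
  have Dn: "0 \<le> D x" "x \<in> S \<Longrightarrow> 0 < D x" for x
    using C(1) by (auto simp: D_def S_def indicator_def intro!: power_mono power_strict_mono)
  have "(LINT x|X. D x) \<le> 0" unfolding D_def using le i1 i2 by simp
  moreover have "(LINT x|X. D x) \<ge> 0" by (rule integral_nonneg_AE) (use Dn in auto)
  ultimately have "AE x in X. D x = 0"
    using i1 i2 Dn by (subst integral_nonneg_eq_0_iff_AE[symmetric]) (auto simp: D_def[abs_def])
  then have "AE x in X. cmod (th x) \<le> C"
  proof (rule AE_mp, intro AE_I2 impI)
    fix x assume x: "x \<in> space X" and 0: "D x = 0"
    have "x \<notin> S" using Dn(2)[of x] 0 by auto
    then show "cmod (th x) \<le> C" using x by (auto simp: S_def)
  qed
  then show ?thesis by (auto simp: Linfty_def th_def[symmetric] t_def[symmetric])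
qed

lemma mult_op_vac: "mult_op f vac = emb f \<one>"
  by (auto simp: mult_op_def vac_def emb_def fun_eq_iff)

text \<open>The conditional expectation onto the multiplication operators preserves
  \<open>N\<close>: its vector lies in \<open>K\<close> by \<open>K_slice\<close>, and boundedness
  of the slice turns the vector back into an operator commuting with \<open>rops\<close>.\<close>

lemma mult_slice_one_in_N:
  assumes T: "T \<in> N"
  shows "mult_op (\<lambda>x. T vac (x, \<one>)) \<in> N"
proof -
  have TQ: "T \<in> commutant H rops" using T N_rops by blast
  have "mult_op (\<lambda>x. T vac (x, \<one>)) \<in> commutant H (commutant H N)"
  proof (rule in_bicommutant_of_vac[OF N_rops N_adjoint])
    show "mult_op (\<lambda>x. T vac (x, \<one>)) \<in> commutant H rops"
      by (rule mult_op_commutes[OF commutant_vac_slice_bounded[OF TQ one_closed]])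
    fix e :: real assume "e > 0"
    then show "\<exists>n\<in>N. L2_norm H (\<lambda>x. mult_op (\<lambda>x. T vac (x, \<one>)) vac x - n vac x) < e"
      using K_slice[OF N_vac[OF T]] unfolding mult_op_vac K_def by blast
  qed
  then show ?thesis by (simp add: N_bicommutant)
qed

lemma mult_op_cong_N:
  assumes "mult_op f \<in> N" "f \<in> Linfty X" "f' \<in> Linfty X" "AE x in X. f' x = f x"
  shows "mult_op f' \<in> N"
proof (rule N_cong[OF assms(1)])
  fix \<xi> assume "\<xi> \<in> L2 H"
  then show "mult_op f' \<xi> \<in> L2 H" by (rule mult_op_L2[OF assms(3)])
  have "AE z in H. f' (fst z) = f (fst z)" unfolding AE_H using assms(4) by simp
  then show "AE z in H. mult_op f' \<xi> z = mult_op f \<xi> z"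
    by eventually_elim (simp add: mult_op_eq)
qed

text \<open>The coefficient at \<open>h\<close> is the identity coefficient of \<open>T\<close>
  times the group element \<open>inv h\<close>, which again belongs to \<open>N\<close>.\<close>

lemma mult_slice_in_N:
  assumes T: "T \<in> N" and h: "h \<in> carrier G"
  shows "mult_op (\<lambda>x. T vac (x, h)) \<in> N"
proof -
  define T' where "T' = (\<lambda>\<xi>. T (group_op G a (inv h) \<xi>))"
  have T': "T' \<in> N" unfolding T'_def by (rule N_comp[OF T group_in_N]) (use h in simp)
  have "T \<in> commutant H rops" "T' \<in> commutant H rops" using T T' N_rops by auto
  then have L: "(\<lambda>x. T vac (x, h)) \<in> Linfty X" "(\<lambda>x. T' vac (x, \<one>)) \<in> Linfty X"
    using commutant_vac_slice_bounded h by auto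
  have "AE x in X. rop (\<lambda>_. 1) h (T vac) (x, \<one>) = T' vac (x, \<one>)"
    using rop_1_N_vac[OF h T] unfolding AE_H T'_def by simp
  then have "AE x in X. T vac (x, h) = T' vac (x, \<one>)"
    by eventually_elim (use h in \<open>simp add: rop_def\<close>)
  from mult_op_cong_N[OF mult_slice_one_in_N[OF T'] L(2,1) this] show ?thesis .
qed

text \<open>\<open>T vac\<close> is the limit of finite Fourier sums whose coefficients act by multiplication operators
  in \<open>N\<close>, and the value at \<open>vac\<close> determines the operator.\<close>

lemma N_subset_bicommutant:
  assumes S: "S \<subseteq> commutant H rops" and Sadj: "\<And>s. s \<in> S \<Longrightarrow> \<exists>s'\<in>S. adjoint_ops H s s'"
    and grp: "\<And>g. g \<in> carrier G \<Longrightarrow> group_op G a g \<in> S"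
    and mul: "\<And>f. f \<in> Linfty X \<Longrightarrow> mult_op f \<in> N \<Longrightarrow> mult_op f \<in> commutant H (commutant H S)"
  shows "N \<subseteq> commutant H (commutant H S)"
proof
  fix T assume T: "T \<in> N"
  have Sb: "S \<subseteq> bounded_ops H" using S commutant_subset_bounded by blast
  define A where "A = commutant H (commutant H S)"
  have SA: "S \<subseteq> A" unfolding A_def by (rule commutant_commutant_superset[OF Sb])
  have A_rops: "A \<subseteq> commutant H rops"
    unfolding A_def
    using commutant_antimono[OF commutant_antimono[OF S, of H], of H] commutant_triple[OF rops_bounded] by simp
  have Aadj: "\<exists>s'\<in>A. adjoint_ops H s s'" if "s \<in> A" for s
    using von_neumann_algebra_bicommutant[OF Sb Sadj] that by (auto simp: von_neumann_algebra_def A_def)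
  have TQ: "T \<in> commutant H rops" using T N_rops by blast
  have "T \<in> commutant H (commutant H A)"
  proof (rule in_bicommutant_of_vac[OF A_rops Aadj TQ])
    fix e :: real assume e: "e > 0"
    obtain F where F: "finite F" "F \<subseteq> carrier G"
      "L2_norm H (\<lambda>z. T vac z - (\<Sum>g\<in>F. emb (\<lambda>x. T vac (x, g)) g z)) < e"
      using L2_finite_approx[OF N_vac_L2[OF T] e] .
    \<comment> \<open>The finite Fourier sum of \<open>T\<close> as an operator: the coefficient
      multiplies after the group element has moved \<open>vac\<close> to slice \<open>g\<close>, so
      its value at \<open>vac\<close> is the finite approximation of \<open>T vac\<close>.\<close>
    define n where "n = (\<lambda>\<xi> z. \<Sum>g\<in>F. mult_op (\<lambda>x. T vac (x, g)) (group_op G a g \<xi>) z)"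
    have "n \<in> A"
      unfolding n_def A_def
    proof (rule commutant_sum[OF commutant_subset_bounded])
      fix g assume "g \<in> F"
      then have g: "g \<in> carrier G" using F by auto
      have 1: "mult_op (\<lambda>x. T vac (x, g)) \<in> commutant H (commutant H S)"
        by (rule mul[OF commutant_vac_slice_bounded[OF TQ g] mult_slice_in_N[OF T g]])
      have 2: "group_op G a g \<in> commutant H (commutant H S)" using grp[OF g] SA by (auto simp: A_def)
      show "(\<lambda>\<xi>. mult_op (\<lambda>x. T vac (x, g)) (group_op G a g \<xi>)) \<in> commutant H (commutant H S)"
        by (rule commutant_comp[OF commutant_subset_bounded 1 2])
    qed
    moreover have "n vac z = (\<Sum>g\<in>F. emb (\<lambda>x. T vac (x, g)) g z)" if zs: "z \<in> space H" for z
      unfolding n_def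
    proof (rule sum.cong[OF refl])
      fix g assume "g \<in> F"
      then have g: "g \<in> carrier G" using F by auto
      obtain x k where z: "z = (x, k)" "x \<in> space X" "k \<in> carrier G" using zs by (auto simp: space_H)
      have "inv g \<otimes> k = \<one> \<longleftrightarrow> k = g" using z g by (metis inv_closed inv_equality inv_inv l_inv)
      then show "mult_op (\<lambda>x. T vac (x, g)) (group_op G a g vac) z = emb (\<lambda>x. T vac (x, g)) g z"
        by (simp add: z mult_op_def group_op_def vac_def emb_def)
    qed
    then have "L2_norm H (\<lambda>z. T vac z - n vac z) = L2_norm H (\<lambda>z. T vac z - (\<Sum>g\<in>F. emb (\<lambda>x. T vac (x, g)) g z))"
      unfolding L2_norm_def by (intro arg_cong[where f=sqrt] Bochner_Integration.integral_cong) auto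
    ultimately show "\<exists>n\<in>A. L2_norm H (\<lambda>x. T vac x - n vac x) < e"
      using F(3) by (intro bexI[of _ n]) simp_all
  qed
  then show "T \<in> commutant H (commutant H S)"
    unfolding A_def commutant_triple[OF commutant_subset_bounded] .
qed

end


section \<open>Multiplication operators in a commutant\<close>

lemma Linfty_lin:
  assumes "f \<in> Linfty M" "g \<in> Linfty M"
  shows "(\<lambda>x. f x + c * g x) \<in> Linfty M"
proof -
  obtain C D where C: "AE x in M. cmod (f x) \<le> C" and D: "AE x in M. cmod (g x) \<le> D"
    and [measurable]: "f \<in> borel_measurable M" "g \<in> borel_measurable M"
    using assms by (auto simp: Linfty_def)
  have "AE x in M. cmod (f x + c * g x) \<le> C + cmod c * D"
    using C D
  proof eventually_elim
    case (elim x)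
    have "cmod (f x + c * g x) \<le> cmod (f x) + cmod c * cmod (g x)"
      using norm_triangle_ineq[of "f x" "c * g x"] by (simp add: norm_mult)
    also have "\<dots> \<le> C + cmod c * D" using elim by (intro add_mono mult_left_mono) auto
    finally show ?case .
  qed
  moreover have "(\<lambda>x. f x + c * g x) \<in> borel_measurable M" by measurable
  ultimately show ?thesis unfolding Linfty_def by blast
qed

lemma Linfty_times:
  assumes "f \<in> Linfty M" "g \<in> Linfty M"
  shows "(\<lambda>x. f x * g x) \<in> Linfty M"
proof -
  obtain C D where C: "AE x in M. cmod (f x) \<le> C" and D: "AE x in M. cmod (g x) \<le> D"
    and [measurable]: "f \<in> borel_measurable M" "g \<in> borel_measurable M"
    using assms by (auto simp: Linfty_def)
  have "AE x in M. cmod (f x * g x) \<le> C * D"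
    using C D
  proof eventually_elim
    case (elim x)
    have "0 \<le> C" using elim(1) norm_ge_zero order_trans by blast
    then show ?case using elim by (simp add: norm_mult mult_mono)
  qed
  moreover have "(\<lambda>x. f x * g x) \<in> borel_measurable M" by measurable
  ultimately show ?thesis unfolding Linfty_def by blast
qed

lemma Linfty_indicator: "D \<in> sets M \<Longrightarrow> indicator D \<in> Linfty M"
  by (auto simp: Linfty_def indicator_def intro!: exI[of _ 1])

context crossed_action
begin

text \<open>Depends on an arbitrary set \<open>B\<close> because two algebras are compared:
  \<open>B\<close> is the commutant of \<open>N\<close> in one case and the commutant of the
  generators built from the factor in the other.\<close>

definition mults :: "(('x \<times> 'g \<Rightarrow> complex) \<Rightarrow> 'x \<times> 'g \<Rightarrow> complex) set \<Rightarrow> ('x \<Rightarrow> complex) set" where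
  "mults B = {f \<in> Linfty X. mult_op f \<in> commutant H B}"

lemma mults_Linfty: "f \<in> mults B \<Longrightarrow> f \<in> Linfty X"
  by (simp add: mults_def)

lemma mults_meas: "f \<in> mults B \<Longrightarrow> f \<in> borel_measurable X"
  by (simp add: mults_def Linfty_def)

lemma mults_cong_AE:
  assumes B: "B \<subseteq> bounded_ops H" and f: "f \<in> mults B" and f': "f' \<in> Linfty X" and eq: "AE x in X. f' x = f x"
  shows "f' \<in> mults B"
proof -
  have "mult_op f' \<in> commutant H B"
  proof (rule commutant_cong[OF B, of "mult_op f"])
    show "mult_op f \<in> commutant H B" using f by (simp add: mults_def)
    fix \<xi> assume "\<xi> \<in> L2 H"
    then show "mult_op f' \<xi> \<in> L2 H" by (rule mult_op_L2[OF f'])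
    have "AE z in H. f' (fst z) = f (fst z)" unfolding AE_H using eq by simp
    then show "AE z in H. mult_op f' \<xi> z = mult_op f \<xi> z"
      by eventually_elim (simp add: mult_op_eq)
  qed
  then show ?thesis using f' by (simp add: mults_def)
qed

lemma mults_cong:
  assumes B: "B \<subseteq> bounded_ops H" and f: "f \<in> mults B" and eq: "\<And>x. x \<in> space X \<Longrightarrow> f' x = f x"
  shows "f' \<in> mults B"
proof (rule mults_cong_AE[OF B f])
  show AE: "AE x in X. f' x = f x" using eq by (intro AE_I2)
  have m: "f' \<in> borel_measurable X" using mults_meas[OF f] eq by (simp cong: measurable_cong)
  obtain C where "AE x in X. cmod (f x) \<le> C" using mults_Linfty[OF f] by (auto simp: Linfty_def)
  then have "AE x in X. cmod (f' x) \<le> C" using AE by eventually_elim simp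
  then show "f' \<in> Linfty X" using m by (auto simp: Linfty_def)
qed

lemma mults_lin:
  assumes B: "B \<subseteq> bounded_ops H" and f: "f \<in> mults B" and g: "g \<in> mults B"
  shows "(\<lambda>x. f x + c * g x) \<in> mults B"
proof -
  have "mult_op (\<lambda>x. f x + c * g x) = (\<lambda>(\<xi> :: 'x \<times> 'g \<Rightarrow> complex) z. mult_op f \<xi> z + c * mult_op g \<xi> z)"
    by (auto simp: mult_op_eq fun_eq_iff algebra_simps)
  then show ?thesis
    using commutant_lincomb[OF B, of "mult_op f" "mult_op g" c] f g Linfty_lin[of f X g c]
    by (simp add: mults_def)
qed

lemma mults_times:
  assumes B: "B \<subseteq> bounded_ops H" and f: "f \<in> mults B" and g: "g \<in> mults B"
  shows "(\<lambda>x. f x * g x) \<in> mults B"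
proof -
  have "mult_op (\<lambda>x. f x * g x) = (\<lambda>\<xi> :: 'x \<times> 'g \<Rightarrow> complex. mult_op f (mult_op g \<xi>))"
    by (auto simp: mult_op_eq fun_eq_iff algebra_simps)
  then show ?thesis
    using commutant_comp[OF B, of "mult_op f" "mult_op g"] f g Linfty_times[of f X g]
    by (simp add: mults_def)
qed

lemma mults_const:
  assumes B: "B \<subseteq> bounded_ops H"
  shows "(\<lambda>_. c) \<in> mults B"
proof -
  have "mult_op (\<lambda>_. 1) = (\<lambda>\<xi> :: 'x \<times> 'g \<Rightarrow> complex. \<xi>)" by (auto simp: mult_op_eq)
  then have 1: "(\<lambda>_. 1) \<in> mults B" using commutant_id[of H B] by (simp add: mults_def Linfty_const)
  have "mult_op (\<lambda>_. 0) = (\<lambda>(\<xi> :: 'x \<times> 'g \<Rightarrow> complex) z. 0)" by (auto simp: mult_op_eq)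
  then have 0: "(\<lambda>_. 0) \<in> mults B" using commutant_zero[OF B] by (simp add: mults_def Linfty_const)
  show ?thesis using mults_lin[OF B 0 1, of c] by simp
qed

lemma mults_sum:
  assumes B: "B \<subseteq> bounded_ops H" and f: "\<And>i. i \<in> I \<Longrightarrow> f i \<in> mults B"
  shows "(\<lambda>x. \<Sum>i\<in>I. c i * f i x) \<in> mults B"
  using f
proof (induction I rule: infinite_finite_induct)
  case (insert i I)
  have "(\<lambda>x. (\<Sum>i\<in>I. c i * f i x) + c i * f i x) \<in> mults B"
    by (rule mults_lin[OF B]) (use insert in auto)
  then show ?case using insert by (simp add: add.commute)
qed (auto intro: mults_const[OF B])

lemma mults_limit:
  assumes B: "B \<subseteq> bounded_ops H" and f: "\<And>n::nat. f n \<in> mults B" and bd: "\<And>n. AE x in X. cmod (f n x) \<le> C"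
    and lim: "AE x in X. (\<lambda>n. f n x) \<longlonglongrightarrow> f' x" and f': "f' \<in> Linfty X"
  shows "f' \<in> mults B"
proof -
  have "mult_op f' \<in> commutant H B"
  proof (rule commutant_limit[OF B mult_op_bounded[OF f']])
    show "mult_op (f n) \<in> commutant H B" for n using f[of n] by (simp add: mults_def)
    fix \<xi> assume \<xi>: "\<xi> \<in> L2 H"
    show "(\<lambda>n. L2_norm H (\<lambda>z. mult_op (f n) \<xi> z - mult_op f' \<xi> z)) \<longlonglongrightarrow> 0"
      unfolding mult_op_eq
    proof (rule Linfty_mult_tendsto[OF _ _ _ _ \<xi>, where C=C])
      show "(\<lambda>z. f n (fst z)) \<in> borel_measurable H" for n by (rule fst_measurable[OF mults_meas[OF f]])
      show "(\<lambda>z. f' (fst z)) \<in> borel_measurable H" using f' by (intro fst_measurable) (simp add: Linfty_def)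
      show "AE z in H. cmod (f n (fst z)) \<le> C" for n unfolding AE_H using bd[of n] by simp
      show "AE z in H. (\<lambda>n. f n (fst z)) \<longlonglongrightarrow> f' (fst z)" unfolding AE_H using lim by simp
    qed
  qed
  then show ?thesis using f' by (simp add: mults_def)
qed

text \<open>Simple functions over \<open>F\<close> are combinations of indicators and can be chosen
  to converge pointwise with norm at most twice that of \<open>f\<close>, so closure under bounded
  limits applies with the bound \<open>2 * C\<close>.\<close>

lemma mults_simple_approx:
  assumes B: "B \<subseteq> bounded_ops H" and sub: "subalgebra X F"
    and ind: "\<And>D. D \<in> sets F \<Longrightarrow> indicator D \<in> mults B"
    and f: "f \<in> Linfty X" "f \<in> borel_measurable F"
  shows "f \<in> mults B"
proof -
  obtain C where C: "AE x in X. cmod (f x) \<le> C" using f by (auto simp: Linfty_def)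
  have sp: "space F = space X" using sub by (simp add: subalgebra_def)
  obtain s where s: "\<And>i::nat. simple_function F (s i)"
      and lim: "\<And>x. x \<in> space F \<Longrightarrow> (\<lambda>i. s i x) \<longlonglongrightarrow> f x"
      and bd: "\<And>i x. x \<in> space F \<Longrightarrow> dist (s i x) 0 \<le> 2 * dist (f x) 0"
    using borel_measurable_implies_sequence_metric[OF f(2), of 0] by blast
  have sm: "s i \<in> mults B" for i
  proof (rule mults_cong[OF B])
    show "(\<lambda>x. \<Sum>y\<in>s i ` space F. y * indicator (s i -` {y} \<inter> space F) x) \<in> mults B"
    proof (rule mults_sum[OF B])
      fix y assume "y \<in> s i ` space F"
      have "s i -` {y} \<inter> space F \<in> sets F" by (rule simple_functionD(2)[OF s])
      then show "indicator (s i -` {y} \<inter> space F) \<in> mults B" by (rule ind)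
    qed
    fix x assume "x \<in> space X"
    then have "s i x = (\<Sum>y\<in>s i ` space F. indicator (s i -` {y} \<inter> space F) x *\<^sub>R y)"
      using s sp by (intro simple_function_indicator_representation_banach) auto
    also have "\<dots> = (\<Sum>y\<in>s i ` space F. y * indicator (s i -` {y} \<inter> space F) x)"
      by (intro sum.cong) (auto simp: indicator_def)
    finally show "s i x = (\<Sum>y\<in>s i ` space F. y * indicator (s i -` {y} \<inter> space F) x)" .
  qed
  show ?thesis
  proof (rule mults_limit[OF B sm _ _ f(1), where C="2 * C"])
    show "AE x in X. cmod (s n x) \<le> 2 * C" for n
      using C
    proof (rule AE_mp, intro AE_I2 impI)
      fix x assume "x \<in> space X" "cmod (f x) \<le> C"
      then show "cmod (s n x) \<le> 2 * C" using bd[of x n] sp by simp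
    qed
    show "AE x in X. (\<lambda>n. s n x) \<longlonglongrightarrow> f x" using lim sp by (intro AE_I2) auto
  qed
qed

end

text \<open>Iterating \<open>(3 x - x\<^sup>3) / 2\<close> on \<open>[-1, 1]\<close> gives polynomials converging pointwise and boundedly
  to the sign function; this replaces the Borel functional calculus.\<close>

definition smoothstep :: "real \<Rightarrow> real" where
  "smoothstep x = (3 * x - x ^ 3) / 2"

lemma smoothstep_bound:
  assumes "\<bar>x\<bar> \<le> 1"
  shows "\<bar>smoothstep x\<bar> \<le> 1"
proof -
  \<comment> \<open>These products are \<open>2 - (3 x - x^3)\<close> and
    \<open>2 + (3 x - x^3)\<close>.\<close>
  have "0 \<le> (x - 1)\<^sup>2 * (x + 2)" "0 \<le> (x + 1)\<^sup>2 * (2 - x)"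
    using assms by (auto intro!: mult_nonneg_nonneg)
  then show ?thesis
    by (simp add: smoothstep_def abs_le_iff power2_eq_square power3_eq_cube algebra_simps)
qed

lemma smoothstep_iter_bound: "\<bar>x\<bar> \<le> 1 \<Longrightarrow> \<bar>(smoothstep ^^ n) x\<bar> \<le> 1"
  by (induction n) (auto intro: smoothstep_bound)

text \<open>On \<open>(0, 1]\<close> the map does not decrease its argument, so the iterates
  increase to a fixed point that is at least \<open>x\<close>. The fixed points are -1, 0 and
  1.\<close>

lemma smoothstep_iter_pos:
  assumes "0 < x" "x \<le> 1"
  shows "(\<lambda>n. (smoothstep ^^ n) x) \<longlonglongrightarrow> 1"
proof -
  let ?s = "\<lambda>n. (smoothstep ^^ n) x"
  have le: "?s n \<le> 1" for n using smoothstep_iter_bound[of x n] assms by auto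
  have step: "y \<le> smoothstep y" if "0 < y" "y \<le> 1" for y
  proof -
    have "0 \<le> y * (1 - y) * (1 + y)" using that by (intro mult_nonneg_nonneg) auto
    then show ?thesis by (simp add: smoothstep_def power3_eq_cube algebra_simps)
  qed
  have pos: "x \<le> ?s n" for n
  proof (induction n)
    case (Suc n)
    then have "?s n \<le> smoothstep (?s n)" using assms le by (intro step) auto
    then show ?case using Suc by simp
  qed simp
  have "?s n \<le> ?s (Suc n)" for n
    using step[of "?s n"] pos[of n] le[of n] assms by simp
  then have "incseq ?s" by (rule incseq_SucI)
  then obtain L where L: "?s \<longlonglongrightarrow> L" using incseq_convergent[of ?s 1] le by metis
  have "(\<lambda>n. smoothstep (?s n)) \<longlonglongrightarrow> smoothstep L"
    unfolding smoothstep_def[of L] smoothstep_def[of "?s _"] by (intro tendsto_intros L) simp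
  moreover have "(\<lambda>n. smoothstep (?s n)) \<longlonglongrightarrow> L" using LIMSEQ_Suc[OF L] by simp
  ultimately have "smoothstep L = L" by (rule LIMSEQ_unique)
  then have "L * (1 - L) * (1 + L) = 0" by (simp add: smoothstep_def power3_eq_cube algebra_simps)
  moreover have "x \<le> L" by (rule LIMSEQ_le_const[OF L]) (use pos in auto)
  ultimately have "L = 1" using assms by auto
  then show ?thesis using L by simp
qed

lemma smoothstep_iter_minus: "(smoothstep ^^ n) (- x) = - (smoothstep ^^ n) x"
proof (induction n)
  case (Suc n)
  have "smoothstep (- y) = - smoothstep y" for y by (simp add: smoothstep_def field_simps)
  then show ?case using Suc by simp
qed simp

lemma smoothstep_iter_zero: "(smoothstep ^^ n) 0 = 0"
  by (induction n) (simp_all add: smoothstep_def)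

lemma smoothstep_iter_sgn:
  assumes "\<bar>x\<bar> \<le> 1"
  shows "(\<lambda>n. (smoothstep ^^ n) x) \<longlonglongrightarrow> sgn x"
proof (cases x "0::real" rule: linorder_cases)
  case less
  have "(\<lambda>n. - (smoothstep ^^ n) (- x)) \<longlonglongrightarrow> - 1"
    by (intro tendsto_minus smoothstep_iter_pos) (use assms less in auto)
  then show ?thesis using less by (simp add: smoothstep_iter_minus)
next
  case equal
  then show ?thesis by (simp add: smoothstep_iter_zero)
next
  case greater
  then show ?thesis using smoothstep_iter_pos[of x] assms by simp
qed

context crossed_action
begin

lemma mults_sgn:
  assumes B: "B \<subseteq> bounded_ops H" and r: "(\<lambda>x. complex_of_real (r x)) \<in> mults B" and bd: "AE x in X. \<bar>r x\<bar> \<le> 1"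
  shows "(\<lambda>x. complex_of_real (sgn (r x))) \<in> mults B"
proof -
  have iter: "(\<lambda>x. complex_of_real ((smoothstep ^^ n) (r x))) \<in> mults B" for n
  proof (induction n)
    case (Suc n)
    define g where "g x = complex_of_real ((smoothstep ^^ n) (r x))" for x
    have g: "g \<in> mults B" using Suc unfolding g_def .
    have "(\<lambda>x. (3/2) * g x) \<in> mults B"
      using mults_lin[OF B mults_const[OF B, of 0] g, of "3/2"] by simp
    from mults_lin[OF B this mults_times[OF B g mults_times[OF B g g]], of "-1/2"]
    have "(\<lambda>x. (3/2) * g x + (-1/2) * (g x * (g x * g x))) \<in> mults B" .
    also have "(\<lambda>x. (3/2) * g x + (-1/2) * (g x * (g x * g x))) = (\<lambda>x. complex_of_real ((smoothstep ^^ Suc n) (r x)))"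
      by (auto simp: g_def smoothstep_def power3_eq_cube fun_eq_iff field_simps)
    finally show ?case .
  qed (use r in simp)
  have rm: "r \<in> borel_measurable X" using mults_meas[OF r] by (simp add: borel_measurable_complex_iff)
  show ?thesis
  proof (rule mults_limit[OF B iter, where C=1])
    show "AE x in X. cmod (complex_of_real ((smoothstep ^^ n) (r x))) \<le> 1" for n
      using bd by eventually_elim (simp add: smoothstep_iter_bound)
    show "AE x in X. (\<lambda>n. complex_of_real ((smoothstep ^^ n) (r x))) \<longlonglongrightarrow> complex_of_real (sgn (r x))"
      using bd by eventually_elim (intro tendsto_of_real smoothstep_iter_sgn)
    show "(\<lambda>x. complex_of_real (sgn (r x))) \<in> Linfty X"
      using rm by (auto simp: Linfty_def sgn_real_def intro!: exI[of _ 1])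
  qed
qed

text \<open>After rescaling into \<open>[-1, 1]\<close>, the indicator of positivity is
  \<open>(s + s^2) / 2\<close> for \<open>s\<close> the sign, and the sign is available by
  \<open>mults_sgn\<close>.\<close>

lemma mults_superlevel:
  assumes B: "B \<subseteq> bounded_ops H" and r: "(\<lambda>x. complex_of_real (r x)) \<in> mults B"
  shows "indicator {x \<in> space X. q < r x} \<in> mults B"
proof -
  obtain C where C: "AE x in X. \<bar>r x\<bar> \<le> C" using mults_Linfty[OF r] by (auto simp: Linfty_def)
  \<comment> \<open>Dominates \<open>|r x - q|\<close> almost everywhere; the summand 1 makes it
    positive.\<close>
  define K where "K = \<bar>C\<bar> + \<bar>q\<bar> + 1"
  have K: "K > 0" by (simp add: K_def)
  define t where "t x = (r x - q) / K" for x
  have t: "(\<lambda>x. complex_of_real (t x)) \<in> mults B"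
    using mults_lin[OF B mults_const[OF B, of "- complex_of_real (q / K)"] r, of "complex_of_real (1 / K)"]
    by (simp add: t_def diff_divide_distrib)
  have "AE x in X. \<bar>t x\<bar> \<le> 1"
    using C
  proof eventually_elim
    case (elim x)
    then have "\<bar>r x - q\<bar> \<le> K" by (simp add: K_def)
    then show ?case using K by (simp add: t_def)
  qed
  then have s: "(\<lambda>x. complex_of_real (sgn (t x))) \<in> mults B" by (rule mults_sgn[OF B t])
  have "(\<lambda>x. (1/2) * complex_of_real (sgn (t x))) \<in> mults B"
    using mults_lin[OF B mults_const[OF B, of 0] s, of "1/2"] by simp
  from mults_lin[OF B this mults_times[OF B s s], of "1/2"]
  have f: "(\<lambda>x. (1/2) * complex_of_real (sgn (t x)) + (1/2) * (complex_of_real (sgn (t x)) * complex_of_real (sgn (t x)))) \<in> mults B" .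
  show ?thesis
  proof (rule mults_cong[OF B f])
    fix x assume "x \<in> space X"
    have "0 < t x \<longleftrightarrow> q < r x" "t x < 0 \<longleftrightarrow> r x < q"
      using K by (auto simp: t_def zero_less_divide_iff divide_less_0_iff)
    then show "indicator {x \<in> space X. q < r x} x =
       (1/2) * complex_of_real (sgn (t x)) + (1/2) * (complex_of_real (sgn (t x)) * complex_of_real (sgn (t x)))"
      using \<open>x \<in> space X\<close> by (cases "t x" "0::real" rule: linorder_cases) (auto simp: indicator_def)
  qed
qed

section \<open>The \<sigma>-algebra belonging to the multiplication operators in a commutant\<close>

lemma mults_cnj:
  assumes B: "B \<subseteq> bounded_ops H" and adj: "\<And>S. S \<in> B \<Longrightarrow> \<exists>S'\<in>B. adjoint_ops H S S'" and f: "f \<in> mults B"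
  shows "(\<lambda>x. cnj (f x)) \<in> mults B"
  using adjoint_in_commutant[OF B adj, of "mult_op f" "mult_op (\<lambda>x. cnj (f x))"]
    mult_op_bounded[OF Linfty_cnj] mult_op_adjoint f Linfty_cnj
  by (auto simp: mults_def)

definition mult_sets :: "(('x \<times> 'g \<Rightarrow> complex) \<Rightarrow> 'x \<times> 'g \<Rightarrow> complex) set \<Rightarrow> 'x set set" where
  "mult_sets B = {D \<in> sets X. indicator D \<in> mults B}"

text \<open>Complement and union of sets are polynomial expressions in indicators,
  \<open>1 - s\<close> and \<open>s + t - s t\<close>; countable unions are bounded pointwise limits
  of finite ones.\<close>

lemma mult_sets_sigma_algebra:
  assumes B: "B \<subseteq> bounded_ops H"
  shows "sigma_algebra (space X) (mult_sets B)"
  unfolding sigma_algebra_iff2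
proof (intro conjI ballI allI impI)
  show "mult_sets B \<subseteq> Pow (space X)" using sets.space_closed by (auto simp: mult_sets_def)
  have "indicator {} \<in> mults B" by (rule mults_cong[OF B mults_const[OF B, of 0]]) simp
  then show e: "{} \<in> mult_sets B" by (simp add: mult_sets_def)
  show "space X - s \<in> mult_sets B" if s: "s \<in> mult_sets B" for s
  proof -
    have "(\<lambda>x. 1 + (-1) * indicator s x) \<in> mults B"
      by (rule mults_lin[OF B mults_const[OF B]]) (use s in \<open>simp add: mult_sets_def\<close>)
    then have "indicator (space X - s) \<in> mults B"
      by (rule mults_cong[OF B]) (auto simp: indicator_def)
    then show ?thesis using s by (auto simp: mult_sets_def)
  qed
  have union: "s \<union> t \<in> mult_sets B" if s: "s \<in> mult_sets B" and t: "t \<in> mult_sets B" for s t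
  proof -
    have i: "indicator s \<in> mults B" "indicator t \<in> mults B" using s t by (auto simp: mult_sets_def)
    have "(\<lambda>x. indicator s x + 1 * indicator t x) \<in> mults B" by (rule mults_lin[OF B i])
    then have "(\<lambda>x. (indicator s x + 1 * indicator t x) + (-1) * (indicator s x * indicator t x)) \<in> mults B"
      by (rule mults_lin[OF B _ mults_times[OF B i]])
    then have "indicator (s \<union> t) \<in> mults B"
      by (rule mults_cong[OF B]) (auto simp: indicator_def)
    then show ?thesis using s t by (auto simp: mult_sets_def)
  qed
  fix A :: "nat \<Rightarrow> 'x set" assume A: "range A \<subseteq> mult_sets B"
  have fin: "(\<Union>i<n. A i) \<in> mult_sets B" for n
  proof (induction n)
    case (Suc n)
    have "A n \<union> (\<Union>i<n. A i) \<in> mult_sets B" by (rule union) (use Suc A in auto)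
    then show ?case by (simp add: lessThan_Suc)
  qed (simp add: e)
  have m: "(\<Union>i. A i) \<in> sets X" using A by (auto simp: mult_sets_def)
  have "indicator (\<Union>i. A i) \<in> mults B"
  proof (rule mults_limit[OF B, where C=1 and f="\<lambda>n. indicator (\<Union>i<n. A i)"])
    show "indicator (\<Union>i<n. A i) \<in> mults B" for n using fin[of n] by (simp add: mult_sets_def)
    show "AE x in X. cmod (indicator (\<Union>i<n. A i) x) \<le> 1" for n by (auto simp: indicator_def)
    show "AE x in X. (\<lambda>n. indicator (\<Union>i<n. A i) x) \<longlonglongrightarrow> (indicator (\<Union>i. A i) x :: complex)"
      by (intro AE_I2 LIMSEQ_indicator_UN)
    show "indicator (\<Union>i. A i) \<in> Linfty X" by (rule Linfty_indicator[OF m])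
  qed
  then show "(\<Union>i. A i) \<in> mult_sets B" using m by (simp add: mult_sets_def)
qed

definition mult_space :: "(('x \<times> 'g \<Rightarrow> complex) \<Rightarrow> 'x \<times> 'g \<Rightarrow> complex) set \<Rightarrow> 'x measure" where
  "mult_space B = sigma (space X) (mult_sets B)"

lemma sets_mult_space:
  assumes "B \<subseteq> bounded_ops H"
  shows "sets (mult_space B) = mult_sets B"
  unfolding mult_space_def
  using sigma_algebra.sets_measure_of_eq[OF mult_sets_sigma_algebra[OF assms]] by simp

lemma space_mult_space [simp]: "space (mult_space B) = space X"
  by (simp add: mult_space_def space_measure_of_conv)

lemma subalgebra_mult_space: "B \<subseteq> bounded_ops H \<Longrightarrow> subalgebra X (mult_space B)"
  by (auto simp: subalgebra_def sets_mult_space) (simp add: mult_sets_def)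

lemma mults_if_measurable:
  assumes B: "B \<subseteq> bounded_ops H" and "f \<in> Linfty X" "f \<in> borel_measurable (mult_space B)"
  shows "f \<in> mults B"
  by (rule mults_simple_approx[OF B subalgebra_mult_space[OF B] _ assms(2,3)])
     (simp add: sets_mult_space[OF B] mult_sets_def)

text \<open>Closure under conjugation separates real and imaginary part, and for a real function the
  superlevel sets are members by \<open>mults_superlevel\<close>. Together with
  \<open>mults_if_measurable\<close> this recovers the algebra from its \<sigma>-algebra.\<close>

lemma mults_measurable:
  assumes B: "B \<subseteq> bounded_ops H" and adj: "\<And>S. S \<in> B \<Longrightarrow> \<exists>S'\<in>B. adjoint_ops H S S'" and f: "f \<in> mults B"
  shows "f \<in> borel_measurable (mult_space B)"
proof -
  note c = mults_cnj[OF B adj f]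
  have real: "r \<in> borel_measurable (mult_space B)" if r: "(\<lambda>x. complex_of_real (r x)) \<in> mults B" for r
    unfolding borel_measurable_iff_greater
  proof
    fix q
    have "r \<in> borel_measurable X" using mults_meas[OF r] by (simp add: borel_measurable_complex_iff)
    then have "{x \<in> space X. q < r x} \<in> sets X" by measurable
    then show "{x \<in> space (mult_space B). q < r x} \<in> sets (mult_space B)"
      using mults_superlevel[OF B r, of q] by (simp add: sets_mult_space[OF B] mult_sets_def)
  qed
  have h: "(\<lambda>x. (1/2) * f x) \<in> mults B" "(\<lambda>x. (-\<i>/2) * f x) \<in> mults B"
    using mults_lin[OF B mults_const[OF B, of 0] f, of "1/2"]
      mults_lin[OF B mults_const[OF B, of 0] f, of "-\<i>/2"] by simp_all
  have "(\<lambda>x. complex_of_real (Re (f x))) = (\<lambda>x. (1/2) * f x + (1/2) * cnj (f x))"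
    by (simp add: fun_eq_iff complex_eq_iff)
  then have 1: "(\<lambda>x. complex_of_real (Re (f x))) \<in> mults B" using mults_lin[OF B h(1) c, of "1/2"] by simp
  have "(\<lambda>x. complex_of_real (Im (f x))) = (\<lambda>x. (-\<i>/2) * f x + (\<i>/2) * cnj (f x))"
    by (simp add: fun_eq_iff complex_eq_iff)
  then have 2: "(\<lambda>x. complex_of_real (Im (f x))) \<in> mults B" using mults_lin[OF B h(2) c, of "\<i>/2"] by simp
  show ?thesis using real[OF 1] real[OF 2] by (simp add: borel_measurable_complex_iff)
qed

lemma mults_act:
  assumes B: "B \<subseteq> bounded_ops H" and grp: "\<And>g. g \<in> carrier G \<Longrightarrow> group_op G a g \<in> commutant H B"
    and f: "f \<in> mults B" and g: "g \<in> carrier G"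
  shows "(\<lambda>x. f (a g x)) \<in> mults B"
proof -
  \<comment> \<open>Conjugating a multiplication operator by a group element translates its
    symbol.\<close>
  define T where "T = (\<lambda>\<xi>. group_op G a (inv g) (mult_op f (group_op G a g \<xi>)))"
  have fm: "mult_op f \<in> commutant H B" using f by (simp add: mults_def)
  have T: "T \<in> commutant H B" unfolding T_def
    by (rule commutant_comp[OF B grp commutant_comp[OF B fm grp]]) (use g in auto)
  have fg: "(\<lambda>x. f (a g x)) \<in> Linfty X" by (rule Linfty_act[OF mults_Linfty[OF f] g])
  have "mult_op (\<lambda>x. f (a g x)) \<in> commutant H B"
  proof (rule commutant_cong[OF B T])
    fix \<xi> assume "\<xi> \<in> L2 H"
    then show "mult_op (\<lambda>x. f (a g x)) \<xi> \<in> L2 H" by (rule mult_op_L2[OF fg])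
    show "AE z in H. mult_op (\<lambda>x. f (a g x)) \<xi> z = T \<xi> z"
      using g by (intro AE_I2)
        (auto simp: T_def mult_op_def group_op_def space_H act_inv m_assoc[symmetric])
  qed
  then show ?thesis using fg by (simp add: mults_def)
qed

lemma act_mult_space:
  assumes B: "B \<subseteq> bounded_ops H" and grp: "\<And>g. g \<in> carrier G \<Longrightarrow> group_op G a g \<in> commutant H B"
    and g: "g \<in> carrier G"
  shows "a g \<in> measurable (mult_space B) (mult_space B)"
proof (rule measurableI)
  fix x assume "x \<in> space (mult_space B)"
  then show "a g x \<in> space (mult_space B)" using act_space[OF g] by simp
next
  fix D assume "D \<in> sets (mult_space B)"
  then have D: "D \<in> sets X" "indicator D \<in> mults B"
    by (auto simp: sets_mult_space[OF B] mult_sets_def)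
  have "(\<lambda>x. indicator D (a g x)) \<in> mults B" by (rule mults_act[OF B grp D(2) g])
  then have "indicator (a g -` D \<inter> space X) \<in> mults B"
    by (rule mults_cong[OF B]) (auto simp: indicator_def)
  moreover have "a g -` D \<inter> space X \<in> sets X" using measurable_sets[OF act_meas[OF g] D(1)] .
  ultimately show "a g -` D \<inter> space (mult_space B) \<in> sets (mult_space B)"
    by (simp add: sets_mult_space[OF B] mult_sets_def)
qed

end


section \<open>Point realization of an invariant \<open>\<sigma>\<close>-algebra\<close>

lemma countably_generated_standard:
  assumes "standard_probability_space M"
  shows "\<exists>b :: nat \<Rightarrow> 'x set. sets M = sigma_sets (space M) (range b) \<and> range b \<subseteq> Pow (space (M :: 'x measure))"
proof -
  obtain T where T: "topspace T = space M" "second_countable T" "sets M = sigma_sets (space M) {U. openin T U}"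
    using assms by (auto simp: standard_probability_space_def)
  obtain \<B> where "countable \<B> \<and> (\<forall>V\<in>\<B>. openin T V) \<and>
      (\<forall>U x. openin T U \<and> x \<in> U \<longrightarrow> (\<exists>V\<in>\<B>. x \<in> V \<and> V \<subseteq> U))"
    using T(2) unfolding second_countable_def by (elim exE) (rule that)
  then have B: "countable \<B>" "\<And>V. V \<in> \<B> \<Longrightarrow> openin T V"
    "\<And>U x. openin T U \<Longrightarrow> x \<in> U \<Longrightarrow> \<exists>V\<in>\<B>. x \<in> V \<and> V \<subseteq> U"
    by simp_all
  \<comment> \<open>The empty set is added so that the family is nonempty and is the range of a
    sequence.\<close>
  define b where "b = from_nat_into (insert {} \<B>)"
  have r: "range b = insert {} \<B>"
    unfolding b_def by (rule range_from_nat_into) (use B in auto)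
  have sub: "range b \<subseteq> Pow (space M)" unfolding r using openin_subset[OF B(2)] T(1) by auto
  have "U \<in> sigma_sets (space M) (range b)" if "openin T U" for U
  proof -
    have "U = \<Union>{V \<in> \<B>. V \<subseteq> U}" using B(3)[OF that] by blast
    moreover have "\<Union>{V \<in> \<B>. V \<subseteq> U} \<in> sigma_sets (space M) (range b)"
    proof (rule sigma_sets_UNION)
      show "countable {V \<in> \<B>. V \<subseteq> U}" using B(1) by (rule countable_subset[rotated]) auto
      show "\<And>V. V \<in> {V \<in> \<B>. V \<subseteq> U} \<Longrightarrow> V \<in> sigma_sets (space M) (range b)" unfolding r by auto
    qed
    ultimately show ?thesis by simp
  qed
  then have "sigma_sets (space M) {U. openin T U} \<subseteq> sigma_sets (space M) (range b)"
    by (intro sigma_sets_mono) auto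
  moreover have "sigma_sets (space M) (range b) \<subseteq> sigma_sets (space M) {U. openin T U}"
    unfolding r by (intro sigma_sets_mono') (use B(2) in auto)
  ultimately show ?thesis using T(3) sub by (intro exI[of _ b]) auto
qed

text \<open>The countable algebra generated by the sequence is dense: the sets it approximates
  contain the generators and are closed under complements and countable unions, the latter by
  continuity of the measure from below.\<close>

lemma separable_measure_algebra:
  fixes M :: "'x measure" and b :: "nat \<Rightarrow> 'x set"
  assumes fin: "finite_measure M" and gen: "sets M = sigma_sets (space M) (range b)" and b: "range b \<subseteq> Pow (space M)"
  shows "\<exists>\<U>. countable \<U> \<and> \<U> \<subseteq> sets M \<and> (\<forall>B\<in>sets M. \<forall>e>0. \<exists>U\<in>\<U>. measure M (sym_diff B U) < e)"
proof -
  interpret finite_measure M by fact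
  define U where "U n S = {x \<in> space M. {i \<in> {..<n}. x \<in> b i} \<in> S}" for n :: nat and S :: "nat set set"
  define \<U> where "\<U> = (\<Union>n. U n ` Pow (Pow {..<n}))"
  have count: "countable \<U>" unfolding \<U>_def
    by (rule countable_UN) (auto intro!: countable_finite)
  have bM: "b i \<in> sets M" for i unfolding gen by auto
  have UM: "U n S \<in> sets M" for n S
  proof -
    have "U n S = (\<Union>s\<in>S \<inter> Pow {..<n}. {x \<in> space M. \<forall>i\<in>{..<n}. x \<in> b i \<longleftrightarrow> i \<in> s})"
    proof (rule Set.set_eqI, rule iffI)
      fix x assume x: "x \<in> U n S"
      define s where "s = {i \<in> {..<n}. x \<in> b i}"
      have "s \<in> S \<inter> Pow {..<n}" "x \<in> {x \<in> space M. \<forall>i\<in>{..<n}. x \<in> b i \<longleftrightarrow> i \<in> s}"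
        using x by (auto simp: U_def s_def)
      then show "x \<in> (\<Union>s\<in>S \<inter> Pow {..<n}. {x \<in> space M. \<forall>i\<in>{..<n}. x \<in> b i \<longleftrightarrow> i \<in> s})" by (rule UN_I)
    next
      fix x assume "x \<in> (\<Union>s\<in>S \<inter> Pow {..<n}. {x \<in> space M. \<forall>i\<in>{..<n}. x \<in> b i \<longleftrightarrow> i \<in> s})"
      then obtain s where s: "s \<in> S" "s \<subseteq> {..<n}" "x \<in> space M" "\<forall>i\<in>{..<n}. x \<in> b i \<longleftrightarrow> i \<in> s" by auto
      have "{i \<in> {..<n}. x \<in> b i} = s" using s(2,4) by auto
      then show "x \<in> U n S" using s by (simp add: U_def)
    qed
    moreover have "{x \<in> space M. \<forall>i\<in>{..<n}. x \<in> b i \<longleftrightarrow> i \<in> s} \<in> sets M" for s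
      using bM by measurable
    moreover have "finite (S \<inter> Pow {..<n})" by auto
    ultimately show ?thesis by auto
  qed
  have \<U>M: "\<U> \<subseteq> sets M" using UM by (auto simp: \<U>_def)
  have inU: "U n S \<in> \<U>" for n S
  proof -
    have "U n S = U n (S \<inter> Pow {..<n})" unfolding U_def by auto
    then show ?thesis by (auto simp: \<U>_def)
  qed
  have cov: "\<exists>n S. V = U n S" if "V \<in> \<U>" for V using that by (auto simp: \<U>_def)
  \<comment> \<open>Two members can be read off at a common number of generators, which reduces
    their union to a union of pattern sets.\<close>
  have lift: "U n S = U m {s. s \<inter> {..<n} \<in> S}" if "n \<le> m" for n m S
  proof -
    have "{i \<in> {..<m}. x \<in> b i} \<inter> {..<n} = {i \<in> {..<n}. x \<in> b i}" for x using that by auto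
    then show ?thesis by (simp add: U_def)
  qed
  have Ucompl: "space M - V \<in> \<U>" if "V \<in> \<U>" for V
  proof -
    obtain n S where V: "V = U n S" using cov \<open>V \<in> \<U>\<close> by blast
    have "space M - V = U n (- S)" unfolding V U_def by auto
    then show ?thesis using inU by simp
  qed
  have Uunion: "V \<union> W \<in> \<U>" if VW: "V \<in> \<U>" "W \<in> \<U>" for V W
  proof -
    obtain n S where V: "V = U n S" using cov VW by blast
    obtain m S' where W: "W = U m S'" using cov VW by blast
    have "V = U (max n m) {s. s \<inter> {..<n} \<in> S}" unfolding V by (rule lift) simp
    moreover have "W = U (max n m) {s. s \<inter> {..<m} \<in> S'}" unfolding W by (rule lift) simp
    moreover have "U k R \<union> U k R' = U k (R \<union> R')" for k R R' unfolding U_def by auto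
    ultimately show ?thesis using inU by simp
  qed
  define good where "good B \<longleftrightarrow> B \<in> sets M \<and> (\<forall>e>0. \<exists>V\<in>\<U>. measure M (sym_diff B V) < e)" for B
  have goodU: "good V" if "V \<in> \<U>" for V
    using that \<U>M by (auto simp: good_def intro!: bexI[of _ V])
  have good2: "good (B \<union> C)" if B: "good B" and C: "good C" for B C
    unfolding good_def
  proof (intro conjI allI impI)
    show "B \<union> C \<in> sets M" using B C by (auto simp: good_def)
    fix e :: real assume "e > 0"
    then have e: "e / 2 > 0" by simp
    obtain V W where V: "V \<in> \<U>" "measure M (sym_diff B V) < e / 2"
      and W: "W \<in> \<U>" "measure M (sym_diff C W) < e / 2"
      using B C e unfolding good_def by blast
    have m: "B \<in> sets M" "C \<in> sets M" "V \<in> sets M" "W \<in> sets M"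
      using B C V W \<U>M by (auto simp: good_def)
    have "measure M (sym_diff (B \<union> C) (V \<union> W)) \<le> measure M (sym_diff B V \<union> sym_diff C W)"
      by (rule finite_measure_mono) (use m in auto)
    also have "\<dots> \<le> measure M (sym_diff B V) + measure M (sym_diff C W)"
      by (rule measure_Un_le) (use m in auto)
    also have "\<dots> < e" using V W by simp
    finally show "\<exists>V\<in>\<U>. measure M (sym_diff (B \<union> C) V) < e" using Uunion[OF V(1) W(1)] by blast
  qed
  have good: "good B" if "B \<in> sigma_sets (space M) (range b)" for B
    using that
  proof (induction rule: sigma_sets.induct)
    case (Basic B)
    then obtain i where i: "B = b i" by auto
    have "B \<subseteq> space M" using Basic b by auto
    then have "B = U (Suc i) {s. i \<in> s}" unfolding i U_def by auto
    then show ?case using goodU[OF inU] by simp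
  next
    case Empty
    have "{} = U 0 {}" unfolding U_def by auto
    then show ?case using goodU[OF inU[of 0 "{}"]] by simp
  next
    case (Compl B)
    show ?case unfolding good_def
    proof (intro conjI allI impI)
      show "space M - B \<in> sets M" using Compl by (auto simp: good_def)
      fix e :: real assume "e > 0"
      then obtain V where V: "V \<in> \<U>" "measure M (sym_diff B V) < e" using Compl unfolding good_def by blast
      have "B \<subseteq> space M" "V \<subseteq> space M" using Compl V \<U>M sets.sets_into_space by (auto simp: good_def)
      then have "sym_diff (space M - B) (space M - V) = sym_diff B V" by auto
      then show "\<exists>V\<in>\<U>. measure M (sym_diff (space M - B) V) < e" using V Ucompl[OF V(1)] by (intro bexI[of _ "space M - V"]) simp
    qed
  next
    case (Union A)
    have AM: "A i \<in> sets M" for i using Union by (auto simp: good_def)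
    have fing: "good (\<Union>i<n. A i)" for n
    proof (induction n)
      case 0
      have "{} = U 0 {}" unfolding U_def by auto
      then show ?case using goodU[OF inU[of 0 "{}"]] by simp
    next
      case (Suc n)
      have "good (A n \<union> (\<Union>i<n. A i))" by (rule good2[OF Union(2) Suc])
      then show ?case by (simp add: lessThan_Suc)
    qed
    have lim: "(\<lambda>n. measure M (\<Union>i<n. A i)) \<longlonglongrightarrow> measure M (\<Union>n. \<Union>i<n. A i)"
      by (rule finite_Lim_measure_incseq) (use AM in \<open>auto simp: incseq_def intro: less_le_trans\<close>)
    have un: "(\<Union>n. \<Union>i<n. A i) = (\<Union>i. A i)" by auto
    show ?case unfolding good_def
    proof (intro conjI allI impI)
      show UA: "(\<Union>i. A i) \<in> sets M" using AM by auto
      fix e :: real assume e: "e > 0"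
      have "\<forall>\<^sub>F n in sequentially. measure M (\<Union>i. A i) - e / 2 < measure M (\<Union>i<n. A i)"
        by (rule order_tendstoD(1)[OF lim]) (use e un in simp)
      then obtain n where n: "measure M (\<Union>i. A i) - e / 2 < measure M (\<Union>i<n. A i)"
        by (auto simp: eventually_sequentially)
      have nM: "(\<Union>i<n. A i) \<in> sets M" using AM by auto
      have small: "measure M ((\<Union>i. A i) - (\<Union>i<n. A i)) < e / 2"
      proof -
        have "(\<Union>i<n. A i) \<subseteq> (\<Union>i. A i)" by auto
        from finite_measure_Diff[OF UA nM this] show ?thesis using n by linarith
      qed
      obtain V where V: "V \<in> \<U>" "measure M (sym_diff (\<Union>i<n. A i) V) < e / 2"
        using fing[of n] e unfolding good_def by (meson half_gt_zero)
      have VM: "V \<in> sets M" using V \<U>M by auto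
      have "measure M (sym_diff (\<Union>i. A i) V) \<le> measure M (((\<Union>i. A i) - (\<Union>i<n. A i)) \<union> sym_diff (\<Union>i<n. A i) V)"
        by (rule finite_measure_mono) (use UA nM VM in auto)
      also have "\<dots> \<le> measure M ((\<Union>i. A i) - (\<Union>i<n. A i)) + measure M (sym_diff (\<Union>i<n. A i) V)"
        by (rule measure_Un_le) (use UA nM VM in auto)
      also have "\<dots> < e" using small V by simp
      finally show "\<exists>V\<in>\<U>. measure M (sym_diff (\<Union>i. A i) V) < e" using V by blast
    qed
  qed
  show ?thesis
    using count \<U>M good unfolding gen good_def by blast
qed

text \<open>A subset of a separable metric space is separable: for every set of a countable dense
  family and every radius, one member of the given family within that radius is kept, if there is
  one.\<close>

lemma dense_sequence_of_sets:
  fixes M :: "'x measure"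
  assumes M: "standard_probability_space M" and A: "\<A> \<subseteq> sets M" "{} \<in> \<A>"
  shows "\<exists>B :: nat \<Rightarrow> 'x set. range B \<subseteq> \<A> \<and> (\<forall>D\<in>\<A>. \<forall>e>0. \<exists>n. measure M (sym_diff D (B n)) < e)"
proof -
  interpret prob_space M using M by (simp add: standard_probability_space_def)
  obtain b :: "nat \<Rightarrow> 'x set" where b: "sets M = sigma_sets (space M) (range b)" "range b \<subseteq> Pow (space M)"
    using countably_generated_standard[OF M] by blast
  obtain \<U> where "countable \<U> \<and> \<U> \<subseteq> sets M \<and> (\<forall>B\<in>sets M. \<forall>e>0. \<exists>U\<in>\<U>. measure M (sym_diff B U) < e)"
    using separable_measure_algebra[OF finite_measure_axioms b] ..
  then have U: "countable \<U>" "\<U> \<subseteq> sets M" "\<And>B e. B \<in> sets M \<Longrightarrow> e > 0 \<Longrightarrow> \<exists>U\<in>\<U>. measure M (sym_diff B U) < e"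
    by simp_all
  \<comment> \<open>The disjunction keeps the choice satisfiable even if no member is close enough;
    then any member, such as the empty set, serves, and the chosen set always lies in the
    family.\<close>
  define S where "S = (\<lambda>(V, k). SOME B. B \<in> \<A> \<and> (measure M (sym_diff B V) < 1 / real (Suc k) \<or>
      \<not> (\<exists>B\<in>\<A>. measure M (sym_diff B V) < 1 / real (Suc k)))) ` (\<U> \<times> (UNIV :: nat set))"
  have SA: "S \<subseteq> \<A>"
  proof
    fix B assume "B \<in> S"
    then obtain V k where B: "B = (SOME B. B \<in> \<A> \<and> (measure M (sym_diff B V) < 1 / real (Suc k) \<or>
      \<not> (\<exists>B\<in>\<A>. measure M (sym_diff B V) < 1 / real (Suc k))))" by (auto simp: S_def)
    have "\<exists>B. B \<in> \<A> \<and> (measure M (sym_diff B V) < 1 / real (Suc k) \<or>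
      \<not> (\<exists>B\<in>\<A>. measure M (sym_diff B V) < 1 / real (Suc k)))" using A(2) by blast
    from someI_ex[OF this] show "B \<in> \<A>" unfolding B by blast
  qed
  have dense: "\<exists>B\<in>S. measure M (sym_diff D B) < e" if D: "D \<in> \<A>" and e: "e > 0" for D e
  proof -
    obtain k where k: "2 / e < real k" using reals_Archimedean2 by blast
    have "2 / e < real (Suc k)" using k by linarith
    then have k2: "1 / real (Suc k) < e / 2" using e by (simp add: field_simps)
    obtain V where V: "V \<in> \<U>" "measure M (sym_diff D V) < 1 / real (Suc k)"
      using U(3)[of D "1 / real (Suc k)"] D A by auto
    define B where "B = (SOME B. B \<in> \<A> \<and> (measure M (sym_diff B V) < 1 / real (Suc k) \<or>
      \<not> (\<exists>B\<in>\<A>. measure M (sym_diff B V) < 1 / real (Suc k))))"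
    have "\<exists>B. B \<in> \<A> \<and> (measure M (sym_diff B V) < 1 / real (Suc k) \<or>
      \<not> (\<exists>B\<in>\<A>. measure M (sym_diff B V) < 1 / real (Suc k)))" using A(2) by blast
    from someI_ex[OF this] have B: "B \<in> \<A>" "measure M (sym_diff B V) < 1 / real (Suc k)"
      using D V(2) unfolding B_def[symmetric] by blast+
    have BS: "B \<in> S" unfolding S_def B_def using V(1) by (intro image_eqI[of _ _ "(V, k)"]) auto
    have m: "D \<in> sets M" "B \<in> sets M" "V \<in> sets M" using D B V A U(2) by auto
    have "measure M (sym_diff D B) \<le> measure M (sym_diff D V \<union> sym_diff B V)"
      by (rule finite_measure_mono) (use m in auto)
    also have "\<dots> \<le> measure M (sym_diff D V) + measure M (sym_diff B V)"
      by (rule measure_Un_le) (use m in auto)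
    also have "\<dots> < e" using V B k2 by linarith
    finally show ?thesis using BS by blast
  qed
  have cS: "countable S" unfolding S_def using U(1) by auto
  have ne: "S \<noteq> {}" using dense[OF A(2), of 1] by auto
  have r: "range (from_nat_into S) = S" by (rule range_from_nat_into[OF ne cS])
  show ?thesis
  proof (intro exI[of _ "from_nat_into S"] conjI ballI allI impI)
    show "range (from_nat_into S) \<subseteq> \<A>" using r SA by simp
    fix D e assume "D \<in> \<A>" "e > (0::real)"
    then obtain B where "B \<in> S" "measure M (sym_diff D B) < e" using dense by blast
    then show "\<exists>n. measure M (sym_diff D (from_nat_into S n)) < e" using r by (metis rangeE)
  qed
qed

text \<open>The map \<open>y \<mapsto> (d y (c k))\<^sub>k\<close> for a dense sequence \<open>c\<close> embeds a Polish space onto a Borel set of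
  sequences: its image consists of the sequences with infimum \<open>0\<close> that satisfy all triangle
  inequalities with the points \<open>c k\<close>. So the inverse is Borel without appeal to Lusin--Souslin.\<close>

lemma standard_space_embedding:
  assumes M: "standard_probability_space M"
  shows "\<exists>(\<theta> :: 'y \<Rightarrow> nat \<Rightarrow> real) \<rho>. \<theta> \<in> measurable M borel \<and> \<rho> \<in> measurable borel M \<and>
    (\<forall>y\<in>space M. \<rho> (\<theta> y) = y)"
proof -
  interpret P: prob_space M using M by (simp add: standard_probability_space_def)
  obtain T where T: "topspace T = space M" "completely_metrizable_space T" "second_countable T"
    "sets M = sigma_sets (space M) {U. openin T U}"
    using M by (auto simp: standard_probability_space_def)
  obtain M0 d where ms: "Metric_space M0 d" and mc: "Metric_space.mcomplete M0 d" and Td: "T = Metric_space.mtopology M0 d"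
    using T(2) unfolding completely_metrizable_space_def by blast
  interpret Metric_space M0 d by (rule ms)
  have M0: "M0 = space M" using T(1) Td by simp
  obtain C where C: "countable C" "C \<subseteq> M0" "T closure_of C = M0"
    using second_countable_imp_separable_space[OF T(3)] T(1) M0 unfolding separable_space_def by auto
  have Cne: "C \<noteq> {}" using C(3) M0 P.not_empty by auto
  define c where "c = from_nat_into C"
  have rc: "range c = C" unfolding c_def by (rule range_from_nat_into[OF Cne C(1)])
  have cM: "c k \<in> M0" for k using rc C by auto
  have dense: "\<exists>k. d y (c k) < e" if "y \<in> M0" "e > 0" for y e
  proof -
    have "y \<in> mtopology closure_of C" using that C(3) Td by simp
    then have "\<exists>z\<in>C. z \<in> mball y e" using \<open>e > 0\<close> unfolding metric_closure_of by blast
    then obtain z where "z \<in> C" "z \<in> mball y e" by blast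
    then show ?thesis using rc by (metis in_mball rangeE)
  qed
  define \<theta> where "\<theta> y = (\<lambda>k. d y (c k))" for y
  \<comment> \<open>Sequences that look like the distances from a point to the \<open>c k\<close>.
    Only countably many coordinate conditions enter, so the set is Borel; negative coordinates are
    excluded by the case \<open>j = k\<close> of the last one.\<close>
  define S where "S = {s :: nat \<Rightarrow> real. (\<forall>n. \<exists>k. s k < 1 / real (Suc n)) \<and>
      (\<forall>j k. s k \<le> d (c j) (c k) + s j \<and> d (c j) (c k) \<le> s j + s k)}"
  have S: "S \<in> sets borel"
  proof -
    have "{s \<in> space borel. (\<forall>n. \<exists>k. (s :: nat \<Rightarrow> real) k < 1 / real (Suc n)) \<and>
      (\<forall>j k. s k \<le> d (c j) (c k) + s j \<and> d (c j) (c k) \<le> s j + s k)} \<in> sets borel"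
    proof -
      have c: "(\<lambda>s :: nat \<Rightarrow> real. s k) \<in> borel_measurable borel" for k
        by (rule measurable_product_coordinates)
      have "{s \<in> space borel. (s :: nat \<Rightarrow> real) k < r} \<in> sets borel"
        "{s \<in> space borel. (s :: nat \<Rightarrow> real) k \<le> r + s j} \<in> sets borel"
        "{s \<in> space borel. r \<le> (s :: nat \<Rightarrow> real) j + s k} \<in> sets borel" for j k r
        by (intro borel_measurable_less borel_measurable_le borel_measurable_add borel_measurable_const c)+
      then show ?thesis
        by (intro sets.sets_Collect_conj sets.sets_Collect_countable_All sets.sets_Collect_countable_Ex)
    qed
    then show ?thesis by (simp add: S_def)
  qed
  have \<theta>S: "\<theta> y \<in> S" if y: "y \<in> M0" for y
    unfolding S_def
  proof (intro CollectI conjI allI)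
    show "\<exists>k. \<theta> y k < 1 / real (Suc n)" for n unfolding \<theta>_def by (rule dense[OF y]) simp
    show "\<theta> y k \<le> d (c j) (c k) + \<theta> y j" for j k
      unfolding \<theta>_def using triangle[OF y cM[of j] cM[of k]] by simp
    show "d (c j) (c k) \<le> \<theta> y j + \<theta> y k" for j k
      unfolding \<theta>_def using triangle[OF cM[of j] y cM[of k]] commute[of "c j" y] by simp
  qed
  have inj: "y = y'" if y: "y \<in> M0" "y' \<in> M0" and eq: "\<theta> y = \<theta> y'" for y y'
  proof -
    have "d y y' \<le> 0 + e" if "e > 0" for e
    proof -
      obtain k where k: "d y (c k) < e / 2" using dense[OF y(1) half_gt_zero[OF \<open>e > 0\<close>]] by blast
      have "d y' (c k) < e / 2" using k fun_cong[OF eq, of k] by (simp add: \<theta>_def)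
      then show ?thesis using k triangle[OF y(1) cM y(2), of k] commute[of "c k" y'] by simp
    qed
    then have "d y y' \<le> 0" by (rule field_le_epsilon)
    then show ?thesis using y zero[of y y'] nonneg[of y y'] by simp
  qed
  have surj: "\<exists>y\<in>M0. \<theta> y = s" if s: "s \<in> S" for s
  proof -
    have S1: "\<exists>k. s k < 1 / real (Suc n)" and S2: "s k \<le> d (c j) (c k) + s j" and S3: "d (c j) (c k) \<le> s j + s k" for n j k
      using s by (auto simp: S_def)
    \<comment> \<open>Points \<open>c (\<kappa> n)\<close> whose prescribed distance from the
      missing point tends to 0. The triangle inequalities make them Cauchy, and their limit has all
      the prescribed distances.\<close>
    obtain \<kappa> where \<kappa>: "\<And>n. s (\<kappa> n) < 1 / real (Suc n)" using S1 by metis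
    have small: "\<exists>N. \<forall>n\<ge>N. s (\<kappa> n) < e" if "e > 0" for e
    proof -
      obtain N where N: "1 / e < real N" using reals_Archimedean2 by blast
      have "s (\<kappa> n) < e" if "n \<ge> N" for n
      proof -
        have "1 / e < real (Suc n)" using N that by linarith
        then have "1 / real (Suc n) < e" using \<open>e > 0\<close> by (simp add: field_simps)
        then show ?thesis using \<kappa>[of n] by linarith
      qed
      then show ?thesis by blast
    qed
    have "MCauchy (\<lambda>n. c (\<kappa> n))"
      unfolding MCauchy_def
    proof (intro conjI allI impI)
      show "range (\<lambda>n. c (\<kappa> n)) \<subseteq> M0" using cM by auto
      fix e :: real assume "e > 0"
      then obtain N where N: "\<And>n. n \<ge> N \<Longrightarrow> s (\<kappa> n) < e / 2" using small[of "e/2"] by auto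
      have "d (c (\<kappa> n)) (c (\<kappa> n')) < e" if "N \<le> n" "N \<le> n'" for n n'
        using S3[of "\<kappa> n" "\<kappa> n'"] N[OF that(1)] N[OF that(2)] by linarith
      then show "\<exists>N. \<forall>n n'. N \<le> n \<longrightarrow> N \<le> n' \<longrightarrow> d (c (\<kappa> n)) (c (\<kappa> n')) < e" by blast
    qed
    then obtain y where "limitin mtopology (\<lambda>n. c (\<kappa> n)) y sequentially" using mc unfolding mcomplete_def by blast
    then have y: "y \<in> M0" and lim: "\<And>e. e > 0 \<Longrightarrow> \<exists>N. \<forall>n\<ge>N. c (\<kappa> n) \<in> M0 \<and> d (c (\<kappa> n)) y < e"
      unfolding limit_metric_sequentially by auto
    have "d y (c k) = s k" for k
    proof -
      have "\<bar>d y (c k) - s k\<bar> \<le> 0 + e" if "e > 0" for e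
      proof -
        have e2: "e / 2 > 0" using that by simp
        obtain N1 where N1: "\<And>n. n \<ge> N1 \<Longrightarrow> s (\<kappa> n) < e / 2" using small[OF e2] by auto
        obtain N2 where N2: "\<And>n. n \<ge> N2 \<Longrightarrow> d (c (\<kappa> n)) y < e / 2" using lim[OF e2] by auto
        define n where "n = max N1 N2"
        have 1: "s (\<kappa> n) < e / 2" "d (c (\<kappa> n)) y < e / 2" using N1[of n] N2[of n] by (auto simp: n_def)
        have 2: "d y (c k) \<le> d (c (\<kappa> n)) y + d (c (\<kappa> n)) (c k)"
          using triangle[OF y cM[of "\<kappa> n"] cM[of k]] commute[of y "c (\<kappa> n)"] by simp
        have 3: "d (c (\<kappa> n)) (c k) \<le> d (c (\<kappa> n)) y + d y (c k)"
          by (rule triangle[OF cM y cM])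
        have "s k \<le> d (c (\<kappa> n)) (c k) + s (\<kappa> n)" "d (c (\<kappa> n)) (c k) \<le> s (\<kappa> n) + s k"
          using S2[of k "\<kappa> n"] S3[of "\<kappa> n" k] by auto
        then show ?thesis using 1 2 3 unfolding abs_le_iff by linarith
      qed
      then have "\<bar>d y (c k) - s k\<bar> \<le> 0" by (rule field_le_epsilon)
      then show ?thesis by simp
    qed
    then show ?thesis using y by (intro bexI[of _ y]) (auto simp: \<theta>_def)
  qed
  obtain y0 where y0: "y0 \<in> M0" using M0 P.not_empty by auto
  \<comment> \<open>Off the image the value is a fixed point \<open>y0\<close>, harmless because the
    image is Borel.\<close>
  define \<rho> where "\<rho> s = (if s \<in> S then SOME y. y \<in> M0 \<and> \<theta> y = s else y0)" for s
  have \<rho>S: "\<rho> s \<in> M0 \<and> \<theta> (\<rho> s) = s" if "s \<in> S" for s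
    unfolding \<rho>_def using someI_ex[of "\<lambda>y. y \<in> M0 \<and> \<theta> y = s"] surj[OF that] that by auto
  have \<rho>M: "\<rho> s \<in> M0" for s using \<rho>S y0 by (cases "s \<in> S") (auto simp: \<rho>_def)
  have ball: "mball (c k) r \<in> sets M" for k r unfolding T(4) Td by (intro sigma_sets.Basic) auto
  have "\<theta> \<in> measurable M borel"
  proof (rule measurable_coordinatewise_then_product)
    fix k
    show "(\<lambda>y. \<theta> y k) \<in> borel_measurable M"
      unfolding borel_measurable_iff_less
    proof
      fix r
      have "{y \<in> space M. \<theta> y k < r} = mball (c k) r"
        using cM by (auto simp: \<theta>_def M0[symmetric] commute)
      then show "{y \<in> space M. \<theta> y k < r} \<in> sets M" using ball by simp
    qed
  qed
  moreover have "\<rho> \<in> measurable borel M"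
  proof (rule measurable_sigma_sets[OF T(4)])
    show "{U. openin T U} \<subseteq> Pow (space M)" using openin_subset T(1) by auto
    show "\<rho> \<in> space borel \<rightarrow> space M" using \<rho>M M0 by auto
    fix U assume "U \<in> {U. openin T U}"
    then have U: "openin mtopology U" by (simp add: Td)
    \<comment> \<open>Countably many balls with centres \<open>c k\<close> and radii
      \<open>1 / Suc n\<close> exhaust \<open>U\<close>, and for \<open>s\<close> in
      \<open>S\<close> membership of \<open>\<rho> s\<close> in such a ball is the condition
      \<open>s k < 1 / Suc n\<close> on one coordinate.\<close>
    define I where "I = {(k, n). mball (c k) (1 / real (Suc n)) \<subseteq> U}"
    have cover: "\<exists>(k, n)\<in>I. d y (c k) < 1 / real (Suc n)" if "y \<in> U" for y
    proof -
      have yM: "y \<in> M0" and "\<exists>r>0. mball y r \<subseteq> U" using U \<open>y \<in> U\<close> unfolding openin_mtopology by auto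
      then obtain r where r: "r > 0" "mball y r \<subseteq> U" by blast
      obtain n where n: "2 / r < real n" using reals_Archimedean2 by blast
      have "2 / r < real (Suc n)" using n by linarith
      then have n2: "2 / real (Suc n) < r" using r by (simp add: field_simps)
      obtain k where k: "d y (c k) < 1 / real (Suc n)" using dense[OF yM, of "1 / real (Suc n)"] by auto
      have "mball (c k) (1 / real (Suc n)) \<subseteq> mball y r"
      proof
        fix z assume z: "z \<in> mball (c k) (1 / real (Suc n))"
        then have "d y z \<le> d y (c k) + d (c k) z" using triangle[OF yM cM] by auto
        also have "\<dots> < 2 / real (Suc n)" using k z by (simp add: field_simps)
        finally show "z \<in> mball y r" using z yM n2 by auto
      qed
      then show ?thesis using k r by (intro bexI[of _ "(k, n)"]) (auto simp: I_def)
    qed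
    have "\<rho> -` U \<inter> S = (\<Union>(k, n)\<in>I. {s. s k < 1 / real (Suc n)}) \<inter> S"
    proof (intro Set.set_eqI iffI)
      fix s assume s: "s \<in> \<rho> -` U \<inter> S"
      then have "\<theta> (\<rho> s) = s" using \<rho>S by auto
      then have sk: "d (\<rho> s) (c k) = s k" for k by (metis \<theta>_def)
      obtain k n where "(k, n) \<in> I" "d (\<rho> s) (c k) < 1 / real (Suc n)" using cover[of "\<rho> s"] s by auto
      then show "s \<in> (\<Union>(k, n)\<in>I. {s. s k < 1 / real (Suc n)}) \<inter> S" using s sk by auto
    next
      fix s assume s: "s \<in> (\<Union>(k, n)\<in>I. {s. s k < 1 / real (Suc n)}) \<inter> S"
      then obtain k n where kn: "(k, n) \<in> I" "s k < 1 / real (Suc n)" by auto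
      have r: "\<rho> s \<in> M0" "\<theta> (\<rho> s) = s" using \<rho>S s by auto
      have "d (\<rho> s) (c k) = s k" using r(2) by (metis \<theta>_def)
      then have "\<rho> s \<in> mball (c k) (1 / real (Suc n))" using kn r cM by (simp add: commute)
      then show "s \<in> \<rho> -` U \<inter> S" using kn s by (auto simp: I_def)
    qed
    moreover have "(\<Union>(k, n)\<in>I. {s :: nat \<Rightarrow> real. s k < 1 / real (Suc n)}) \<in> sets borel"
    proof -
      have "{s \<in> space borel. (s :: nat \<Rightarrow> real) k < r} \<in> sets borel" for k r by measurable
      then have "{s :: nat \<Rightarrow> real. s k < r} \<in> sets borel" for k r by simp
      then show ?thesis by (intro sets.countable_UN') auto
    qed
    moreover have "\<rho> -` U \<inter> - S = (if y0 \<in> U then - S else {})" by (auto simp: \<rho>_def)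
    moreover have "\<rho> -` U \<inter> space borel = (\<rho> -` U \<inter> S) \<union> (\<rho> -` U \<inter> - S)" by auto
    ultimately show "\<rho> -` U \<inter> space borel \<in> sets borel" using S by auto
  qed
  moreover have "\<rho> (\<theta> y) = y" if "y \<in> space M" for y
    using inj[of "\<rho> (\<theta> y)" y] \<rho>S[OF \<theta>S] that M0 by auto
  ultimately show ?thesis by blast
qed

section \<open>Coding by sequences, transported to the reals\<close>

lemma ex_bij_sequences_real: "\<exists>\<phi> :: (nat \<Rightarrow> real) \<Rightarrow> real. bij \<phi>"
proof -
  obtain \<beta> :: "nat set \<Rightarrow> real" where \<beta>: "bij_betw \<beta> UNIV UNIV"
    using nat_sets_eqpoll_reals unfolding eqpoll_def by blast
  define \<gamma> where "\<gamma> = inv_into UNIV \<beta>"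
  have \<gamma>: "inj \<gamma>" unfolding \<gamma>_def using \<beta> by (intro bij_is_inj bij_imp_bij_inv)
  \<comment> \<open>Each term is coded as a set of naturals, and a sequence of such sets as one set
    of pairs; the converse injection is by constant sequences.\<close>
  define f where "f s = \<beta> (prod_encode ` {(n, m). m \<in> \<gamma> (s n)})" for s :: "nat \<Rightarrow> real"
  have f: "inj f"
  proof (rule injI)
    fix s t assume "f s = f t"
    then have "prod_encode ` {(n, m). m \<in> \<gamma> (s n)} = prod_encode ` {(n, m). m \<in> \<gamma> (t n)}"
      using \<beta> by (auto simp: f_def bij_betw_def inj_on_def)
    then have e: "{(n, m). m \<in> \<gamma> (s n)} = {(n, m). m \<in> \<gamma> (t n)}"
      by (simp only: inj_image_eq_iff[OF inj_prod_encode])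
    have "\<gamma> (s n) = \<gamma> (t n)" for n
      using arg_cong[OF e, of "\<lambda>A. {m. (n, m) \<in> A}"] by simp
    then show "s = t" using \<gamma> by (auto simp: inj_def)
  qed
  have g: "inj (\<lambda>r::real. \<lambda>n::nat. r)" by (rule injI) (drule fun_cong[where x=0], simp)
  have "(UNIV :: (nat \<Rightarrow> real) set) \<lesssim> (UNIV :: real set)" "(UNIV :: real set) \<lesssim> (UNIV :: (nat \<Rightarrow> real) set)"
    unfolding lepoll_def using f g by auto
  then have "(UNIV :: (nat \<Rightarrow> real) set) \<approx> (UNIV :: real set)" by (rule lepoll_antisym)
  then show ?thesis unfolding eqpoll_def by blast
qed

text \<open>The bijection \<phi> need not be Borel for the usual topology of the reals:
  \<open>Z\<close> carries the structure pulled back along its inverse, for which \<phi> is a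
  homeomorphism, and both topological properties are transported.\<close>

lemma standard_space_of_sequences:
  assumes \<phi>: "bij (\<phi> :: (nat \<Rightarrow> real) \<Rightarrow> real)" and P: "prob_space Z"
    and Z: "space Z = UNIV" "sets Z = sets (vimage_algebra UNIV (inv_into UNIV \<phi>) borel)"
  shows "standard_probability_space Z"
proof -
  let ?\<psi> = "inv_into UNIV \<phi>"
  define T where "T = pullback_topology UNIV ?\<psi> (euclidean :: (nat \<Rightarrow> real) topology)"
  have \<psi>\<phi>: "?\<psi> (\<phi> s) = s" for s using \<phi> by (simp add: bij_is_inj)
  have \<phi>\<psi>: "\<phi> (?\<psi> z) = z" for z using \<phi> by (simp add: bij_is_surj surj_f_inv_f)
  have top: "topspace T = UNIV" by (simp add: T_def topspace_pullback_topology)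
  have "continuous_map T euclidean (id \<circ> ?\<psi>)"
    unfolding T_def by (rule continuous_map_pullback) simp
  moreover have "continuous_map euclidean T \<phi>"
    unfolding T_def
  proof (rule continuous_map_pullback')
    have "?\<psi> \<circ> \<phi> = id" using \<psi>\<phi> by auto
    then show "continuous_map euclidean euclidean (?\<psi> \<circ> \<phi>)" by simp
  qed simp
  ultimately have "homeomorphic_maps T euclidean ?\<psi> \<phi>"
    unfolding homeomorphic_maps_def using \<psi>\<phi> \<phi>\<psi> by simp
  then have hom: "T homeomorphic_space (euclidean :: (nat \<Rightarrow> real) topology)"
    unfolding homeomorphic_space_def by blast
  have "completely_metrizable_space T"
    using homeomorphic_completely_metrizable_space[OF hom] completely_metrizable_space_euclidean by blast
  moreover have "second_countable (euclidean :: (nat \<Rightarrow> real) topology)"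
  proof -
    obtain B :: "(nat \<Rightarrow> real) set set" where B: "countable B" "topological_basis B" using ex_countable_basis by blast
    show ?thesis
      unfolding second_countable_def
      by (intro exI[of _ B]) (use B topological_basis_open[OF B(2)] in \<open>auto elim!: topological_basisE\<close>)
  qed
  then have "second_countable T" using homeomorphic_space_second_countability[OF hom] by blast
  moreover have "sets Z = sigma_sets (space Z) {U. openin T U}"
  proof -
    have "sets Z = {?\<psi> -` A \<inter> UNIV | A. A \<in> sets borel}"
      unfolding Z(2) by (rule sets_vimage_algebra2) auto
    also have "\<dots> = {?\<psi> -` A \<inter> UNIV | A. A \<in> sigma_sets UNIV {S. open S}}" by (simp add: sets_borel)
    also have "\<dots> = sigma_sets UNIV {?\<psi> -` A \<inter> UNIV | A. A \<in> {S. open S}}"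
      by (rule sigma_sets_vimage_commute) simp
    also have "{?\<psi> -` A \<inter> UNIV | A. A \<in> {S. open S}} = {U. openin T U}"
      by (auto simp: T_def openin_pullback_topology)
    finally show ?thesis using Z(1) by simp
  qed
  ultimately show ?thesis
    using P top Z(1) unfolding standard_probability_space_def by auto
qed

context crossed_action
begin

text \<open>The coordinates of the sequence space are indexed by \<open>\<nat> \<times> G\<close>, so that translating the group
  coordinate is a genuine action and the coding map is exactly equivariant.\<close>

definition cenc :: "nat \<times> 'g \<Rightarrow> nat" where
  "cenc = to_nat_on (UNIV \<times> carrier G)"

definition cdec :: "nat \<Rightarrow> nat \<times> 'g" where
  "cdec = from_nat_into (UNIV \<times> carrier G)"

lemma coord_countable: "countable ((UNIV :: nat set) \<times> carrier G)"
  using countable_G by simp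

lemma coord_infinite: "infinite ((UNIV :: nat set) \<times> carrier G)"
  using one_closed by (auto simp: finite_cartesian_product_iff)

lemma cdec_cenc: "h \<in> carrier G \<Longrightarrow> cdec (cenc (n, h)) = (n, h)"
  unfolding cdec_def cenc_def by (rule from_nat_into_to_nat_on[OF coord_countable]) simp

lemma cenc_cdec: "cenc (cdec i) = i"
  unfolding cdec_def cenc_def by (rule to_nat_on_from_nat_into_infinite[OF coord_countable coord_infinite])

lemma snd_cdec: "snd (cdec i) \<in> carrier G"
  using from_nat_into[of "(UNIV :: nat set) \<times> carrier G" i] coord_infinite
  unfolding cdec_def by (auto simp: mem_Times_iff)

definition shift :: "'g \<Rightarrow> (nat \<Rightarrow> real) \<Rightarrow> nat \<Rightarrow> real" where
  "shift g s = (\<lambda>i. s (cenc (fst (cdec i), inv g \<otimes> snd (cdec i))))"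

lemma shift_mult: "g \<in> carrier G \<Longrightarrow> h \<in> carrier G \<Longrightarrow> shift (g \<otimes> h) s = shift g (shift h s)"
  by (auto simp: shift_def fun_eq_iff cdec_cenc snd_cdec inv_mult_group m_assoc)

lemma shift_one: "shift \<one> s = s"
  by (auto simp: shift_def fun_eq_iff snd_cdec cenc_cdec)

lemma shift_measurable: "shift g \<in> measurable borel borel"
  unfolding shift_def by (rule measurable_coordinatewise_then_product) (rule measurable_product_coordinates)

definition code :: "(nat \<Rightarrow> 'x \<Rightarrow> real) \<Rightarrow> 'x \<Rightarrow> nat \<Rightarrow> real" where
  "code E x = (\<lambda>i. E (fst (cdec i)) (a (inv (snd (cdec i))) x))"

text \<open>Coordinate \<open>(n, h)\<close> of the code of \<open>a g x\<close> evaluates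
  \<open>E n\<close> at the image of \<open>x\<close> under \<open>inv h \<otimes> g\<close>, the
  inverse of \<open>inv g \<otimes> h\<close>; that is the coordinate that \<open>shift g\<close>
  reads.\<close>

lemma code_act:
  assumes g: "g \<in> carrier G" and x: "x \<in> space X"
  shows "code E (a g x) = shift g (code E x)"
proof
  fix i
  have i: "snd (cdec i) \<in> carrier G" by (rule snd_cdec)
  show "code E (a g x) i = shift g (code E x) i"
    using g x i by (simp add: code_def shift_def cdec_cenc act_mult inv_mult_group)
qed

lemma code_one: "x \<in> space X \<Longrightarrow> code E x (cenc (n, \<one>)) = E n x"
  by (simp add: code_def cdec_cenc act_one)

lemma code_measurable:
  assumes act: "\<And>g. g \<in> carrier G \<Longrightarrow> a g \<in> measurable F F" and E: "\<And>n. E n \<in> borel_measurable F"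
  shows "code E \<in> measurable F borel"
proof (rule measurable_coordinatewise_then_product)
  fix i
  show "(\<lambda>x. code E x i) \<in> borel_measurable F"
    unfolding code_def by (rule measurable_compose[OF act E]) (simp add: snd_cdec)
qed

text \<open>The shift acts on all sequences, so \<open>c\<close> is an action on the whole of
  \<open>Z\<close> and not merely on the image of \<open>p1\<close>. That it preserves the measure
  follows from exact equivariance, \<open>Z\<close> being the push-forward of
  \<open>X\<close>.\<close>

lemma coding_factor:
  assumes \<phi>: "bij (\<phi> :: (nat \<Rightarrow> real) \<Rightarrow> real)" and E: "\<And>n. E n \<in> borel_measurable X"
  defines "p1 \<equiv> \<lambda>x. \<phi> (code E x)" and "c \<equiv> \<lambda>g z. \<phi> (shift g (inv_into UNIV \<phi> z))"
  defines "Z \<equiv> distr X (vimage_algebra UNIV (inv_into UNIV \<phi>) borel) p1"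
  shows "pmp_action G Z c" "factor_map G X a Z c p1" "p1 \<in> measurable X Z"
    "inv_into UNIV \<phi> \<in> measurable Z borel" "\<And>g x. g \<in> carrier G \<Longrightarrow> x \<in> space X \<Longrightarrow> p1 (a g x) = c g (p1 x)"
    "\<And>g. g \<in> carrier G \<Longrightarrow> c g \<in> measurable Z Z"
proof -
  let ?W = "vimage_algebra UNIV (inv_into UNIV \<phi>) (borel :: (nat \<Rightarrow> real) measure)"
  have \<psi>\<phi>: "inv_into UNIV \<phi> (\<phi> s) = s" for s using \<phi> by (simp add: bij_is_inj)
  have \<phi>\<psi>: "\<phi> (inv_into UNIV \<phi> z) = z" for z using \<phi> by (simp add: bij_is_surj surj_f_inv_f)
  have \<psi>m: "inv_into UNIV \<phi> \<in> measurable ?W borel" by (rule measurable_vimage_algebra1) simp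
  have \<phi>m: "\<phi> \<in> measurable borel ?W" by (rule measurable_vimage_algebra2) (auto simp: \<psi>\<phi>)
  have cm: "code E \<in> measurable X borel" by (rule code_measurable[OF act_meas E])
  have p1W: "p1 \<in> measurable X ?W" unfolding p1_def by (rule measurable_compose[OF cm \<phi>m])
  have sZ: "sets Z = sets ?W" "space Z = UNIV" by (auto simp: Z_def)
  show p1: "p1 \<in> measurable X Z" using p1W by (simp add: measurable_cong_sets[OF refl sZ(1)])
  show "inv_into UNIV \<phi> \<in> measurable Z borel" using \<psi>m by (simp add: measurable_cong_sets[OF sZ(1) refl])
  have cW: "c g \<in> measurable ?W ?W" for g
    unfolding c_def by (rule measurable_compose[OF measurable_compose[OF \<psi>m shift_measurable] \<phi>m])
  show cZ: "c g \<in> measurable Z Z" if "g \<in> carrier G" for g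
    using cW by (simp add: measurable_cong_sets[OF sZ(1) sZ(1)])
  show eq: "p1 (a g x) = c g (p1 x)" if "g \<in> carrier G" "x \<in> space X" for g x
    using code_act[OF that] by (simp add: p1_def c_def \<psi>\<phi>)
  have PZ: "prob_space Z" unfolding Z_def by (rule X.prob_space_distr[OF p1W])
  have std: "standard_probability_space Z"
    by (rule standard_space_of_sequences[OF \<phi> PZ sZ(2)]) (simp add: Z_def)
  have dZ: "distr Z Z (c g) = Z" if g: "g \<in> carrier G" for g
  proof -
    have "distr Z Z (c g) = distr X Z (c g \<circ> p1)"
      unfolding Z_def by (subst distr_distr) (use cW p1W in \<open>auto simp: measurable_distr_eq2\<close>)
    also have "\<dots> = distr X Z (p1 \<circ> a g)" by (rule distr_cong) (use eq[OF g] in auto)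
    also have "\<dots> = distr (distr X X (a g)) Z p1" by (rule distr_distr[OF p1 act_meas[OF g], symmetric])
    also have "\<dots> = distr X Z p1" by (simp add: act_distr[OF g])
    also have "\<dots> = Z" unfolding Z_def by (rule distr_cong) auto
    finally show ?thesis .
  qed
  have cmul: "c (g \<otimes> h) z = c g (c h z)" if "g \<in> carrier G" "h \<in> carrier G" for g h z
    using shift_mult[OF that] by (simp add: c_def \<psi>\<phi>)
  have cone: "c \<one> z = z" for z by (simp add: c_def shift_one \<phi>\<psi>)
  have bij: "bij (c g)" if "g \<in> carrier G" for g
    by (rule bij_betw_byWitness[where f'="c (inv g)"])
       (use that cmul[of "inv g" g] cmul[of g "inv g"] cone in auto)
  have "group_action G (space Z) c"
    unfolding sZ(2) group_action_def group_hom_def group_hom_axioms_def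
  proof (intro conjI)
    show "group G" by (rule group_axioms)
    show "group (BijGroup (UNIV :: real set))" by (rule group_BijGroup)
    show "c \<in> hom G (BijGroup UNIV)"
      using bij cmul
      by (auto simp: hom_def BijGroup_def Bij_def compose_def restrict_UNIV fun_eq_iff)
  qed
  then show "pmp_action G Z c"
    using std cZ dZ by (simp add: pmp_action_def)
  show "factor_map G X a Z c p1"
    unfolding factor_map_def
  proof (intro conjI ballI)
    show "distr X Z p1 = Z" unfolding Z_def by (rule distr_cong) auto
    show "AE x in X. p1 (a g x) = c g (p1 x)" if "g \<in> carrier G" for g
      using eq[OF that] by (intro AE_I2)
  qed (rule p1)
qed

text \<open>Convergence of sets in measure is convergence of indicators in mean, and a subsequence
  converges almost everywhere; bounded limits stay in \<open>mults B\<close>.\<close>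

lemma mults_indicator_dense:
  assumes B: "B \<subseteq> bounded_ops H" and b: "\<And>n::nat. indicator (b n) \<in> mults B" "\<And>n. b n \<in> sets X"
    and D: "D \<in> sets X" and dense: "\<And>e. e > 0 \<Longrightarrow> \<exists>n. measure X (sym_diff D (b n)) < e"
  shows "indicator D \<in> mults B"
proof -
  have "\<exists>n. measure X (sym_diff D (b n)) < 1 / real (Suc k)" for k by (rule dense) simp
  then obtain \<nu> where \<nu>: "\<And>k. measure X (sym_diff D (b (\<nu> k))) < 1 / real (Suc k)" by metis
  define u :: "nat \<Rightarrow> 'x \<Rightarrow> real" where "u k x = indicator (sym_diff D (b (\<nu> k))) x" for k x
  have int: "integrable X (u k)" for k unfolding u_def
    by (rule X.integrable_const_bound[where B=1]) (use D b(2) in \<open>auto simp: indicator_def\<close>)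
  have "(LINT x|X. norm (u k x)) = measure X (sym_diff D (b (\<nu> k)))" for k
  proof -
    have "(LINT x|X. norm (u k x)) = (LINT x|X. indicator (sym_diff D (b (\<nu> k))) x)"
      by (rule Bochner_Integration.integral_cong) (auto simp: u_def)
    also have "\<dots> = measure X (sym_diff D (b (\<nu> k)))"
      using D b(2) by (simp add: sets.Int_space_eq2)
    finally show ?thesis .
  qed
  moreover have "(\<lambda>k. measure X (sym_diff D (b (\<nu> k)))) \<longlonglongrightarrow> 0"
    by (rule tendsto_sandwich[OF _ _ tendsto_const LIMSEQ_Suc[OF lim_1_over_n]])
       (use \<nu> in \<open>auto intro!: always_eventually less_imp_le\<close>)
  ultimately have "(\<lambda>k. LINT x|X. norm (u k x)) \<longlonglongrightarrow> 0" by simp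
  from tendsto_L1_AE_subseq[OF int this] obtain r where "strict_mono r"
    and lim: "AE x in X. (\<lambda>n. u (r n) x) \<longlonglongrightarrow> 0" by blast
  show ?thesis
  proof (rule mults_limit[OF B, where C=1 and f="\<lambda>n. indicator (b (\<nu> (r n)))"])
    show "indicator (b (\<nu> (r n))) \<in> mults B" for n by (rule b(1))
    show "AE x in X. cmod (indicator (b (\<nu> (r n))) x) \<le> 1" for n by (auto simp: indicator_def)
    show "indicator D \<in> Linfty X" by (rule Linfty_indicator[OF D])
    show "AE x in X. (\<lambda>n. indicator (b (\<nu> (r n))) x) \<longlonglongrightarrow> (indicator D x :: complex)"
      using lim
    proof eventually_elim
      case (elim x)
      have "cmod (indicator (b (\<nu> (r n))) x - indicator D x) = u (r n) x" for n
        by (auto simp: u_def indicator_def)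
      then have "(\<lambda>n. indicator (b (\<nu> (r n))) x - (indicator D x :: complex)) \<longlonglongrightarrow> 0"
        using elim by (subst tendsto_norm_zero_iff[symmetric]) simp
      then show ?case by (subst LIM_zero_iff[symmetric])
    qed
  qed
qed

end

text \<open>\<open>N\<close> and the crossed product of the factor are compared through their
  multiplication operators: both contain the group, and the coded sets are dense among the sets of
  \<open>N\<close>.\<close>

lemma (in intermediate_algebra) ex_intermediate_extension:
  assumes X0: "pmp_action G X0 b" and X: "standard_probability_space X"
  shows "\<exists>(Z :: real measure) c p1 p2. intermediate_extension G X a X0 b p Z c p1 p2 \<and>
    N = crossed_product_via G X a Z p1"
proof -
  \<comment> \<open>As \<open>N\<close> is a bicommutant, \<open>mults N'\<close> consists of the
    bounded functions whose multiplication operator lies in \<open>N\<close>.\<close>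
  define N' where "N' = commutant H N"
  have N'b: "N' \<subseteq> bounded_ops H" unfolding N'_def by (rule commutant_subset_bounded)
  have NN': "commutant H N' = N" unfolding N'_def by (rule N_bicommutant)
  have N'adj: "\<exists>S'\<in>N'. adjoint_ops H S S'" if "S \<in> N'" for S
    unfolding N'_def
    by (rule adjoint_commutant_ex[OF subsetI[OF N_bounded] N_adjoint that[unfolded N'_def]])
  have grpN: "group_op G a g \<in> commutant H N'" if "g \<in> carrier G" for g
    using group_in_N[OF that] NN' by simp
  define XA where "XA = mult_space N'"
  have sXA: "sets XA = mult_sets N'" "space XA = space X" "subalgebra X XA"
    unfolding XA_def by (simp_all add: sets_mult_space[OF N'b] subalgebra_mult_space[OF N'b])
  have sub: "f \<in> measurable X M" if "f \<in> measurable XA M" for f and M :: "'z measure"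
    using measurable_from_subalg[OF sXA(3) that] .
  have aXA: "a g \<in> measurable XA XA" if "g \<in> carrier G" for g
    unfolding XA_def by (rule act_mult_space[OF N'b grpN that])
  \<comment> \<open>The \<sigma>-algebra of \<open>N\<close> contains that of the base because
    \<open>N\<close> contains the multiplications by functions of \<open>p x\<close>; this is what
    allows \<open>p\<close> to be coded.\<close>
  have pXA: "p \<in> measurable XA X0"
  proof (rule measurableI)
    show "p x \<in> space X0" if "x \<in> space XA" for x using that p_meas sXA(2) by (auto dest: measurable_space)
    fix D assume D: "D \<in> sets X0"
    have "(\<lambda>x. indicator D (p x)) \<in> mults N'"
      using indicator_p[OF D] NN' by (simp add: mults_def)
    then have "indicator (p -` D \<inter> space X) \<in> mults N'"
      by (rule mults_cong[OF N'b]) (auto simp: indicator_def)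
    then show "p -` D \<inter> space XA \<in> sets XA"
      using measurable_sets[OF p_meas D] by (simp add: sXA mult_sets_def)
  qed
  have "{} \<in> mult_sets N'" using sXA(1) by (metis sets.empty_sets)
  moreover have "mult_sets N' \<subseteq> sets X" by (auto simp: mult_sets_def)
  ultimately have "\<exists>B :: nat \<Rightarrow> 'x set. range B \<subseteq> mult_sets N' \<and>
      (\<forall>D\<in>mult_sets N'. \<forall>e>0. \<exists>n. measure X (sym_diff D (B n)) < e)"
    by (intro dense_sequence_of_sets[OF X])
  then obtain B :: "nat \<Rightarrow> 'x set" where B0: "range B \<subseteq> mult_sets N' \<and>
      (\<forall>D\<in>mult_sets N'. \<forall>e>0. \<exists>n. measure X (sym_diff D (B n)) < e)" ..
  then have B: "B n \<in> mult_sets N'" for n by auto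
  have dense: "\<exists>n. measure X (sym_diff D (B n)) < e" if "D \<in> mult_sets N'" "e > 0" for D e
    using B0 that by simp
  have X0std: "standard_probability_space X0" using X0 by (simp add: pmp_action_def)
  obtain \<theta> :: "'y \<Rightarrow> nat \<Rightarrow> real" and \<rho> where "\<theta> \<in> measurable X0 borel \<and> \<rho> \<in> measurable borel X0 \<and>
      (\<forall>y\<in>space X0. \<rho> (\<theta> y) = y)"
    using standard_space_embedding[OF X0std] by (elim exE) (rule that)
  then have \<theta>: "\<theta> \<in> measurable X0 borel" and \<rho>: "\<rho> \<in> measurable borel X0"
    and \<rho>\<theta>: "\<And>y. y \<in> space X0 \<Longrightarrow> \<rho> (\<theta> y) = y" by simp_all
  \<comment> \<open>Even indices code the dense sequence of sets, so that the factor generates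
    \<open>N\<close>; odd indices code \<open>p x\<close> as a sequence of reals, so that the map to
    the base can be recovered from the code.\<close>
  define E :: "nat \<Rightarrow> 'x \<Rightarrow> real" where
    "E n x = (if even n then indicator (B (n div 2)) x else \<theta> (p x) (n div 2))" for n x
  have EXA: "E n \<in> borel_measurable XA" for n
  proof (cases "even n")
    case True
    have "indicator (B (n div 2)) \<in> borel_measurable XA"
      by (rule borel_measurable_indicator) (use B[of "n div 2"] sXA(1) in simp)
    then show ?thesis using True by (simp add: E_def[abs_def])
  next
    case False
    have "(\<lambda>x. \<theta> (p x) (n div 2)) \<in> borel_measurable XA"
      by (rule measurable_compose[OF measurable_compose[OF pXA \<theta>] measurable_product_coordinates])
    then show ?thesis using False by (simp add: E_def[abs_def])
  qed
  obtain \<phi> :: "(nat \<Rightarrow> real) \<Rightarrow> real" where \<phi>: "bij \<phi>" using ex_bij_sequences_real by blast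
  have \<psi>\<phi>: "inv_into UNIV \<phi> (\<phi> s) = s" for s using \<phi> by (simp add: bij_is_inj)
  define p1 where "p1 x = \<phi> (code E x)" for x
  define c where "c g z = \<phi> (shift g (inv_into UNIV \<phi> z))" for g z
  define Z where "Z = distr X (vimage_algebra UNIV (inv_into UNIV \<phi>) borel) p1"
  \<comment> \<open>Reads the odd coordinates at the identity element and decodes them; \<rho> is
    defined on all sequences, so \<open>p2\<close> is defined on all of \<open>Z\<close>.\<close>
  define p2 where "p2 z = \<rho> (\<lambda>k. inv_into UNIV \<phi> z (cenc (2 * k + 1, \<one>)))" for z
  note cf = coding_factor[where E=E, OF \<phi> sub[OF EXA], folded p1_def c_def, folded Z_def]
  note p1Z = cf(3)
  have p1XA: "p1 \<in> measurable XA Z"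
  proof -
    have \<phi>m: "\<phi> \<in> measurable borel (vimage_algebra UNIV (inv_into UNIV \<phi>) borel)"
      by (rule measurable_vimage_algebra2) (auto simp: \<psi>\<phi>)
    have "p1 \<in> measurable XA (vimage_algebra UNIV (inv_into UNIV \<phi>) borel)"
      unfolding p1_def by (rule measurable_compose[OF code_measurable[OF aXA EXA] \<phi>m])
    then show ?thesis by (simp add: Z_def measurable_distr_eq2)
  qed
  have p2Z: "p2 \<in> measurable Z X0"
  proof -
    have "(\<lambda>z. \<lambda>k. inv_into UNIV \<phi> z (cenc (2 * k + 1, \<one>))) \<in> measurable Z borel"
    proof (rule measurable_coordinatewise_then_product)
      fix k
      show "(\<lambda>z. inv_into UNIV \<phi> z (cenc (2 * k + 1, \<one>))) \<in> borel_measurable Z"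
      proof -
        have 1: "inv_into UNIV \<phi> \<in> measurable Z borel" by (rule cf(4))
        have 2: "(\<lambda>s :: nat \<Rightarrow> real. s (cenc (2 * k + 1, \<one>))) \<in> borel_measurable borel"
          by (rule measurable_product_coordinates)
        show ?thesis by (rule measurable_compose[OF 1 2])
      qed
    qed
    then show ?thesis unfolding p2_def by (rule measurable_compose[OF _ \<rho>])
  qed
  have p2p1: "p2 (p1 x) = p x" if "x \<in> space X" for x
  proof -
    have "(\<lambda>k. code E x (cenc (2 * k + 1, \<one>))) = \<theta> (p x)"
      using code_one[OF that, of E] by (auto simp: E_def fun_eq_iff)
    then have "p2 (p1 x) = \<rho> (\<theta> (p x))" by (simp add: p2_def p1_def \<psi>\<phi>)
    also have "\<dots> = p x" by (rule \<rho>\<theta>) (use p_meas that in \<open>auto dest: measurable_space\<close>)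
    finally show ?thesis .
  qed
  have dp1: "distr X Z p1 = Z" using cf(2) by (simp add: factor_map_def)
  have "factor_map G Z c X0 b p2"
    unfolding factor_map_def
  proof (intro conjI ballI)
    show "p2 \<in> measurable Z X0" by (rule p2Z)
    have "distr Z X0 p2 = distr (distr X Z p1) X0 p2" by (simp add: dp1)
    also have "\<dots> = distr X X0 (p2 \<circ> p1)" by (rule distr_distr[OF p2Z p1Z])
    also have "\<dots> = distr X X0 p" by (rule distr_cong) (use p2p1 in auto)
    also have "\<dots> = X0" by (rule p_distr)
    finally show "distr Z X0 p2 = X0" .
    fix g assume g: "g \<in> carrier G"
    have bm: "b g \<in> measurable X0 X0" using X0 g by (simp add: pmp_action_def)
    have u: "(\<lambda>z. p2 (c g z)) \<in> measurable Z X0" by (rule measurable_compose[OF cf(6)[OF g] p2Z])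
    have v: "(\<lambda>z. b g (p2 z)) \<in> measurable Z X0" by (rule measurable_compose[OF p2Z bm])
    \<comment> \<open>The embedding \<theta> turns equality of points of the base into countably
      many equations between real functions. Measurability of this set is what transports
      equivariance from \<open>X\<close> to the push-forward.\<close>
    have "{z \<in> space Z. p2 (c g z) = b g (p2 z)} = {z \<in> space Z. \<forall>k. \<theta> (p2 (c g z)) k = \<theta> (b g (p2 z)) k}"
    proof (intro Collect_cong conj_cong refl iffI)
      fix z assume z: "z \<in> space Z" and "\<forall>k. \<theta> (p2 (c g z)) k = \<theta> (b g (p2 z)) k"
      then have "\<theta> (p2 (c g z)) = \<theta> (b g (p2 z))" by auto
      then show "p2 (c g z) = b g (p2 z)"
        using \<rho>\<theta>[OF measurable_space[OF u z]] \<rho>\<theta>[OF measurable_space[OF v z]] by metis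
    qed auto
    also have "\<dots> \<in> sets Z"
    proof -
      have [measurable]: "(\<lambda>z. \<theta> (p2 (c g z)) k) \<in> borel_measurable Z" "(\<lambda>z. \<theta> (b g (p2 z)) k) \<in> borel_measurable Z" for k
        by (rule measurable_compose[OF measurable_compose[OF u \<theta>] measurable_product_coordinates])
           (rule measurable_compose[OF measurable_compose[OF v \<theta>] measurable_product_coordinates])
      show ?thesis by measurable
    qed
    finally have m: "{z \<in> space Z. p2 (c g z) = b g (p2 z)} \<in> sets Z" .
    have "AE x in X. p (a g x) = b g (p x)" using factor g by (simp add: factor_map_def)
    then have "AE x in X. p2 (c g (p1 x)) = b g (p2 (p1 x))"
    proof (rule AE_mp, intro AE_I2 impI)
      fix x assume x: "x \<in> space X" and e: "p (a g x) = b g (p x)"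
      show "p2 (c g (p1 x)) = b g (p2 (p1 x))"
        using cf(5)[OF g x] p2p1[OF act_space[OF g x]] p2p1[OF x] e by simp
    qed
    then have "AE z in distr X Z p1. p2 (c g z) = b g (p2 z)"
      by (subst AE_distr_iff[OF p1Z m])
    then show "AE z in Z. p2 (c g z) = b g (p2 z)" unfolding dp1 .
  qed
  then have ext: "intermediate_extension G X a X0 b p Z c p1 p2"
    using cf(1,2) p2p1 by (auto simp: intermediate_extension_def)
  \<comment> \<open>The generators of the crossed product of the factor. They lie in
    \<open>N\<close>; what remains is that every von Neumann algebra containing them contains
    \<open>N\<close>.\<close>
  define S where "S = {mult_op (\<lambda>x. f (p1 x)) | f. f \<in> Linfty Z} \<union> group_op G a ` carrier G"
  have fp1: "(\<lambda>x. f (p1 x)) \<in> Linfty X" if f: "f \<in> Linfty Z" for f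
  proof -
    obtain C where C: "AE z in Z. cmod (f z) \<le> C" and m: "f \<in> borel_measurable Z" using f by (auto simp: Linfty_def)
    have "AE z in distr X Z p1. cmod (f z) \<le> C" using C unfolding dp1 .
    from AE_distrD[OF p1Z this] have "AE x in X. cmod (f (p1 x)) \<le> C" .
    then show ?thesis using measurable_compose[OF p1Z m] by (auto simp: Linfty_def)
  qed
  have "mult_op (\<lambda>x. f (p1 x)) \<in> N" if f: "f \<in> Linfty Z" for f
  proof -
    have "f \<in> borel_measurable Z" using f by (simp add: Linfty_def)
    then have "(\<lambda>x. f (p1 x)) \<in> borel_measurable (mult_space N')"
      unfolding XA_def[symmetric] by (rule measurable_compose[OF p1XA])
    then have "(\<lambda>x. f (p1 x)) \<in> mults N'" by (rule mults_if_measurable[OF N'b fp1[OF f]])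
    then show ?thesis using NN' by (simp add: mults_def)
  qed
  then have SN: "S \<subseteq> N" using group_in_N by (auto simp: S_def)
  have Sb: "S \<subseteq> bounded_ops H" using SN N_bounded by auto
  have Sadj: "\<exists>s'\<in>S. adjoint_ops H s s'" if "s \<in> S" for s
    using that unfolding S_def
  proof (elim UnE)
    assume "s \<in> {mult_op (\<lambda>x. f (p1 x)) | f. f \<in> Linfty Z}"
    then obtain f where s: "s = mult_op (\<lambda>x. f (p1 x))" and f: "f \<in> Linfty Z" by blast
    have "mult_op (\<lambda>x. cnj (f (p1 x))) \<in> {mult_op (\<lambda>x. f (p1 x)) | f. f \<in> Linfty Z}"
      using Linfty_cnj[OF f] by (intro CollectI exI[of _ "\<lambda>z. cnj (f z)"]) simp
    then show "\<exists>s'\<in>{mult_op (\<lambda>x. f (p1 x)) | f. f \<in> Linfty Z} \<union> group_op G a ` carrier G. adjoint_ops H s s'"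
      using mult_op_adjoint s by blast
  next
    assume "s \<in> group_op G a ` carrier G"
    then obtain g where s: "s = group_op G a g" and g: "g \<in> carrier G" by blast
    show "\<exists>s'\<in>{mult_op (\<lambda>x. f (p1 x)) | f. f \<in> Linfty Z} \<union> group_op G a ` carrier G. adjoint_ops H s s'"
      using group_op_adjoint[OF g] s g by (intro bexI[of _ "group_op G a (inv g)"]) auto
  qed
  define S' where "S' = commutant H S"
  have S'b: "S' \<subseteq> bounded_ops H" unfolding S'_def by (rule commutant_subset_bounded)
  have SS': "S \<subseteq> commutant H S'" unfolding S'_def by (rule commutant_commutant_superset[OF Sb])
  have indB: "indicator (B n) \<in> mults S'" for n
  proof -
    \<comment> \<open>The coordinate \<open>(2 * n, \<one>)\<close> of the code is the indicator of
      \<open>B n\<close>, so comparing it with 1 recovers that set by a function on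
      \<open>Z\<close>.\<close>
    define f where "f z = complex_of_real (indicator {1} (inv_into UNIV \<phi> z (cenc (2 * n, \<one>))))" for z
    have "(\<lambda>z. inv_into UNIV \<phi> z (cenc (2 * n, \<one>))) \<in> borel_measurable Z"
      by (rule measurable_compose[OF cf(4) measurable_product_coordinates])
    then have "f \<in> borel_measurable Z" unfolding f_def by measurable
    then have f: "f \<in> Linfty Z" by (auto simp: Linfty_def f_def indicator_def intro!: exI[of _ 1])
    then have "mult_op (\<lambda>x. f (p1 x)) \<in> S" by (auto simp: S_def)
    then have "(\<lambda>x. f (p1 x)) \<in> mults S'" using SS' fp1[OF f] by (auto simp: mults_def)
    then show ?thesis
    proof (rule mults_cong[OF S'b])
      fix x assume "x \<in> space X"
      then show "indicator (B n) x = f (p1 x)"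
        using code_one[of x E "2 * n"] by (simp add: f_def p1_def \<psi>\<phi> E_def indicator_def)
    qed
  qed
  have BX: "B n \<in> sets X" for n using B[of n] by (simp add: mult_sets_def)
  \<comment> \<open>Density in measure makes every set of the \<sigma>-algebra of \<open>N\<close>
    available, although only the sequence \<open>B\<close> was coded.\<close>
  have indD: "indicator D \<in> mults S'" if "D \<in> sets XA" for D
    by (rule mults_indicator_dense[OF S'b indB BX _ dense])
       (use that sXA(1) in \<open>auto simp: mult_sets_def\<close>)
  have "N \<subseteq> commutant H S'"
    unfolding S'_def
  proof (rule N_subset_bicommutant[OF _ Sadj])
    show "S \<subseteq> commutant H rops" using SN N_rops by blast
    show "group_op G a g \<in> S" if "g \<in> carrier G" for g using that by (auto simp: S_def)
    fix f assume f: "f \<in> Linfty X" "mult_op f \<in> N"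
    have fN: "f \<in> mults N'" using f NN' by (simp add: mults_def)
    have "f \<in> borel_measurable XA" unfolding XA_def by (rule mults_measurable[OF N'b N'adj fN])
    from mults_simple_approx[OF S'b sXA(3) indD f(1) this] have "f \<in> mults S'" .
    then show "mult_op f \<in> commutant H (commutant H S)" by (simp add: mults_def S'_def)
  qed
  \<comment> \<open>A von Neumann algebra equals its bicommutant, so one containing \<open>S\<close>
    contains the bicommutant of \<open>S\<close>.\<close>
  then have "N \<subseteq> A" if "von_neumann_algebra H A" "S \<subseteq> A" for A
    using that commutant_antimono[OF commutant_antimono[OF that(2), of H], of H]
    unfolding S'_def von_neumann_algebra_def by blast
  then have "N = vn_generated H S"
    unfolding vn_generated_def using N_vN SN by blast
  then have "N = crossed_product_via G X a Z p1"
    by (simp add: crossed_product_via_def S_def)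
  then show ?thesis using ext by blast
qed

theorem theorem1p3:
  fixes G :: "('g, 'm) monoid_scheme"
    and X :: "'x measure" and a :: "'g \<Rightarrow> 'x \<Rightarrow> 'x"
    and X0 :: "'y measure" and b :: "'g \<Rightarrow> 'y \<Rightarrow> 'y"
    and p :: "'x \<Rightarrow> 'y"
    and N :: "(('x \<times> 'g \<Rightarrow> complex) \<Rightarrow> ('x \<times> 'g \<Rightarrow> complex)) set"
  assumes "group G" and "countable (carrier G)" and "icc G"
    and "pmp_action G X0 b"
    and "ergodic_action G X a"
    and "compact_extension G X a X0 b p"
    and "von_neumann_algebra (crossed_space G X) N"
    and "crossed_product_via G X a X0 p \<subseteq> N"
    and "N \<subseteq> crossed_product G X a"
  shows "\<exists>(Z :: real measure) (c :: 'g \<Rightarrow> real \<Rightarrow> real) (p1 :: 'x \<Rightarrow> real) (p2 :: real \<Rightarrow> 'y).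
           intermediate_extension G X a X0 b p Z c p1 p2 \<and>
           N = crossed_product_via G X a Z p1"
proof -
  have pmp: "pmp_action G X a" using assms by (simp add: ergodic_action_def)
  interpret group G by fact
  interpret intermediate_algebra G X a X0 b p N
    by unfold_locales (use assms pmp in auto)
  show ?thesis
    by (rule ex_intermediate_extension) (use assms pmp in \<open>auto simp: pmp_action_def\<close>)
qed

end
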